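(* Let $V$ be a complex locally convex space with a continuous hermitian scalar product $\langle\cdot,\cdot\rangle\colon V\times V\to\mathbb{C}$. The projective space $\mathbb{P}(V)$ with the Hermitean form $H$ is a locally convex Kähler manifold. The tautological bundle $\mathbb{L}(V)\to\mathbb{P}(V)$, equipped with the connection inherited from the $\mathrm{U}(1)$-principal connection 1-form $\alpha$ on $\mathbb{S}(V)\to\mathbb{P}(V)$, is a prequantum line bundle for the corresponding symplectic form $\Omega=\mathrm{Im}\,H$.
   Context: The scalar product is positive definite, antilinear in the first and linear in the second argument; continuity is with respect to the given locally convex topology of $V$ (not necessarily the norm topology of the scalar product). Smoothness is in the sense of Michal–Bastiani. $\mathbb{P}(V)$ carries the quotient topology of $V\setminus\{0\}$ and, for each unit vector $\psi$, the chart $\kappa_\psi\colon\{[\chi]:\langle\psi,\chi\rangle\ne0\}\to T_{[\psi]}:=\{v\in V:\langle\psi,v\rangle=0\}$, $\kappa_\psi([\chi])=\langle\psi,\chi\rangle^{-1}\chi-\psi$, with inverse $v\mapsto[\psi+v]$. Tangent vectors at $[\psi]$ are identified with elements of $T_{[\psi]}$ by the differential of $\kappa_\psi$ at $[\psi]$ ($\|\psi\|=1$). The Hermitean form is $H_{[\psi]}(\delta v,\delta w)=2\langle\delta v,\delta w\rangle$, and $\Omega_{[\psi]}(\delta v,\delta w)=2\,\mathrm{Im}\langle\delta v,\delta w\rangle$. A (locally convex) Kähler manifold is a complex manifold modelled on locally convex spaces with a smooth positive definite Hermitean form $H$ whose imaginary part $\Omega$ is a symplectic form, i.e. closed and weakly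 nondegenerate ($\Omega(\delta v,\delta w)=0$ for all $\delta w$ implies $\delta v=0$). $\mathbb{S}(V)=\{\psi\in V:\|\psi\|=1\}$ is a locally convex manifold with charts $\{\chi\in\mathbb{S}(V):\mathrm{Re}\langle\psi,\chi\rangle>0\}\to T_\psi:=\{v\in V:\mathrm{Re}\langle\psi,v\rangle=0\}$, $\chi\mapsto(\mathrm{Re}\langle\psi,\chi\rangle)^{-1}\chi-\psi$, so $T_\psi\mathbb{S}(V)\cong T_\psi$; the projection $\pi\colon\mathbb{S}(V)\to\mathbb{P}(V)$ is a principal $\mathrm{U}(1)$-bundle for scalar multiplication. The 1-form $\alpha$ on $\mathbb{S}(V)$ is $\alpha_\psi(\delta v)=-i\langle\psi,\delta v\rangle$ (the Lie algebra of $\mathrm{U}(1)$ is identified with $\mathbb{R}$ through $t\mapsto e^{it}$). $\mathbb{L}(V)=\mathbb{S}(V)\times_{\mathrm{U}(1)}\mathbb{C}$ is the line bundle associated to $\mathbb{S}(V)$ along the canonical representation $\mathrm{U}(1)\to\mathrm{GL}(\mathbb{C})$; it is the tautological line bundle, whose fibre over $[\psi]$ is the line $\mathbb{C}\psi$. That it is a prequantum line bundle for $\Omega$ means that its connection, associated to the principal connection $\alpha$, has curvature $\Omega$, i.e. $d\alpha=\pi^*\Omega$. *)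

theory Defs
  imports "HOL-Analysis.Analysis"
begin

section \<open>Locally convex spaces and hermitian scalar products\<close>

text \<open>Not assumed to be Hausdorff: wherever limits have to be unique, the sort
  \<^class>\<open>t2_space\<close> is added.\<close>

class lc_space = real_vector + topological_ab_group_add +
  assumes tendsto_scaleR_Pair:
      "LIM z (nhds r \<times>\<^sub>F nhds x). fst z *\<^sub>R snd z :> nhds (r *\<^sub>R x)"
    and locally_convex: "open U \<Longrightarrow> 0 \<in> U \<Longrightarrow> \<exists>W. open W \<and> 0 \<in> W \<and> W \<subseteq> U \<and>
      (\<forall>x\<in>W. \<forall>y\<in>W. \<forall>u\<ge>0. \<forall>v\<ge>0. u + v = 1 \<longrightarrow> u *\<^sub>R x + v *\<^sub>R y \<in> W)"

lemma locally_convex_0: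
  fixes U :: "'a::lc_space set"
  assumes "open U" "0 \<in> U"
  obtains W where "open W" "0 \<in> W" "convex W" "W \<subseteq> U"
proof -
  obtain W where W: "open W" "0 \<in> W" "W \<subseteq> U"
      "\<forall>x\<in>W. \<forall>y\<in>W. \<forall>u\<ge>0. \<forall>v\<ge>0. u + v = 1 \<longrightarrow> u *\<^sub>R x + v *\<^sub>R y \<in> W"
    using locally_convex[OF assms] by (elim exE conjE)
  from W(4) have "convex W"
    unfolding convex_def .
  with W that show thesis by simp
qed

lemma tendsto_scaleR_lc:
  fixes x :: "'a::lc_space"
  shows "(f \<longlongrightarrow> r) F \<Longrightarrow> (g \<longlongrightarrow> x) F \<Longrightarrow> ((\<lambda>z. f z *\<^sub>R g z) \<longlongrightarrow> r *\<^sub>R x) F"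
  using filterlim_compose[OF tendsto_scaleR_Pair, of "\<lambda>z. (f z, g z)" r x F]
  by (simp add: nhds_prod[symmetric] tendsto_Pair)

instance real_normed_vector \<subseteq> lc_space
proof
  fix r :: real and x :: 'a
  have "((\<lambda>z. fst z *\<^sub>R snd z) \<longlongrightarrow> fst (r, x) *\<^sub>R snd (r, x)) (nhds (r, x))"
    by (intro tendsto_scaleR tendsto_fst tendsto_snd filterlim_ident)
  then show "LIM z (nhds r \<times>\<^sub>F nhds x). fst z *\<^sub>R snd z :> nhds (r *\<^sub>R x)"
    by (simp add: nhds_prod)
next
  fix U :: "'a set"
  assume "open U" "0 \<in> U"
  then obtain e where "e > 0" "ball 0 e \<subseteq> U"
    by (meson open_contains_ball)
  then show "\<exists>W. open W \<and> 0 \<in> W \<and> W \<subseteq> U \<and>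
      (\<forall>x\<in>W. \<forall>y\<in>W. \<forall>u\<ge>0. \<forall>v\<ge>0. u + v = 1 \<longrightarrow> u *\<^sub>R x + v *\<^sub>R y \<in> W)"
    by (intro exI[of _ "ball 0 e"] conjI convex_ball[unfolded convex_def]) simp_all
qed

instance prod :: (topological_monoid_add, topological_monoid_add) topological_monoid_add
proof
  fix a b :: "'a \<times> 'b"
  have "((\<lambda>z. (fst (fst z) + fst (snd z), snd (fst z) + snd (snd z))) \<longlongrightarrow>
      (fst (fst (a, b)) + fst (snd (a, b)), snd (fst (a, b)) + snd (snd (a, b)))) (nhds (a, b))"
    by (intro tendsto_Pair tendsto_add tendsto_fst tendsto_snd filterlim_ident)
  then show "LIM z (nhds a \<times>\<^sub>F nhds b). fst z + snd z :> nhds (a + b)"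
    by (simp add: nhds_prod plus_prod_def)
qed

instance prod :: (topological_comm_monoid_add, topological_comm_monoid_add)
  topological_comm_monoid_add ..

instance prod :: (topological_group_add, topological_group_add) topological_group_add
proof
  fix a :: "'a \<times> 'b"
  have eq: "uminus = (\<lambda>z::'a \<times> 'b. (- fst z, - snd z))"
    by (rule ext) (simp add: uminus_prod_def)
  show "(uminus \<longlongrightarrow> - a) (nhds a)"
    unfolding eq by (intro tendsto_Pair tendsto_minus tendsto_fst tendsto_snd filterlim_ident)
qed

instance prod :: (topological_ab_group_add, topological_ab_group_add)
  topological_ab_group_add ..

instance prod :: (lc_space, lc_space) lc_space
proof
  fix r :: real and x :: "'a \<times> 'b"
  have 1: "LIM z (nhds (r, x)). fst z *\<^sub>R fst (snd z) :> nhds (r *\<^sub>R fst x)"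
    using tendsto_scaleR_lc[OF tendsto_fst[OF filterlim_ident, of "(r, x)"]
      tendsto_fst[OF tendsto_snd[OF filterlim_ident, of "(r, x)"]]] by simp
  have 2: "LIM z (nhds (r, x)). fst z *\<^sub>R snd (snd z) :> nhds (r *\<^sub>R snd x)"
    using tendsto_scaleR_lc[OF tendsto_fst[OF filterlim_ident, of "(r, x)"]
      tendsto_snd[OF tendsto_snd[OF filterlim_ident, of "(r, x)"]]] by simp
  show "LIM z (nhds r \<times>\<^sub>F nhds x). fst z *\<^sub>R snd z :> nhds (r *\<^sub>R x)"
    using tendsto_Pair[OF 1 2] by (simp add: nhds_prod scaleR_prod_def)
next
  fix U :: "('a \<times> 'b) set"
  assume "open U" "0 \<in> U"
  then obtain A B where AB: "open A" "open B" "0 \<in> A \<times> B" "A \<times> B \<subseteq> U"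
    by (metis open_prod_elim)
  then have "0 \<in> A" "0 \<in> B" by (auto simp: zero_prod_def)
  obtain A' where A': "open A'" "0 \<in> A'" "convex A'" "A' \<subseteq> A"
    using locally_convex_0[OF AB(1) \<open>0 \<in> A\<close>] .
  obtain B' where B': "open B'" "0 \<in> B'" "convex B'" "B' \<subseteq> B"
    using locally_convex_0[OF AB(2) \<open>0 \<in> B\<close>] .
  have "A' \<times> B' \<subseteq> U"
    using AB(4) A'(4) B'(4) by auto
  then show "\<exists>W. open W \<and> 0 \<in> W \<and> W \<subseteq> U \<and>
      (\<forall>x\<in>W. \<forall>y\<in>W. \<forall>u\<ge>0. \<forall>v\<ge>0. u + v = 1 \<longrightarrow> u *\<^sub>R x + v *\<^sub>R y \<in> W)"
    using A'(1,2) B'(1,2)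
    by (intro exI[of _ "A' \<times> B'"] conjI convex_Times[OF A'(3) B'(3), unfolded convex_def])
       (simp_all add: zero_prod_def open_Times)
qed

class complex_vector = real_vector +
  fixes scaleC :: "complex \<Rightarrow> 'a \<Rightarrow> 'a" (infixr "*\<^sub>C" 75)
  assumes scaleC_add_right: "c *\<^sub>C (x + y) = c *\<^sub>C x + c *\<^sub>C y"
    and scaleC_add_left: "(b + c) *\<^sub>C x = b *\<^sub>C x + c *\<^sub>C x"
    and scaleC_scaleC: "b *\<^sub>C c *\<^sub>C x = (b * c) *\<^sub>C x"
    and scaleC_one: "1 *\<^sub>C x = x"
    and scaleR_scaleC: "r *\<^sub>R x = complex_of_real r *\<^sub>C x"

class complex_lc_space = complex_vector + lc_space +
  assumes tendsto_scaleC_Pair: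
      "LIM z (nhds c \<times>\<^sub>F nhds x). fst z *\<^sub>C snd z :> nhds (c *\<^sub>C x)"

lemma tendsto_scaleC:
  fixes x :: "'a::complex_lc_space"
  shows "(f \<longlongrightarrow> c) F \<Longrightarrow> (g \<longlongrightarrow> x) F \<Longrightarrow> ((\<lambda>z. f z *\<^sub>C g z) \<longlongrightarrow> c *\<^sub>C x) F"
  using filterlim_compose[OF tendsto_scaleC_Pair, of "\<lambda>z. (f z, g z)" c x F]
  by (simp add: nhds_prod[symmetric] tendsto_Pair)

text \<open>The topology is the given locally convex one; it is in general finer than the norm
  topology of the scalar product.\<close>

class hermitian_lc_space = complex_lc_space +
  fixes cinner :: "'a \<Rightarrow> 'a \<Rightarrow> complex"
  assumes cinner_add_right: "cinner x (y + z) = cinner x y + cinner x z"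
    and cinner_scaleC_right: "cinner x (c *\<^sub>C y) = c * cinner x y"
    and cinner_commute: "cinner x y = cnj (cinner y x)"
    and cinner_pos: "x \<noteq> 0 \<Longrightarrow> 0 < Re (cinner x x)"
    and tendsto_cinner_Pair:
      "LIM z (nhds x \<times>\<^sub>F nhds y). cinner (fst z) (snd z) :> nhds (cinner x y)"

lemma tendsto_cinner:
  fixes x y :: "'a::hermitian_lc_space"
  shows "(f \<longlongrightarrow> x) F \<Longrightarrow> (g \<longlongrightarrow> y) F \<Longrightarrow> ((\<lambda>z. cinner (f z) (g z)) \<longlongrightarrow> cinner x y) F"
  using filterlim_compose[OF tendsto_cinner_Pair, of "\<lambda>z. (f z, g z)" x y F]
  by (simp add: nhds_prod[symmetric] tendsto_Pair)

instance hermitian_lc_space \<subseteq> t2_space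
proof
  fix x y :: 'a
  assume "x \<noteq> y"
  define f where "f z = Re (cinner (x - y) (z - y))" for z
  have f_y: "f y = 0"
    using cinner_add_right[of "x - y" 0 0] by (simp add: f_def)
  have f_x: "f x > 0"
    using \<open>x \<noteq> y\<close> cinner_pos[of "x - y"] by (simp add: f_def)
  have "continuous_on UNIV f"
  proof -
    have "((\<lambda>z. cinner (x - y) (z - y)) \<longlongrightarrow> cinner (x - y) (a - y)) (at a)" for a
      by (intro tendsto_cinner tendsto_diff tendsto_const tendsto_ident_at)
    then show ?thesis
      unfolding f_def continuous_on_def by (auto intro!: tendsto_Re)
  qed
  then have "open {z. f x / 2 < f z}" "open {z. f z < f x / 2}"
    by (intro open_Collect_less continuous_on_const; assumption)+
  moreover have "x \<in> {z. f x / 2 < f z}" "y \<in> {z. f z < f x / 2}"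
      "{z. f x / 2 < f z} \<inter> {z. f z < f x / 2} = {}"
    using f_y f_x by auto
  ultimately show "\<exists>U V. open U \<and> open V \<and> x \<in> U \<and> y \<in> V \<and> U \<inter> V = {}"
    by blast
qed

instantiation complex :: hermitian_lc_space
begin

definition scaleC_complex_def: "scaleC (c::complex) (x::complex) = c * x"
definition cinner_complex_def: "cinner (x::complex) y = cnj x * y"

instance
proof
  fix x y z b c :: complex and r :: real
  show "c *\<^sub>C (x + y) = c *\<^sub>C x + c *\<^sub>C y" "(b + c) *\<^sub>C x = b *\<^sub>C x + c *\<^sub>C x"
    "b *\<^sub>C c *\<^sub>C x = (b * c) *\<^sub>C x" "1 *\<^sub>C x = x"
    by (simp_all add: scaleC_complex_def algebra_simps)
  show "r *\<^sub>R x = complex_of_real r *\<^sub>C x"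
    by (simp only: scaleC_complex_def scaleR_conv_of_real)
  show "cinner x (y + z) = cinner x y + cinner x z" "cinner x (c *\<^sub>C y) = c * cinner x y"
    "cinner x y = cnj (cinner y x)"
    by (simp_all add: scaleC_complex_def cinner_complex_def algebra_simps)
  show "0 < Re (cinner x x)" if "x \<noteq> 0"
    using that complex_neq_0[of x] by (simp add: cinner_complex_def power2_eq_square)
  have "((\<lambda>z. fst z * snd z) \<longlongrightarrow> fst (c, x) * snd (c, x)) (nhds (c, x))"
    by (intro tendsto_mult tendsto_fst tendsto_snd filterlim_ident)
  then show "LIM z (nhds c \<times>\<^sub>F nhds x). fst z *\<^sub>C snd z :> nhds (c *\<^sub>C x)"
    by (simp add: nhds_prod scaleC_complex_def)
  have "((\<lambda>z. cnj (fst z) * snd z) \<longlongrightarrow> cnj (fst (x, y)) * snd (x, y)) (nhds (x, y))"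
    by (intro tendsto_mult tendsto_cnj tendsto_fst tendsto_snd filterlim_ident)
  then show "LIM z (nhds x \<times>\<^sub>F nhds y). cinner (fst z) (snd z) :> nhds (cinner x y)"
    by (simp add: nhds_prod cinner_complex_def)
qed

end

definition hnorm :: "'v::hermitian_lc_space \<Rightarrow> real" where
  "hnorm x = sqrt (Re (cinner x x))"

lemma hnorm_complex: "hnorm (z::complex) = cmod z"
  unfolding hnorm_def cinner_complex_def cmod_def by (simp add: power2_eq_square)


section \<open>Smooth maps in the sense of Michal and Bastiani\<close>

definition has_dirderiv ::
    "('a::real_vector \<Rightarrow> 'b::{lc_space,t2_space}) \<Rightarrow> 'a \<Rightarrow> 'a \<Rightarrow> 'b \<Rightarrow> bool" where
  "has_dirderiv f x h l \<longleftrightarrow> ((\<lambda>t::real. (1 / t) *\<^sub>R (f (x + t *\<^sub>R h) - f x)) \<longlongrightarrow> l) (at 0)"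

definition dirderiv ::
    "('a::real_vector \<Rightarrow> 'b::{lc_space,t2_space}) \<Rightarrow> 'a \<Rightarrow> 'a \<Rightarrow> 'b" where
  "dirderiv f x h = Lim (at 0) (\<lambda>t::real. (1 / t) *\<^sub>R (f (x + t *\<^sub>R h) - f x))"

text \<open>\<open>iter_dirderiv f k h x\<close> is the iterated directional derivative of \<open>f\<close> at \<open>x\<close> in the
  directions \<open>h 0\<close>, \ldots, \<open>h (k - 1)\<close>.\<close>

primrec iter_dirderiv ::
    "('a::real_vector \<Rightarrow> 'b::{lc_space,t2_space}) \<Rightarrow> nat \<Rightarrow> (nat \<Rightarrow> 'a) \<Rightarrow> 'a \<Rightarrow> 'b" where
  "iter_dirderiv f 0 h x = f x"
| "iter_dirderiv f (Suc k) h x = dirderiv (iter_dirderiv f k h) x (h k)"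

text \<open>\<open>smooth_on E U f\<close>: on the open subset \<open>U\<close> of the linear subspace \<open>E\<close>, all iterated
  directional derivatives of \<open>f\<close> in directions from \<open>E\<close> exist and are jointly continuous
  in the point and the directions. The \<open>k\<close>-th derivative depends only on the first \<open>k\<close>
  directions, so continuity on \<open>U \<times> E\<^sup>\<nat>\<close> (product topology) is continuity on \<open>U \<times> E\<^sup>k\<close>.
  Directional derivatives at points of \<open>U\<close> do not depend on the values of \<open>f\<close> outside \<open>U\<close>.\<close>

definition smooth_on ::
    "'a::lc_space set \<Rightarrow> 'a set \<Rightarrow> ('a \<Rightarrow> 'b::{lc_space,t2_space}) \<Rightarrow> bool" where
  "smooth_on E U f \<longleftrightarrow> openin (top_of_set E) U \<and>
     (\<forall>k. (\<forall>h \<in> UNIV \<rightarrow> E. \<forall>x \<in> U. \<exists>l. has_dirderiv (iter_dirderiv f k h) x (h k) l) \<and>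
          continuous_on (U \<times> (UNIV \<rightarrow> E)) (\<lambda>(x, h). iter_dirderiv f k h x))"


section \<open>Locally convex manifolds\<close>

text \<open>A space with a family of charts. The chart with index \<open>i\<close> maps \<open>mdom M i\<close> to the linear
  subspace \<open>mmodel M i\<close> of the ambient type; different charts may have different model spaces.\<close>

record ('m, 'v, 'i) mfd =
  mtop :: "'m topology"
  mix :: "'i set"
  mdom :: "'i \<Rightarrow> 'm set"
  mchart :: "'i \<Rightarrow> 'm \<Rightarrow> 'v"
  mmodel :: "'i \<Rightarrow> 'v set"

abbreviation points :: "('m, 'v, 'i) mfd \<Rightarrow> 'm set" where
  "points M \<equiv> topspace (mtop M)"

definition param :: "('m, 'v, 'i) mfd \<Rightarrow> 'i \<Rightarrow> 'v \<Rightarrow> 'm" where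
  "param M i = inv_into (mdom M i) (mchart M i)"

definition smooth_manifold :: "('m, 'v::{lc_space,t2_space}, 'i) mfd \<Rightarrow> bool" where
  "smooth_manifold M \<longleftrightarrow>
     Hausdorff_space (mtop M) \<and>
     (\<Union>i\<in>mix M. mdom M i) = points M \<and>
     (\<forall>i\<in>mix M.
        openin (mtop M) (mdom M i) \<and>
        subspace (mmodel M i) \<and>
        openin (top_of_set (mmodel M i)) (mchart M i ` mdom M i) \<and>
        homeomorphic_map (subtopology (mtop M) (mdom M i))
          (top_of_set (mchart M i ` mdom M i)) (mchart M i)) \<and>
     (\<forall>i\<in>mix M. \<forall>j\<in>mix M.
        smooth_on (mmodel M i) (mchart M i ` (mdom M i \<inter> mdom M j)) (mchart M j \<circ> param M i))"

definition complex_manifold ::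
    "('m, 'v::{complex_lc_space,t2_space}, 'i) mfd \<Rightarrow> bool" where
  "complex_manifold M \<longleftrightarrow>
     smooth_manifold M \<and>
     (\<forall>i\<in>mix M. \<forall>v\<in>mmodel M i. \<forall>c. c *\<^sub>C v \<in> mmodel M i) \<and>
     (\<forall>i\<in>mix M. \<forall>j\<in>mix M. \<forall>p \<in> mdom M i \<inter> mdom M j. \<forall>v\<in>mmodel M i. \<forall>c.
        dirderiv (mchart M j \<circ> param M i) (mchart M i p) (c *\<^sub>C v) =
        c *\<^sub>C dirderiv (mchart M j \<circ> param M i) (mchart M i p) v)"

definition smooth_map ::
    "('m, 'v::{lc_space,t2_space}, 'i) mfd \<Rightarrow> ('n, 'w::{lc_space,t2_space}, 'j) mfd \<Rightarrow>
     ('m \<Rightarrow> 'n) \<Rightarrow> bool" where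
  "smooth_map M N F \<longleftrightarrow>
     continuous_map (mtop M) (mtop N) F \<and>
     (\<forall>i\<in>mix M. \<forall>j\<in>mix N.
        smooth_on (mmodel M i) (mchart M i ` (mdom M i \<inter> F -` mdom N j))
          (mchart N j \<circ> F \<circ> param M i))"

definition diffeomorphism ::
    "('m, 'v::{lc_space,t2_space}, 'i) mfd \<Rightarrow> ('n, 'w::{lc_space,t2_space}, 'j) mfd \<Rightarrow>
     ('m \<Rightarrow> 'n) \<Rightarrow> bool" where
  "diffeomorphism M N F \<longleftrightarrow> smooth_map M N F \<and>
     (\<exists>G. smooth_map N M G \<and> (\<forall>p\<in>points M. G (F p) = p) \<and> (\<forall>q\<in>points N. F (G q) = q))"

definition open_submfd :: "('m, 'v, 'i) mfd \<Rightarrow> 'm set \<Rightarrow> ('m, 'v, 'i) mfd" where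
  "open_submfd M W =
     M\<lparr>mtop := subtopology (mtop M) W, mdom := \<lambda>i. mdom M i \<inter> W\<rparr>"

definition prod_mfd ::
    "('m, 'v, 'i) mfd \<Rightarrow> ('n, 'w, 'j) mfd \<Rightarrow> ('m \<times> 'n, 'v \<times> 'w, 'i \<times> 'j) mfd" where
  "prod_mfd M N =
     \<lparr>mtop = prod_topology (mtop M) (mtop N),
      mix = mix M \<times> mix N,
      mdom = \<lambda>(i, j). mdom M i \<times> mdom N j,
      mchart = \<lambda>(i, j) (p, q). (mchart M i p, mchart N j q),
      mmodel = \<lambda>(i, j). mmodel M i \<times> mmodel N j\<rparr>"

definition complex_plane :: "(complex, complex, unit) mfd" where
  "complex_plane =
     \<lparr>mtop = euclidean, mix = UNIV, mdom = \<lambda>_. UNIV, mchart = \<lambda>_. id, mmodel = \<lambda>_. UNIV\<rparr>"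


section \<open>Tangent vectors and differential forms\<close>

text \<open>A tangent vector at \<open>p\<close> is the family of its representatives in all charts around \<open>p\<close>,
  related by the differentials of the chart changes (and \<open>0\<close> at all other indices). Hence the
  differential at \<open>p\<close> of the chart with index \<open>i\<close> sends \<open>\<xi>\<close> to \<open>\<xi> i\<close>, and the vector space
  operations are componentwise.\<close>

definition tangent_space :: "('m, 'v::{lc_space,t2_space}, 'i) mfd \<Rightarrow> 'm \<Rightarrow> ('i \<Rightarrow> 'v) set" where
  "tangent_space M p = {\<xi>.
     (\<forall>i\<in>{i \<in> mix M. p \<in> mdom M i}. \<xi> i \<in> mmodel M i \<and>
        (\<forall>j\<in>{j \<in> mix M. p \<in> mdom M j}.
           \<xi> j = dirderiv (mchart M j \<circ> param M i) (mchart M i p) (\<xi> i))) \<and>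
     (\<forall>i. \<not> (i \<in> mix M \<and> p \<in> mdom M i) \<longrightarrow> \<xi> i = 0)}"

definition tangent_vector ::
    "('m, 'v::{lc_space,t2_space}, 'i) mfd \<Rightarrow> 'i \<Rightarrow> 'm \<Rightarrow> 'v \<Rightarrow> 'i \<Rightarrow> 'v" where
  "tangent_vector M i p v = (\<lambda>j. if j \<in> mix M \<and> p \<in> mdom M j
     then dirderiv (mchart M j \<circ> param M i) (mchart M i p) v else 0)"

definition chart_at :: "('m, 'v, 'i) mfd \<Rightarrow> 'm \<Rightarrow> 'i" where
  "chart_at M p = (SOME i. i \<in> mix M \<and> p \<in> mdom M i)"

text \<open>The next two definitions do not depend on the chart chosen by \<^const>\<open>chart_at\<close>, by the
  chain rule.\<close>

definition tangent_map ::
    "('m, 'v::{lc_space,t2_space}, 'i) mfd \<Rightarrow> ('n, 'w::{lc_space,t2_space}, 'j) mfd \<Rightarrow>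
     ('m \<Rightarrow> 'n) \<Rightarrow> 'm \<Rightarrow> ('i \<Rightarrow> 'v) \<Rightarrow> 'j \<Rightarrow> 'w" where
  "tangent_map M N F p \<xi> = (\<lambda>j. if j \<in> mix N \<and> F p \<in> mdom N j
     then let i = chart_at M p
          in dirderiv (mchart N j \<circ> F \<circ> param M i) (mchart M i p) (\<xi> i)
     else 0)"

definition fun_deriv ::
    "('m, 'v::{lc_space,t2_space}, 'i) mfd \<Rightarrow> ('m \<Rightarrow> 'b::{lc_space,t2_space}) \<Rightarrow>
     'm \<Rightarrow> ('i \<Rightarrow> 'v) \<Rightarrow> 'b" where
  "fun_deriv M f p \<xi> =
     (let i = chart_at M p in dirderiv (f \<circ> param M i) (mchart M i p) (\<xi> i))"

definition local_form1 ::
    "('m, 'v::{lc_space,t2_space}, 'i) mfd \<Rightarrow> ('m \<Rightarrow> ('i \<Rightarrow> 'v) \<Rightarrow> 'b) \<Rightarrow>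
     'i \<Rightarrow> 'v \<Rightarrow> 'v \<Rightarrow> 'b" where
  "local_form1 M \<alpha> i x v = \<alpha> (param M i x) (tangent_vector M i (param M i x) v)"

definition local_form2 ::
    "('m, 'v::{lc_space,t2_space}, 'i) mfd \<Rightarrow> ('m \<Rightarrow> ('i \<Rightarrow> 'v) \<Rightarrow> ('i \<Rightarrow> 'v) \<Rightarrow> 'b) \<Rightarrow>
     'i \<Rightarrow> 'v \<Rightarrow> 'v \<Rightarrow> 'v \<Rightarrow> 'b" where
  "local_form2 M \<omega> i x v w =
     \<omega> (param M i x) (tangent_vector M i (param M i x) v) (tangent_vector M i (param M i x) w)"

definition smooth_tensor2 ::
    "('m, 'v::{lc_space,t2_space}, 'i) mfd \<Rightarrow>
     ('m \<Rightarrow> ('i \<Rightarrow> 'v) \<Rightarrow> ('i \<Rightarrow> 'v) \<Rightarrow> 'b::{lc_space,t2_space}) \<Rightarrow> bool" where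
  "smooth_tensor2 M \<omega> \<longleftrightarrow> (\<forall>i\<in>mix M.
     smooth_on (mmodel M i \<times> mmodel M i \<times> mmodel M i)
       (mchart M i ` mdom M i \<times> mmodel M i \<times> mmodel M i)
       (\<lambda>(x, v, w). local_form2 M \<omega> i x v w))"

definition one_form ::
    "('m, 'v::{lc_space,t2_space}, 'i) mfd \<Rightarrow>
     ('m \<Rightarrow> ('i \<Rightarrow> 'v) \<Rightarrow> 'b::{lc_space,t2_space}) \<Rightarrow> bool" where
  "one_form M \<alpha> \<longleftrightarrow>
     (\<forall>p\<in>points M. \<forall>\<xi>\<in>tangent_space M p. \<forall>\<eta>\<in>tangent_space M p. \<forall>r.
        \<alpha> p (\<lambda>j. \<xi> j + \<eta> j) = \<alpha> p \<xi> + \<alpha> p \<eta> \<and>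
        \<alpha> p (\<lambda>j. r *\<^sub>R \<xi> j) = r *\<^sub>R \<alpha> p \<xi>) \<and>
     (\<forall>i\<in>mix M. smooth_on (mmodel M i \<times> mmodel M i) (mchart M i ` mdom M i \<times> mmodel M i)
        (\<lambda>(x, v). local_form1 M \<alpha> i x v))"

definition two_form ::
    "('m, 'v::{lc_space,t2_space}, 'i) mfd \<Rightarrow>
     ('m \<Rightarrow> ('i \<Rightarrow> 'v) \<Rightarrow> ('i \<Rightarrow> 'v) \<Rightarrow> 'b::{lc_space,t2_space}) \<Rightarrow> bool" where
  "two_form M \<omega> \<longleftrightarrow>
     (\<forall>p\<in>points M. \<forall>\<xi>\<in>tangent_space M p. \<forall>\<eta>\<in>tangent_space M p. \<forall>\<zeta>\<in>tangent_space M p. \<forall>r.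
        \<omega> p (\<lambda>j. \<xi> j + \<eta> j) \<zeta> = \<omega> p \<xi> \<zeta> + \<omega> p \<eta> \<zeta> \<and>
        \<omega> p (\<lambda>j. r *\<^sub>R \<xi> j) \<zeta> = r *\<^sub>R \<omega> p \<xi> \<zeta> \<and>
        \<omega> p \<xi> \<eta> = - \<omega> p \<eta> \<xi>) \<and>
     smooth_tensor2 M \<omega>"

text \<open>Exterior derivatives in the chart with index \<open>i\<close>, evaluated on constant vector fields,
  whose Lie brackets vanish. The convention is
  \<open>d\<alpha>(X, Y) = X \<alpha>(Y) - Y \<alpha>(X) - \<alpha>([X, Y])\<close>.\<close>

definition ext_deriv1 ::
    "('m, 'v::{lc_space,t2_space}, 'i) mfd \<Rightarrow>
     ('m \<Rightarrow> ('i \<Rightarrow> 'v) \<Rightarrow> 'b::{lc_space,t2_space}) \<Rightarrow> 'i \<Rightarrow> 'v \<Rightarrow> 'v \<Rightarrow> 'v \<Rightarrow> 'b" where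
  "ext_deriv1 M \<alpha> i x v w =
     dirderiv (\<lambda>y. local_form1 M \<alpha> i y w) x v - dirderiv (\<lambda>y. local_form1 M \<alpha> i y v) x w"

definition ext_deriv2 ::
    "('m, 'v::{lc_space,t2_space}, 'i) mfd \<Rightarrow>
     ('m \<Rightarrow> ('i \<Rightarrow> 'v) \<Rightarrow> ('i \<Rightarrow> 'v) \<Rightarrow> 'b::{lc_space,t2_space}) \<Rightarrow>
     'i \<Rightarrow> 'v \<Rightarrow> 'v \<Rightarrow> 'v \<Rightarrow> 'v \<Rightarrow> 'b" where
  "ext_deriv2 M \<omega> i x u v w =
     dirderiv (\<lambda>y. local_form2 M \<omega> i y v w) x u
     - dirderiv (\<lambda>y. local_form2 M \<omega> i y u w) x v
     + dirderiv (\<lambda>y. local_form2 M \<omega> i y u v) x w"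

definition is_ext_deriv1 ::
    "('m, 'v::{lc_space,t2_space}, 'i) mfd \<Rightarrow>
     ('m \<Rightarrow> ('i \<Rightarrow> 'v) \<Rightarrow> 'b::{lc_space,t2_space}) \<Rightarrow>
     ('m \<Rightarrow> ('i \<Rightarrow> 'v) \<Rightarrow> ('i \<Rightarrow> 'v) \<Rightarrow> 'b) \<Rightarrow> bool" where
  "is_ext_deriv1 M \<alpha> \<omega> \<longleftrightarrow>
     (\<forall>i\<in>mix M. \<forall>p\<in>mdom M i. \<forall>\<xi>\<in>tangent_space M p. \<forall>\<eta>\<in>tangent_space M p.
        \<omega> p \<xi> \<eta> = ext_deriv1 M \<alpha> i (mchart M i p) (\<xi> i) (\<eta> i))"

definition closed_form2 ::
    "('m, 'v::{lc_space,t2_space}, 'i) mfd \<Rightarrow>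
     ('m \<Rightarrow> ('i \<Rightarrow> 'v) \<Rightarrow> ('i \<Rightarrow> 'v) \<Rightarrow> 'b::{lc_space,t2_space}) \<Rightarrow> bool" where
  "closed_form2 M \<omega> \<longleftrightarrow>
     (\<forall>i\<in>mix M. \<forall>x\<in>mchart M i ` mdom M i.
        \<forall>u\<in>mmodel M i. \<forall>v\<in>mmodel M i. \<forall>w\<in>mmodel M i. ext_deriv2 M \<omega> i x u v w = 0)"

definition pullback2 ::
    "('m, 'v::{lc_space,t2_space}, 'i) mfd \<Rightarrow> ('n, 'w::{lc_space,t2_space}, 'j) mfd \<Rightarrow>
     ('m \<Rightarrow> 'n) \<Rightarrow> ('n \<Rightarrow> ('j \<Rightarrow> 'w) \<Rightarrow> ('j \<Rightarrow> 'w) \<Rightarrow> 'b) \<Rightarrow>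
     'm \<Rightarrow> ('i \<Rightarrow> 'v) \<Rightarrow> ('i \<Rightarrow> 'v) \<Rightarrow> 'b" where
  "pullback2 M N F \<omega> p \<xi> \<eta> =
     \<omega> (F p) (tangent_map M N F p \<xi>) (tangent_map M N F p \<eta>)"


section \<open>Kaehler manifolds\<close>

definition symplectic_form ::
    "('m, 'v::{lc_space,t2_space}, 'i) mfd \<Rightarrow>
     ('m \<Rightarrow> ('i \<Rightarrow> 'v) \<Rightarrow> ('i \<Rightarrow> 'v) \<Rightarrow> real) \<Rightarrow> bool" where
  "symplectic_form M \<Omega> \<longleftrightarrow>
     two_form M \<Omega> \<and> closed_form2 M \<Omega> \<and>
     (\<forall>p\<in>points M. \<forall>\<xi>\<in>tangent_space M p.
        (\<forall>\<eta>\<in>tangent_space M p. \<Omega> p \<xi> \<eta> = 0) \<longrightarrow> \<xi> = (\<lambda>_. 0))"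

definition hermitean_form ::
    "('m, 'v::{complex_lc_space,t2_space}, 'i) mfd \<Rightarrow>
     ('m \<Rightarrow> ('i \<Rightarrow> 'v) \<Rightarrow> ('i \<Rightarrow> 'v) \<Rightarrow> complex) \<Rightarrow> bool" where
  "hermitean_form M H \<longleftrightarrow>
     (\<forall>p\<in>points M. \<forall>\<xi>\<in>tangent_space M p. \<forall>\<eta>\<in>tangent_space M p. \<forall>\<zeta>\<in>tangent_space M p. \<forall>c.
        H p \<xi> (\<lambda>j. \<eta> j + \<zeta> j) = H p \<xi> \<eta> + H p \<xi> \<zeta> \<and>
        H p \<xi> (\<lambda>j. c *\<^sub>C \<eta> j) = c * H p \<xi> \<eta> \<and>
        H p \<eta> \<xi> = cnj (H p \<xi> \<eta>) \<and>
        (\<xi> \<noteq> (\<lambda>_. 0) \<longrightarrow> 0 < Re (H p \<xi> \<xi>))) \<and>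
     smooth_tensor2 M H"

definition kaehler_manifold ::
    "('m, 'v::{complex_lc_space,t2_space}, 'i) mfd \<Rightarrow>
     ('m \<Rightarrow> ('i \<Rightarrow> 'v) \<Rightarrow> ('i \<Rightarrow> 'v) \<Rightarrow> complex) \<Rightarrow> bool" where
  "kaehler_manifold M H \<longleftrightarrow>
     complex_manifold M \<and> hermitean_form M H \<and> symplectic_form M (\<lambda>p \<xi> \<eta>. Im (H p \<xi> \<eta>))"


section \<open>Line bundles with connection\<close>

text \<open>\<open>L\<close> is the total space, \<open>pr\<close> the projection, \<open>add\<close> and \<open>scl\<close> are the operations of the
  fibres. Local trivialisations are linear on fibres, which makes every fibre a
  one-dimensional complex vector space.\<close>

definition complex_line_bundle ::
    "('m, 'v::{lc_space,t2_space}, 'i) mfd \<Rightarrow> ('l, 'w::{lc_space,t2_space}, 'j) mfd \<Rightarrow>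
     ('l \<Rightarrow> 'm) \<Rightarrow> ('l \<Rightarrow> 'l \<Rightarrow> 'l) \<Rightarrow> (complex \<Rightarrow> 'l \<Rightarrow> 'l) \<Rightarrow> bool" where
  "complex_line_bundle M L pr add scl \<longleftrightarrow>
     smooth_manifold M \<and> smooth_manifold L \<and> smooth_map L M pr \<and>
     (\<forall>l\<in>points L. \<forall>l'\<in>points L. pr l' = pr l \<longrightarrow> add l l' \<in> points L \<and> pr (add l l') = pr l) \<and>
     (\<forall>l\<in>points L. \<forall>c. scl c l \<in> points L \<and> pr (scl c l) = pr l) \<and>
     (\<forall>p\<in>points M. \<exists>W \<Phi>. openin (mtop M) W \<and> p \<in> W \<and>
        diffeomorphism (open_submfd L {l \<in> points L. pr l \<in> W})
          (prod_mfd (open_submfd M W) complex_plane) \<Phi> \<and>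
        (\<forall>l\<in>points L. pr l \<in> W \<longrightarrow>
           fst (\<Phi> l) = pr l \<and>
           (\<forall>l'\<in>points L. pr l' = pr l \<longrightarrow> snd (\<Phi> (add l l')) = snd (\<Phi> l) + snd (\<Phi> l')) \<and>
           (\<forall>c. snd (\<Phi> (scl c l)) = c * snd (\<Phi> l))))"

definition smooth_section ::
    "('m, 'v::{lc_space,t2_space}, 'i) mfd \<Rightarrow> ('l, 'w::{lc_space,t2_space}, 'j) mfd \<Rightarrow>
     ('l \<Rightarrow> 'm) \<Rightarrow> 'm set \<Rightarrow> ('m \<Rightarrow> 'l) \<Rightarrow> bool" where
  "smooth_section M L pr W s \<longleftrightarrow>
     openin (mtop M) W \<and> smooth_map (open_submfd M W) L s \<and> (\<forall>p\<in>W. pr (s p) = p)"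

text \<open>\<open>nab s p \<xi>\<close> is the covariant derivative of the local section \<open>s\<close> at \<open>p\<close> in the direction
  \<open>\<xi>\<close>. \<open>connection_form \<dots> nab W s \<theta>\<close> says that \<open>s\<close> is a frame over \<open>W\<close> and that
  \<open>\<nabla>s = \<theta> s\<close> for the smooth complex 1-form \<open>\<theta>\<close> on \<open>W\<close>.\<close>

definition connection_form ::
    "('m, 'v::{lc_space,t2_space}, 'i) mfd \<Rightarrow> ('l, 'w::{lc_space,t2_space}, 'j) mfd \<Rightarrow>
     ('l \<Rightarrow> 'm) \<Rightarrow> (complex \<Rightarrow> 'l \<Rightarrow> 'l) \<Rightarrow> (('m \<Rightarrow> 'l) \<Rightarrow> 'm \<Rightarrow> ('i \<Rightarrow> 'v) \<Rightarrow> 'l) \<Rightarrow>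
     'm set \<Rightarrow> ('m \<Rightarrow> 'l) \<Rightarrow> ('m \<Rightarrow> ('i \<Rightarrow> 'v) \<Rightarrow> complex) \<Rightarrow> bool" where
  "connection_form M L pr scl nab W s \<theta> \<longleftrightarrow>
     smooth_section M L pr W s \<and>
     (\<forall>p\<in>W. \<forall>l\<in>points L. pr l = p \<longrightarrow> (\<exists>c. l = scl c (s p))) \<and>
     one_form (open_submfd M W) \<theta> \<and>
     (\<forall>p\<in>W. \<forall>\<xi>\<in>tangent_space M p. nab s p \<xi> = scl (\<theta> p \<xi>) (s p))"

definition linear_connection ::
    "('m, 'v::{lc_space,t2_space}, 'i) mfd \<Rightarrow> ('l, 'w::{lc_space,t2_space}, 'j) mfd \<Rightarrow>
     ('l \<Rightarrow> 'm) \<Rightarrow> ('l \<Rightarrow> 'l \<Rightarrow> 'l) \<Rightarrow> (complex \<Rightarrow> 'l \<Rightarrow> 'l) \<Rightarrow>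
     (('m \<Rightarrow> 'l) \<Rightarrow> 'm \<Rightarrow> ('i \<Rightarrow> 'v) \<Rightarrow> 'l) \<Rightarrow> bool" where
  "linear_connection M L pr add scl nab \<longleftrightarrow>
     (\<forall>W s p \<xi>. smooth_section M L pr W s \<and> p \<in> W \<and> \<xi> \<in> tangent_space M p \<longrightarrow>
        nab s p \<xi> \<in> points L \<and> pr (nab s p \<xi>) = p \<and>
        (\<forall>\<eta>\<in>tangent_space M p. nab s p (\<lambda>j. \<xi> j + \<eta> j) = add (nab s p \<xi>) (nab s p \<eta>)) \<and>
        (\<forall>r::real. nab s p (\<lambda>j. r *\<^sub>R \<xi> j) = scl (complex_of_real r) (nab s p \<xi>)) \<and>
        (\<forall>s'. (\<forall>q\<in>W. s' q = s q) \<longrightarrow> nab s' p \<xi> = nab s p \<xi>) \<and>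
        (\<forall>s'. smooth_section M L pr W s' \<longrightarrow>
           nab (\<lambda>q. add (s q) (s' q)) p \<xi> = add (nab s p \<xi>) (nab s' p \<xi>)) \<and>
        (\<forall>f. smooth_map (open_submfd M W) complex_plane f \<longrightarrow>
           nab (\<lambda>q. scl (f q) (s q)) p \<xi> =
             add (scl (fun_deriv M f p \<xi>) (s p)) (scl (f p) (nab s p \<xi>)))) \<and>
     (\<forall>p\<in>points M. \<exists>W s \<theta>. p \<in> W \<and> connection_form M L pr scl nab W s \<theta>)"

text \<open>The curvature is normalised to be real, i.e. \<open>\<nabla>s = i \<theta> s\<close> gives the curvature \<open>d\<theta>\<close>
  (the Lie algebra of \<open>U(1)\<close> is identified with the reals). A change of the frame changes
  \<open>\<theta>\<close> by a closed form, so one frame around every point suffices.\<close>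

definition has_curvature ::
    "('m, 'v::{lc_space,t2_space}, 'i) mfd \<Rightarrow> ('l, 'w::{lc_space,t2_space}, 'j) mfd \<Rightarrow>
     ('l \<Rightarrow> 'm) \<Rightarrow> (complex \<Rightarrow> 'l \<Rightarrow> 'l) \<Rightarrow> (('m \<Rightarrow> 'l) \<Rightarrow> 'm \<Rightarrow> ('i \<Rightarrow> 'v) \<Rightarrow> 'l) \<Rightarrow>
     ('m \<Rightarrow> ('i \<Rightarrow> 'v) \<Rightarrow> ('i \<Rightarrow> 'v) \<Rightarrow> real) \<Rightarrow> bool" where
  "has_curvature M L pr scl nab \<Omega> \<longleftrightarrow>
     (\<forall>p\<in>points M. \<exists>W s \<theta>. p \<in> W \<and> connection_form M L pr scl nab W s \<theta> \<and>
        is_ext_deriv1 (open_submfd M W) \<theta> (\<lambda>q \<xi> \<eta>. \<i> * complex_of_real (\<Omega> q \<xi> \<eta>)))"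

definition prequantum_line_bundle ::
    "('m, 'v::{lc_space,t2_space}, 'i) mfd \<Rightarrow>
     ('m \<Rightarrow> ('i \<Rightarrow> 'v) \<Rightarrow> ('i \<Rightarrow> 'v) \<Rightarrow> real) \<Rightarrow> ('l, 'w::{lc_space,t2_space}, 'j) mfd \<Rightarrow>
     ('l \<Rightarrow> 'm) \<Rightarrow> ('l \<Rightarrow> 'l \<Rightarrow> 'l) \<Rightarrow> (complex \<Rightarrow> 'l \<Rightarrow> 'l) \<Rightarrow>
     (('m \<Rightarrow> 'l) \<Rightarrow> 'm \<Rightarrow> ('i \<Rightarrow> 'v) \<Rightarrow> 'l) \<Rightarrow> bool" where
  "prequantum_line_bundle M \<Omega> L pr add scl nab \<longleftrightarrow>
     symplectic_form M \<Omega> \<and>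
     complex_line_bundle M L pr add scl \<and>
     linear_connection M L pr add scl nab \<and>
     has_curvature M L pr scl nab \<Omega>"


section \<open>The unit sphere and the projective space\<close>

definition sphere_mfd :: "('v::hermitian_lc_space, 'v, 'v) mfd" where
  "sphere_mfd =
     \<lparr>mtop = top_of_set {\<psi>. hnorm \<psi> = 1},
      mix = {\<psi>. hnorm \<psi> = 1},
      mdom = \<lambda>\<psi>. {\<phi>. hnorm \<phi> = 1 \<and> Re (cinner \<psi> \<phi>) > 0},
      mchart = \<lambda>\<psi> \<phi>. inverse (Re (cinner \<psi> \<phi>)) *\<^sub>R \<phi> - \<psi>,
      mmodel = \<lambda>\<psi>. {v. Re (cinner \<psi> v) = 0}\<rparr>"

abbreviation circle :: "(complex, complex, complex) mfd" where
  "circle \<equiv> sphere_mfd"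

definition cline :: "'v::hermitian_lc_space \<Rightarrow> 'v set" where
  "cline \<phi> = range (\<lambda>c. c *\<^sub>C \<phi>)"

definition quotient_topology :: "'a topology \<Rightarrow> ('a \<Rightarrow> 'b) \<Rightarrow> 'b topology" where
  "quotient_topology X f =
     topology (\<lambda>U. U \<subseteq> f ` topspace X \<and> openin X {x \<in> topspace X. f x \<in> U})"

lemma openin_quotient_topology:
  "openin (quotient_topology X f) U \<longleftrightarrow>
     U \<subseteq> f ` topspace X \<and> openin X {x \<in> topspace X. f x \<in> U}"
proof -
  have "istopology (\<lambda>U. U \<subseteq> f ` topspace X \<and> openin X {x \<in> topspace X. f x \<in> U})"
    unfolding istopology_def
  proof (intro conjI allI impI)
    fix S T
    assume S: "S \<subseteq> f ` topspace X \<and> openin X {x \<in> topspace X. f x \<in> S}"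
      and T: "T \<subseteq> f ` topspace X \<and> openin X {x \<in> topspace X. f x \<in> T}"
    show "S \<inter> T \<subseteq> f ` topspace X" using S by auto
    have "{x \<in> topspace X. f x \<in> S \<inter> T} =
        {x \<in> topspace X. f x \<in> S} \<inter> {x \<in> topspace X. f x \<in> T}" by auto
    then show "openin X {x \<in> topspace X. f x \<in> S \<inter> T}" using S T by auto
  next
    fix K
    assume K: "\<forall>U\<in>K. U \<subseteq> f ` topspace X \<and> openin X {x \<in> topspace X. f x \<in> U}"
    show "\<Union>K \<subseteq> f ` topspace X" using K by auto
    have "{x \<in> topspace X. f x \<in> \<Union>K} = (\<Union>U\<in>K. {x \<in> topspace X. f x \<in> U})" by auto
    then show "openin X {x \<in> topspace X. f x \<in> \<Union>K}" using K by auto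
  qed
  then show ?thesis
    by (simp add: quotient_topology_def topology_inverse')
qed

lemma topspace_quotient_topology: "topspace (quotient_topology X f) = f ` topspace X"
proof
  show "topspace (quotient_topology X f) \<subseteq> f ` topspace X"
    using openin_quotient_topology[of X f "topspace (quotient_topology X f)"] by simp
  have "{x \<in> topspace X. f x \<in> f ` topspace X} = topspace X" by auto
  then have "openin (quotient_topology X f) (f ` topspace X)"
    by (simp add: openin_quotient_topology)
  then show "f ` topspace X \<subseteq> topspace (quotient_topology X f)"
    by (rule openin_subset)
qed

text \<open>The point \<open>[\<phi>]\<close> is the line \<^term>\<open>cline \<phi>\<close>. The value of a chart does not depend on the
  choice of \<open>\<phi>\<close>; see \<open>proj_chart_cline\<close>.\<close>

definition proj_chart :: "'v::hermitian_lc_space \<Rightarrow> 'v set \<Rightarrow> 'v" where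
  "proj_chart \<psi> p =
     (let \<phi> = (SOME \<phi>. \<phi> \<in> p \<and> \<phi> \<noteq> 0) in inverse (cinner \<psi> \<phi>) *\<^sub>C \<phi> - \<psi>)"

lemma proj_chart_cline:
  fixes \<psi> \<phi> :: "'v::hermitian_lc_space"
  assumes "cinner \<psi> \<phi> \<noteq> 0"
  shows "proj_chart \<psi> (cline \<phi>) = inverse (cinner \<psi> \<phi>) *\<^sub>C \<phi> - \<psi>"
proof -
  have scale0: "0 *\<^sub>C \<phi> = 0"
    using scaleC_add_left[of 0 0 \<phi>] by simp
  have "\<phi> \<noteq> 0"
    using assms cinner_add_right[of \<psi> 0 0] by auto
  moreover have "\<phi> \<in> cline \<phi>"
    unfolding cline_def by (metis rangeI scaleC_one)
  ultimately have "\<exists>x. x \<in> cline \<phi> \<and> x \<noteq> 0"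
    by (intro exI conjI)
  from someI_ex[OF this] obtain c where c: "(SOME x. x \<in> cline \<phi> \<and> x \<noteq> 0) = c *\<^sub>C \<phi>" "c \<noteq> 0"
    using scale0 unfolding cline_def by (metis (lifting) imageE)
  have eq: "inverse (c * cinner \<psi> \<phi>) * c = inverse (cinner \<psi> \<phi>)"
    using c(2) by simp
  show ?thesis
    unfolding proj_chart_def Let_def c(1) cinner_scaleC_right scaleC_scaleC eq ..
qed

definition proj_mfd :: "('v::hermitian_lc_space set, 'v, 'v) mfd" where
  "proj_mfd =
     \<lparr>mtop = quotient_topology (top_of_set (- {0})) cline,
      mix = {\<psi>. hnorm \<psi> = 1},
      mdom = \<lambda>\<psi>. {cline \<phi> |\<phi>. cinner \<psi> \<phi> \<noteq> 0},
      mchart = proj_chart,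
      mmodel = \<lambda>\<psi>. {v. cinner \<psi> v = 0}\<rparr>"

text \<open>The tangent vector \<open>\<xi>\<close> at \<open>[\<psi>]\<close>, \<open>\<psi>\<close> a unit vector, is identified with its component
  \<open>\<xi> \<psi>\<close>, its image under the differential of the chart at \<open>\<psi>\<close>; similarly on the sphere.\<close>

definition proj_H :: "'v::hermitian_lc_space set \<Rightarrow> ('v \<Rightarrow> 'v) \<Rightarrow> ('v \<Rightarrow> 'v) \<Rightarrow> complex" where
  "proj_H p \<xi> \<eta> = (let \<psi> = (SOME \<psi>. hnorm \<psi> = 1 \<and> cline \<psi> = p) in 2 * cinner (\<xi> \<psi>) (\<eta> \<psi>))"

definition proj_Omega :: "'v::hermitian_lc_space set \<Rightarrow> ('v \<Rightarrow> 'v) \<Rightarrow> ('v \<Rightarrow> 'v) \<Rightarrow> real" where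
  "proj_Omega p \<xi> \<eta> = Im (proj_H p \<xi> \<eta>)"

text \<open>The number \<open>- i \<langle>\<psi>, \<delta>v\<rangle>\<close> is real because \<open>Re \<langle>\<psi>, \<delta>v\<rangle> = 0\<close>.\<close>

definition sphere_alpha :: "'v::hermitian_lc_space \<Rightarrow> ('v \<Rightarrow> 'v) \<Rightarrow> real" where
  "sphere_alpha \<psi> \<xi> = Re (- \<i> * cinner \<psi> (\<xi> \<psi>))"

lemma sphere_alpha_eq:
  assumes "hnorm \<psi> = 1" "\<xi> \<in> tangent_space sphere_mfd \<psi>"
  shows "complex_of_real (sphere_alpha \<psi> \<xi>) = - \<i> * cinner \<psi> (\<xi> \<psi>)"
proof -
  have "Re (cinner \<psi> \<psi>) > 0"
    using assms(1) by (simp add: hnorm_def)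
  then have "\<psi> \<in> {i \<in> mix sphere_mfd. \<psi> \<in> mdom sphere_mfd i}"
    using assms(1) by (simp add: sphere_mfd_def)
  with assms(2) have "\<xi> \<psi> \<in> mmodel sphere_mfd \<psi>"
    unfolding tangent_space_def by blast
  then have "Re (cinner \<psi> (\<xi> \<psi>)) = 0"
    by (simp add: sphere_mfd_def)
  then show ?thesis
    by (simp add: sphere_alpha_def complex_eq_iff)
qed


section \<open>Principal \<open>U(1)\<close>-bundles and associated line bundles\<close>

text \<open>\<open>triv i\<close> is the fibre component of the equivariant trivialisation over the chart domain
  with index \<open>i\<close> of the base; freeness and transitivity of the action on the fibres follow.\<close>

definition principal_U1_bundle ::
    "('p, 'u::{lc_space,t2_space}, 'k) mfd \<Rightarrow> ('m, 'v::{lc_space,t2_space}, 'i) mfd \<Rightarrow>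
     (complex \<Rightarrow> 'p \<Rightarrow> 'p) \<Rightarrow> ('p \<Rightarrow> 'm) \<Rightarrow> ('i \<Rightarrow> 'p \<Rightarrow> complex) \<Rightarrow> bool" where
  "principal_U1_bundle P M act pr triv \<longleftrightarrow>
     smooth_manifold P \<and> smooth_manifold M \<and>
     smooth_map P M pr \<and> pr ` points P = points M \<and>
     smooth_map (prod_mfd circle P) P (\<lambda>(z, q). act z q) \<and>
     (\<forall>q\<in>points P. act 1 q = q \<and>
        (\<forall>y z. cmod y = 1 \<longrightarrow> cmod z = 1 \<longrightarrow> act y (act z q) = act (y * z) q) \<and>
        (\<forall>z. cmod z = 1 \<longrightarrow> pr (act z q) = pr q)) \<and>
     (\<forall>i\<in>mix M.
        diffeomorphism (open_submfd P {q \<in> points P. pr q \<in> mdom M i})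
          (prod_mfd (open_submfd M (mdom M i)) circle) (\<lambda>q. (pr q, triv i q)) \<and>
        (\<forall>q\<in>points P. \<forall>z. pr q \<in> mdom M i \<longrightarrow> cmod z = 1 \<longrightarrow> triv i (act z q) = z * triv i q))"

definition fundamental_vector ::
    "('p, 'u::{lc_space,t2_space}, 'k) mfd \<Rightarrow> (complex \<Rightarrow> 'p \<Rightarrow> 'p) \<Rightarrow> 'p \<Rightarrow> 'k \<Rightarrow> 'u" where
  "fundamental_vector P act q = (\<lambda>j. if j \<in> mix P \<and> q \<in> mdom P j
     then dirderiv (\<lambda>t::real. mchart P j (act (cis t) q)) 0 1 else 0)"

definition principal_connection ::
    "('p, 'u::{lc_space,t2_space}, 'k) mfd \<Rightarrow> (complex \<Rightarrow> 'p \<Rightarrow> 'p) \<Rightarrow>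
     ('p \<Rightarrow> ('k \<Rightarrow> 'u) \<Rightarrow> real) \<Rightarrow> bool" where
  "principal_connection P act \<alpha> \<longleftrightarrow>
     one_form P \<alpha> \<and>
     (\<forall>q\<in>points P. \<alpha> q (fundamental_vector P act q) = 1 \<and>
        (\<forall>\<xi>\<in>tangent_space P q. \<forall>z. cmod z = 1 \<longrightarrow>
           \<alpha> (act z q) (tangent_map P P (act z) q \<xi>) = \<alpha> q \<xi>))"

text \<open>The associated bundle is the quotient of \<open>P \<times> \<complex>\<close> by \<open>(u q, z) \<sim> (q, u z)\<close>. Its charts
  combine the charts of the base with the trivialisations of the principal bundle.\<close>

definition assoc_class :: "(complex \<Rightarrow> 'p \<Rightarrow> 'p) \<Rightarrow> 'p \<Rightarrow> complex \<Rightarrow> ('p \<times> complex) set" where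
  "assoc_class act q z = {(act u q, z / u) |u. cmod u = 1}"

definition assoc_rep :: "('p \<times> complex) set \<Rightarrow> 'p \<times> complex" where
  "assoc_rep l = (SOME x. x \<in> l)"

definition assoc_proj :: "('p \<Rightarrow> 'm) \<Rightarrow> ('p \<times> complex) set \<Rightarrow> 'm" where
  "assoc_proj pr l = pr (fst (assoc_rep l))"

definition assoc_add ::
    "(complex \<Rightarrow> 'p \<Rightarrow> 'p) \<Rightarrow> ('p \<times> complex) set \<Rightarrow> ('p \<times> complex) set \<Rightarrow> ('p \<times> complex) set" where
  "assoc_add act l l' =
     (let (q, z) = assoc_rep l in assoc_class act q (z + (THE w. (q, w) \<in> l')))"

definition assoc_scale ::
    "(complex \<Rightarrow> 'p \<Rightarrow> 'p) \<Rightarrow> complex \<Rightarrow> ('p \<times> complex) set \<Rightarrow> ('p \<times> complex) set" where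
  "assoc_scale act c l = (let (q, z) = assoc_rep l in assoc_class act q (c * z))"

definition assoc_line_bundle ::
    "('p, 'u, 'k) mfd \<Rightarrow> ('m, 'v, 'i) mfd \<Rightarrow>
     (complex \<Rightarrow> 'p \<Rightarrow> 'p) \<Rightarrow> ('p \<Rightarrow> 'm) \<Rightarrow> ('i \<Rightarrow> 'p \<Rightarrow> complex) \<Rightarrow>
     (('p \<times> complex) set, 'v \<times> complex, 'i) mfd" where
  "assoc_line_bundle P M act pr triv =
     \<lparr>mtop = quotient_topology (prod_topology (mtop P) euclidean) (\<lambda>(q, z). assoc_class act q z),
      mix = mix M,
      mdom = \<lambda>i. {assoc_class act q z |q z. q \<in> points P \<and> pr q \<in> mdom M i},
      mchart = \<lambda>i l. (let (q, z) = assoc_rep l in (mchart M i (pr q), triv i q * z)),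
      mmodel = \<lambda>i. mmodel M i \<times> UNIV\<rparr>"

text \<open>A section \<open>s\<close> of the associated bundle corresponds to the equivariant function \<open>f\<close> with
  \<open>s (pr q) = [q, f q]\<close>; its covariant derivative is \<open>[q, df(\<xi>\<^sup>h)]\<close>, where \<open>\<xi>\<^sup>h\<close> is the
  horizontal lift of \<open>\<xi>\<close> to \<open>q\<close>.\<close>

definition horizontal_lift ::
    "('p, 'u::{lc_space,t2_space}, 'k) mfd \<Rightarrow> ('m, 'v::{lc_space,t2_space}, 'i) mfd \<Rightarrow>
     ('p \<Rightarrow> 'm) \<Rightarrow> ('p \<Rightarrow> ('k \<Rightarrow> 'u) \<Rightarrow> real) \<Rightarrow> 'p \<Rightarrow> ('i \<Rightarrow> 'v) \<Rightarrow> 'k \<Rightarrow> 'u" where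
  "horizontal_lift P M pr \<alpha> q \<xi> =
     (THE \<zeta>. \<zeta> \<in> tangent_space P q \<and> tangent_map P M pr q \<zeta> = \<xi> \<and> \<alpha> q \<zeta> = 0)"

definition equivariant_fun ::
    "('p \<Rightarrow> 'm) \<Rightarrow> ('m \<Rightarrow> ('p \<times> complex) set) \<Rightarrow> 'p \<Rightarrow> complex" where
  "equivariant_fun pr s q = (THE z. (q, z) \<in> s (pr q))"

definition assoc_connection ::
    "('p, 'u::{lc_space,t2_space}, 'k) mfd \<Rightarrow> ('m, 'v::{lc_space,t2_space}, 'i) mfd \<Rightarrow>
     (complex \<Rightarrow> 'p \<Rightarrow> 'p) \<Rightarrow> ('p \<Rightarrow> 'm) \<Rightarrow> ('p \<Rightarrow> ('k \<Rightarrow> 'u) \<Rightarrow> real) \<Rightarrow>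
     ('m \<Rightarrow> ('p \<times> complex) set) \<Rightarrow> 'm \<Rightarrow> ('i \<Rightarrow> 'v) \<Rightarrow> ('p \<times> complex) set" where
  "assoc_connection P M act pr \<alpha> s p \<xi> =
     (let q = (SOME q. q \<in> points P \<and> pr q = p)
      in assoc_class act q
           (fun_deriv P (equivariant_fun pr s) q (horizontal_lift P M pr \<alpha> q \<xi>)))"


section \<open>The tautological line bundle\<close>

text \<open>Over the chart domain of \<open>\<psi>\<close>, the bundle \<open>\<phi> \<mapsto> [\<phi>]\<close> of the sphere over the projective space
  is trivialised by the phase of \<open>\<langle>\<psi>, \<phi>\<rangle>\<close>.\<close>

definition sphere_triv :: "'v::hermitian_lc_space \<Rightarrow> 'v \<Rightarrow> complex" where
  "sphere_triv \<psi> \<phi> = sgn (cinner \<psi> \<phi>)"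

definition taut_bundle :: "(('v::hermitian_lc_space \<times> complex) set, 'v \<times> complex, 'v) mfd" where
  "taut_bundle = assoc_line_bundle sphere_mfd proj_mfd scaleC cline sphere_triv"

definition taut_connection ::
    "('v::hermitian_lc_space set \<Rightarrow> ('v \<times> complex) set) \<Rightarrow> 'v set \<Rightarrow> ('v \<Rightarrow> 'v) \<Rightarrow>
     ('v \<times> complex) set" where
  "taut_connection = assoc_connection sphere_mfd proj_mfd scaleC cline sphere_alpha"

definition taut_vector :: "('v::hermitian_lc_space \<times> complex) set \<Rightarrow> 'v" where
  "taut_vector l = (let (\<psi>, z) = assoc_rep l in z *\<^sub>C \<psi>)"

end

theory Submission
  imports Defs
begin

text \<open>
  Both the sphere and the projective space are quotients of \<open>V - {0}\<close> with charts of the form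
  \<open>x \<mapsto> x / L x - j\<close> for a functional \<open>L\<close>. In these charts all maps and tensors are built from
  scalar products, inverses and phases \<open>z / |z|\<close>, so that their smoothness follows from closure
  properties that are proved by induction on the order of differentiability; no chain rule for maps
  between locally convex spaces is needed. In terms of a representative \<open>x \<in> V - {0}\<close>, the hermitean
  form is the Fubini--Study form
  \<open>2 (\<langle>v, w\<rangle> / |x|\<^sup>2 - \<langle>v, x\<rangle> \<langle>x, w\<rangle> / |x|\<^sup>4)\<close>, whose imaginary part is closed by a polynomial
  identity, and \<open>\<alpha>\<close> is \<open>Im \<langle>x, v\<rangle> / |x|\<^sup>2\<close>, whose exterior derivative is that imaginary part.

  The covariant derivative at \<open>[q]\<close> is the plain derivative of the representative of the section in
  the trivialisation given by the unit vector \<open>q\<close> itself, because the phase of \<open>\<langle>q, \<cdot>\<rangle>\<close> is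
  stationary at \<open>q\<close> along horizontal curves. For the frame over the chart of \<open>\<psi>\<close> that is given by
  the phase of \<open>\<langle>\<psi>, \<cdot>\<rangle>\<close> this yields the connection form \<open>\<i> (\<alpha> - d arg \<langle>\<psi>, \<cdot>\<rangle>)\<close>, which has
  curvature \<open>\<Omega>\<close>.
\<close>

section \<open>Complex vector spaces with a hermitian scalar product\<close>

text \<open>The obstacle is the topology: V need not be normable, so there is no Frechet derivative
  to work with, and a directional derivative composes with other maps only if the direction may vary
  along the way. For the explicit maps, differentiating formulas avoids this. The axioms of a linear
  connection, however, quantify over arbitrary smooth sections and functions, and evaluating the
  covariant derivative carries a straight line of one chart into a curve of another. Hence one
  genuine chain rule is proved, for scalar functions along differentiable curves; it comes from the
  mean value theorem and convex neighbourhoods. Lifting to V - {0} also tames the unspecified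
  choices in the definitions, such as a unit vector on a line or a chart at a point: they only
  rescale the lift or add a multiple of it to a direction, and the homogeneous formulas ignore both.
  The connection at p is always computed with the very vector q that its definition selects. The
  normalisations of \<alpha> and H match because antisymmetrising the derivative of Im <x, w> along
  v gives Im <v, w> - Im <w, v> = 2 Im <v, w>.\<close>

interpretation scaleC: vector_space "scaleC :: complex \<Rightarrow> 'a::complex_vector \<Rightarrow> 'a"
  by unfold_locales (simp_all add: scaleC_add_right scaleC_add_left scaleC_scaleC scaleC_one)

lemma cinner_add_left: "cinner (x + y) z = cinner x z + cinner y z"
  by (metis cinner_add_right cinner_commute complex_cnj_add)

lemma cinner_scaleC_left: "cinner (c *\<^sub>C x) y = cnj c * cinner x y"
  by (metis cinner_commute cinner_scaleC_right complex_cnj_mult)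

lemma cinner_zero_right [simp]: "cinner x 0 = 0"
  using cinner_add_right[of x 0 0] by simp

lemma cinner_zero_left [simp]: "cinner 0 x = 0"
  using cinner_add_left[of 0 0 x] by simp

lemma cinner_minus_right: "cinner x (- y) = - cinner x y"
  using cinner_add_right[of x y "- y"] by (simp add: eq_neg_iff_add_eq_0 add.commute)

lemma cinner_minus_left: "cinner (- x) y = - cinner x y"
  by (metis cinner_commute cinner_minus_right complex_cnj_minus)

lemma cinner_diff_right: "cinner x (y - z) = cinner x y - cinner x z"
  using cinner_add_right[of x y "- z"] by (simp add: cinner_minus_right)

lemma cinner_diff_left: "cinner (x - y) z = cinner x z - cinner y z"
  using cinner_add_left[of x "- y" z] by (simp add: cinner_minus_left)

lemma cinner_scaleR_right: "cinner x (r *\<^sub>R y) = r * cinner x y"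
  by (simp add: scaleR_scaleC cinner_scaleC_right)

lemma cinner_scaleR_left: "cinner (r *\<^sub>R x) y = r * cinner x y"
  by (simp add: scaleR_scaleC cinner_scaleC_left)

lemmas cinner_simps = cinner_add_left cinner_add_right cinner_diff_left cinner_diff_right
  cinner_minus_left cinner_minus_right cinner_scaleC_left cinner_scaleC_right
  cinner_scaleR_left cinner_scaleR_right

lemma Im_cinner_self [simp]: "Im (cinner x x) = 0"
  using arg_cong[OF cinner_commute[of x x], of Im] by simp

lemma cinner_self_nonneg: "0 \<le> Re (cinner x x)"
  by (cases "x = 0") (auto dest: cinner_pos)

lemma cinner_self: "cinner x x = complex_of_real ((hnorm x)\<^sup>2)"
  by (simp add: complex_eq_iff hnorm_def cinner_self_nonneg)

lemma cinner_self_eq_0 [simp]: "cinner x x = 0 \<longleftrightarrow> x = 0"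
  using cinner_pos[of x] by fastforce

lemma hnorm_eq_0 [simp]: "hnorm x = 0 \<longleftrightarrow> x = 0"
  using cinner_self[of x] by fastforce

lemma hnorm_nonneg [simp]: "0 \<le> hnorm x"
  by (simp add: hnorm_def cinner_self_nonneg)

lemma hnorm_pos: "x \<noteq> 0 \<Longrightarrow> 0 < hnorm x"
  using hnorm_nonneg[of x] hnorm_eq_0[of x] by linarith

lemma hnorm_scaleC: "hnorm (c *\<^sub>C x) = cmod c * hnorm x"
proof -
  have "cinner (c *\<^sub>C x) (c *\<^sub>C x) = complex_of_real ((cmod c * hnorm x)\<^sup>2)"
    by (simp only: cinner_scaleC_left cinner_scaleC_right cinner_self[of x] power_mult_distrib
        of_real_mult complex_norm_square ac_simps)
  then have "(hnorm (c *\<^sub>C x))\<^sup>2 = (cmod c * hnorm x)\<^sup>2"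
    unfolding cinner_self of_real_eq_iff .
  then show ?thesis
    by (simp add: power2_eq_iff_nonneg)
qed

lemma cinner_unit: "hnorm x = 1 \<Longrightarrow> cinner x x = 1"
  by (simp add: cinner_self)

lemma unit_nonzero: "hnorm x = 1 \<Longrightarrow> x \<noteq> 0"
  using hnorm_eq_0[of x] by fastforce

lemma hnorm_normalize: "x \<noteq> 0 \<Longrightarrow> hnorm (complex_of_real (inverse (hnorm x)) *\<^sub>C x) = 1"
  by (simp add: hnorm_scaleC norm_inverse)

lemma continuous_on_scaleC [continuous_intros]:
  "continuous_on S f \<Longrightarrow> continuous_on S g \<Longrightarrow> continuous_on S (\<lambda>x. f x *\<^sub>C (g x::'a::complex_lc_space))"
  unfolding continuous_on_def by (blast intro: tendsto_scaleC)

lemma continuous_on_cinner [continuous_intros]: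
  "continuous_on S f \<Longrightarrow> continuous_on S g \<Longrightarrow> continuous_on S (\<lambda>x. cinner (f x) (g x))"
  unfolding continuous_on_def by (blast intro: tendsto_cinner)

lemma continuous_on_hnorm [continuous_intros]:
  "continuous_on S f \<Longrightarrow> continuous_on S (\<lambda>x. hnorm (f x))"
  unfolding hnorm_def by (intro continuous_intros)


section \<open>Directional derivatives\<close>

lemma has_dirderiv_imp: "has_dirderiv f x h l \<Longrightarrow> dirderiv f x h = l"
  unfolding has_dirderiv_def dirderiv_def by (intro tendsto_Lim trivial_limit_at) auto

lemma has_dirderiv_eq: "has_dirderiv f x h l \<Longrightarrow> l = l' \<Longrightarrow> has_dirderiv f x h l'"
  by simp

text \<open>U is open only relative to E, so the line has to stay in the subspace E. This is why
  derivatives at points of U in directions from E ignore the values outside U.\<close>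

lemma eventually_at_0_I:
  fixes h :: "'a::lc_space"
  assumes "openin (top_of_set E) U" "x \<in> U" "subspace E" "h \<in> E"
  shows "\<forall>\<^sub>F t in at 0. x + t *\<^sub>R h \<in> U"
proof -
  obtain T where T: "open T" "U = E \<inter> T"
    using assms(1) by (auto simp: openin_open)
  have "((\<lambda>t. x + t *\<^sub>R h) \<longlongrightarrow> x + 0 *\<^sub>R h) (at 0)"
    by (intro tendsto_add tendsto_const tendsto_scaleR_lc tendsto_ident_at)
  then have "\<forall>\<^sub>F t in at 0. x + t *\<^sub>R h \<in> T"
    using T assms(2) by (intro topological_tendstoD) auto
  moreover have "x + t *\<^sub>R h \<in> E" for t
    using T assms by (auto intro: subspace_add subspace_scale)
  ultimately show ?thesis
    by (auto simp: T elim: eventually_mono)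
qed

lemma has_dirderiv_cong:
  assumes "\<forall>\<^sub>F t in at 0. f (x + t *\<^sub>R h) = g (x + t *\<^sub>R h)" "f x = g x"
  shows "has_dirderiv f x h l \<longleftrightarrow> has_dirderiv g x h l"
  unfolding has_dirderiv_def using assms(1)
  by (intro tendsto_cong) (auto simp: assms(2) elim: eventually_mono)

lemma has_dirderiv_openin_cong:
  fixes x :: "'a::lc_space"
  assumes "openin (top_of_set E) U" "x \<in> U" "subspace E" "h \<in> E" "\<And>y. y \<in> U \<Longrightarrow> f y = g y"
  shows "has_dirderiv f x h l \<longleftrightarrow> has_dirderiv g x h l"
  by (intro has_dirderiv_cong eventually_mono[OF eventually_at_0_I[OF assms(1-4)]] assms(5,2))

text \<open>Valid even where no derivative exists, since equal difference quotients give the same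
  \<open>Lim\<close>. Exterior derivatives and chart expressions can thus be rewritten before
  differentiability is known.\<close>

lemma dirderiv_cong:
  assumes "\<forall>\<^sub>F t in at 0. f (x + t *\<^sub>R h) = g (x + t *\<^sub>R h)" "f x = g x"
  shows "dirderiv f x h = dirderiv g x h"
  unfolding dirderiv_def t2_space_class.Lim_def
  using has_dirderiv_cong[OF assms] by (simp only: has_dirderiv_def)

lemma has_dirderiv_tendsto:
  assumes "has_dirderiv f x h l"
  shows "((\<lambda>t. f (x + t *\<^sub>R h)) \<longlongrightarrow> f x) (at 0)"
proof -
  have "((\<lambda>t. f x + t *\<^sub>R ((1 / t) *\<^sub>R (f (x + t *\<^sub>R h) - f x))) \<longlongrightarrow> f x + 0 *\<^sub>R l) (at 0)"
    using assms unfolding has_dirderiv_def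
    by (intro tendsto_add tendsto_const tendsto_scaleR_lc tendsto_ident_at)
  moreover have "\<forall>\<^sub>F t in at 0. f x + t *\<^sub>R ((1 / t) *\<^sub>R (f (x + t *\<^sub>R h) - f x)) = f (x + t *\<^sub>R h)"
    unfolding eventually_at_filter by (intro always_eventually) auto
  ultimately show ?thesis
    using tendsto_cong by force
qed

text \<open>Only real linearity is demanded, so that the scalar product, antilinear in its first
  argument, is an instance along with scalar and complex multiplication. Joint continuity takes the
  place of a norm estimate.\<close>

locale lc_bilinear =
  fixes B :: "'a::{lc_space,t2_space} \<Rightarrow> 'b::{lc_space,t2_space} \<Rightarrow> 'c::{lc_space,t2_space}"
  assumes add_left: "B (x + y) z = B x z + B y z"
    and add_right: "B x (u + w) = B x u + B x w"
    and scaleR_left: "B (r *\<^sub>R x) u = r *\<^sub>R B x u"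
    and scaleR_right: "B x (r *\<^sub>R u) = r *\<^sub>R B x u"
    and continuous: "continuous_on UNIV (\<lambda>z. B (fst z) (snd z))"
begin

lemma diff_left: "B (x - y) z = B x z - B y z"
  using add_left[of "x - y" y z] by simp

lemma diff_right: "B x (u - w) = B x u - B x w"
  using add_right[of x "u - w" w] by simp

lemma tendsto: "(f \<longlongrightarrow> x) F \<Longrightarrow> (g \<longlongrightarrow> y) F \<Longrightarrow> ((\<lambda>z. B (f z) (g z)) \<longlongrightarrow> B x y) F"
  using continuous_on_tendsto_compose[OF continuous tendsto_Pair, of f x F g y] by simp

lemma continuous_on:
  "continuous_on S f \<Longrightarrow> continuous_on S g \<Longrightarrow> continuous_on S (\<lambda>z. B (f z) (g z))"
  unfolding continuous_on_def by (blast intro: tendsto)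

lemma has_dirderiv:
  assumes f: "has_dirderiv f x h f'" and g: "has_dirderiv g x h g'"
  shows "has_dirderiv (\<lambda>y. B (f y) (g y)) x h (B f' (g x) + B (f x) g')"
proof -
  \<comment> \<open>The quotient of the product is split as usual; the factor
    \<open>g (x + t *\<^sub>R h)\<close> converges because \<open>g\<close> is differentiable along
    the line.\<close>
  have "((\<lambda>t. B ((1 / t) *\<^sub>R (f (x + t *\<^sub>R h) - f x)) (g (x + t *\<^sub>R h))
      + B (f x) ((1 / t) *\<^sub>R (g (x + t *\<^sub>R h) - g x))) \<longlongrightarrow> B f' (g x) + B (f x) g') (at 0)"
    by (intro tendsto_add tendsto tendsto_const has_dirderiv_tendsto[OF g]
        f[unfolded has_dirderiv_def] g[unfolded has_dirderiv_def])
  then show ?thesis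
    unfolding has_dirderiv_def
    by (simp add: scaleR_left scaleR_right diff_left diff_right scaleR_diff_right)
qed

end

locale lc_linear =
  fixes L :: "'a::{lc_space,t2_space} \<Rightarrow> 'b::{lc_space,t2_space}"
  assumes add: "L (x + y) = L x + L y"
    and scaleR: "L (r *\<^sub>R x) = r *\<^sub>R L x"
    and continuous: "continuous_on UNIV L"
begin

lemma diff: "L (x - y) = L x - L y"
  using add[of "x - y" y] by simp

lemma zero: "L 0 = 0"
  using add[of 0 0] by simp

lemma tendsto: "(f \<longlongrightarrow> x) F \<Longrightarrow> ((\<lambda>z. L (f z)) \<longlongrightarrow> L x) F"
  using continuous_on_tendsto_compose[OF continuous, of f x F] by simp

lemma continuous_on: "continuous_on S f \<Longrightarrow> continuous_on S (\<lambda>z. L (f z))"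
  unfolding continuous_on_def by (blast intro: tendsto)

lemma has_dirderiv:
  assumes "has_dirderiv f x h f'"
  shows "has_dirderiv (\<lambda>y. L (f y)) x h (L f')"
  using tendsto[OF assms[unfolded has_dirderiv_def]]
  by (simp add: has_dirderiv_def scaleR diff)

end

interpretation scaleC: lc_bilinear "scaleC :: complex \<Rightarrow> 'a \<Rightarrow> 'a::{complex_lc_space,t2_space}"
  by unfold_locales
    (auto simp: scaleR_scaleC scaleC_complex_def algebra_simps intro!: continuous_intros)

interpretation cinner: lc_bilinear "cinner :: 'a::hermitian_lc_space \<Rightarrow> 'a \<Rightarrow> complex"
  by unfold_locales
    (auto simp: cinner_simps scaleR_conv_of_real intro!: continuous_intros)

interpretation cmult: lc_bilinear "(*) :: complex \<Rightarrow> complex \<Rightarrow> complex"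
  by unfold_locales (auto simp: algebra_simps intro!: continuous_intros)

interpretation Re: lc_linear Re
  by unfold_locales (auto intro!: continuous_intros)

interpretation Im: lc_linear Im
  by unfold_locales (auto intro!: continuous_intros)

interpretation cnj: lc_linear cnj
  by unfold_locales (auto intro!: continuous_intros)

interpretation of_real: lc_linear complex_of_real
  by unfold_locales (auto simp: scaleR_conv_of_real intro!: continuous_intros)

interpretation uminus: lc_linear "uminus :: 'a::{lc_space,t2_space} \<Rightarrow> 'a"
  by unfold_locales (auto intro!: continuous_intros)

interpretation fst: lc_linear "fst :: 'a::{lc_space,t2_space} \<times> 'b::{lc_space,t2_space} \<Rightarrow> 'a"
  by unfold_locales (auto intro!: continuous_intros)

interpretation snd: lc_linear "snd :: 'a::{lc_space,t2_space} \<times> 'b::{lc_space,t2_space} \<Rightarrow> 'b"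
  by unfold_locales (auto intro!: continuous_intros)

section \<open>Rules for directional derivatives, including inverses and phases\<close>

named_theorems dirderiv_intros

lemma has_dirderiv_const: "has_dirderiv (\<lambda>y. c) x h 0"
  by (simp add: has_dirderiv_def)

lemma has_dirderiv_ident: "has_dirderiv (\<lambda>y. y) x (h::'a::{lc_space,t2_space}) h"
  unfolding has_dirderiv_def
  by (rule tendsto_eventually) (auto simp: eventually_at_filter)

lemma has_dirderiv_add:
  assumes "has_dirderiv f x h f'" "has_dirderiv g x h g'"
  shows "has_dirderiv (\<lambda>y. f y + g y) x h (f' + g')"
  using tendsto_add[OF assms[unfolded has_dirderiv_def]]
  by (simp add: has_dirderiv_def algebra_simps)

lemma has_dirderiv_diff:
  assumes "has_dirderiv f x h f'" "has_dirderiv g x h g'"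
  shows "has_dirderiv (\<lambda>y. f y - g y) x h (f' - g')"
  using tendsto_diff[OF assms[unfolded has_dirderiv_def]]
  by (simp add: has_dirderiv_def algebra_simps)

lemma has_dirderiv_Pair:
  assumes "has_dirderiv f x h f'" "has_dirderiv g x h g'"
  shows "has_dirderiv (\<lambda>y. (f y, g y)) x h (f', g')"
  using tendsto_Pair[OF assms[unfolded has_dirderiv_def]]
  by (simp add: has_dirderiv_def)

text \<open>Only the curve t -> f (x + t h) is differentiated, so a normed codomain is enough to
  reach the calculus of the library, whatever the domain is.\<close>

lemma has_dirderiv_iff_vector_derivative:
  fixes f :: "'a::real_vector \<Rightarrow> 'b::real_normed_vector"
  shows "has_dirderiv f x h l \<longleftrightarrow> ((\<lambda>t. f (x + t *\<^sub>R h)) has_vector_derivative l) (at 0)"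
proof -
  define d where "d t = norm (f (x + t *\<^sub>R h) - f x - t *\<^sub>R l) / norm t" for t
  have "has_dirderiv f x h l \<longleftrightarrow>
      ((\<lambda>t. norm ((1 / t) *\<^sub>R (f (x + t *\<^sub>R h) - f x) - l)) \<longlongrightarrow> 0) (at 0)"
    by (simp add: has_dirderiv_def tendsto_norm_zero_iff LIM_zero_iff)
  also have "\<dots> \<longleftrightarrow> (d \<longlongrightarrow> 0) (at 0)"
  proof (rule tendsto_cong)
    have "norm ((1 / t) *\<^sub>R (f (x + t *\<^sub>R h) - f x) - l) = d t" if "t \<noteq> 0" for t
    proof -
      have "(1 / t) *\<^sub>R (f (x + t *\<^sub>R h) - f x) - l = (1 / t) *\<^sub>R (f (x + t *\<^sub>R h) - f x - t *\<^sub>R l)"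
        using that by (simp add: scaleR_diff_right)
      then show ?thesis
        by (simp only: norm_scaleR d_def) (simp add: field_simps)
    qed
    then show "\<forall>\<^sub>F t in at 0. norm ((1 / t) *\<^sub>R (f (x + t *\<^sub>R h) - f x) - l) = d t"
      unfolding eventually_at_filter by (intro always_eventually) blast
  qed
  finally show ?thesis
    by (simp add: has_vector_derivative_def has_derivative_at bounded_linear_scaleR_left
        d_def[abs_def])
qed

text \<open>The derivative is again a product of \<open>f'\<close> and inverses of \<open>f\<close>.
  This form keeps it inside the class of expressions to which the induction in
  \<open>Cn_on_inverse\<close> applies.\<close>

lemma has_dirderiv_inverse:
  fixes f :: "'a::real_vector \<Rightarrow> complex"
  assumes "has_dirderiv f x h f'" "f x \<noteq> 0"
  shows "has_dirderiv (\<lambda>y. inverse (f y)) x h (f' * - (inverse (f x) * inverse (f x)))"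
proof -
  have "(inverse has_field_derivative - (inverse (f x) * inverse (f x))) (at (f (x + 0 *\<^sub>R h)))"
    using DERIV_inverse[of "f x" UNIV] assms(2) by (simp add: power2_eq_square numeral_2_eq_2)
  from field_vector_diff_chain_at[OF assms(1)[unfolded has_dirderiv_iff_vector_derivative] this]
  show ?thesis
    by (simp add: has_dirderiv_iff_vector_derivative o_def)
qed

lemma has_dirderiv_cmod:
  fixes f :: "'a::real_vector \<Rightarrow> complex"
  assumes "has_dirderiv f x h f'" "f x \<noteq> 0"
  shows "has_dirderiv (\<lambda>y. cmod (f y)) x h (f' \<bullet> sgn (f x))"
  using vector_derivative_diff_chain_within[OF assms(1)[unfolded has_dirderiv_iff_vector_derivative],
      of norm "\<lambda>h. h \<bullet> sgn (f x)"] has_derivative_norm[OF assms(2)]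
  by (simp add: has_dirderiv_iff_vector_derivative o_def has_derivative_at_withinI)

text \<open>Writing the phase as exp (i arg f), its derivative is i d(arg f) times the phase, and
  d(arg f) is the imaginary part of the logarithmic derivative.\<close>

lemma has_dirderiv_sgn:
  fixes f :: "'a::real_vector \<Rightarrow> complex"
  assumes f: "has_dirderiv f x h f'" and nz: "f x \<noteq> 0"
  shows "has_dirderiv (\<lambda>y. sgn (f y)) x h
    (sgn (f x) * (\<i> * complex_of_real (Im (f' * inverse (f x)))))"
proof -
  \<comment> \<open>The logarithmic derivative of \<open>f\<close>: Re w is the derivative of log
    |f|, and Im w that of arg f.\<close>
  define w where "w = f' * inverse (f x)"
  have f': "f' = f x * w"
    using nz by (simp add: w_def)
  have "has_dirderiv (\<lambda>y. f y * inverse (complex_of_real (cmod (f y)))) x h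
    (f' * inverse (complex_of_real (cmod (f x))) + f x *
     (complex_of_real (f' \<bullet> sgn (f x)) * - (inverse (complex_of_real (cmod (f x))) *
       inverse (complex_of_real (cmod (f x))))))"
    using nz by (intro cmult.has_dirderiv has_dirderiv_inverse of_real.has_dirderiv
        has_dirderiv_cmod f) simp_all
  moreover have "sgn z = z * inverse (complex_of_real (cmod z))" for z
    by (simp add: sgn_eq divide_inverse)
  moreover have "f' \<bullet> sgn (f x) = cmod (f x) * Re w"
  proof -
    have "f' \<bullet> sgn (f x) = (Re f' * Re (f x) + Im f' * Im (f x)) / cmod (f x)"
      by (simp add: inner_complex_def add_divide_distrib)
    also have "Re f' * Re (f x) + Im f' * Im (f x) = (cmod (f x))\<^sup>2 * Re w"
      unfolding f' cmod_power2 by (simp add: algebra_simps power2_eq_square)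
    finally show ?thesis
      using nz by (simp add: power2_eq_square)
  qed
  moreover have "f x * w * inverse (complex_of_real (cmod (f x))) + f x *
      (complex_of_real (cmod (f x) * Re w) * - (inverse (complex_of_real (cmod (f x))) *
       inverse (complex_of_real (cmod (f x))))) =
     f x * inverse (complex_of_real (cmod (f x))) * (\<i> * complex_of_real (Im w))"
  proof -
    have "w - complex_of_real (Re w) = \<i> * complex_of_real (Im w)"
      by (simp add: complex_eq_iff)
    then show ?thesis
      using nz by (simp add: divide_simps) (metis right_diff_distrib)
  qed
  ultimately show ?thesis
    by (simp add: w_def[symmetric] f'[symmetric])
qed

lemmas [dirderiv_intros] = has_dirderiv_const has_dirderiv_ident has_dirderiv_add
  has_dirderiv_diff has_dirderiv_Pair has_dirderiv_inverse has_dirderiv_sgn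
  scaleC.has_dirderiv cinner.has_dirderiv cmult.has_dirderiv Re.has_dirderiv Im.has_dirderiv
  cnj.has_dirderiv of_real.has_dirderiv uminus.has_dirderiv fst.has_dirderiv snd.has_dirderiv


section \<open>Smooth maps with parameters\<close>

text \<open>\<open>C^n\<close> in the point \<open>x\<close>, where the sequence \<open>h\<close> of all directions is carried along as a
  parameter: in this way all derivatives have the same type, and closure properties can be proved
  by induction on \<open>n\<close>.\<close>

primrec Cn_on ::
    "nat \<Rightarrow> 'a::lc_space set \<Rightarrow> 'a set \<Rightarrow> ('a \<Rightarrow> (nat \<Rightarrow> 'a) \<Rightarrow> 'b::{lc_space,t2_space}) \<Rightarrow> bool" where
  "Cn_on 0 E U F \<longleftrightarrow> continuous_on (U \<times> (UNIV \<rightarrow> E)) (\<lambda>z. F (fst z) (snd z))"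
| "Cn_on (Suc n) E U F \<longleftrightarrow> continuous_on (U \<times> (UNIV \<rightarrow> E)) (\<lambda>z. F (fst z) (snd z)) \<and>
     (\<forall>k. \<exists>G. Cn_on n E U G \<and>
        (\<forall>x\<in>U. \<forall>h\<in>UNIV \<rightarrow> E. has_dirderiv (\<lambda>y. F y h) x (h k) (G x h)))"

lemma Cn_on_continuous: "Cn_on n E U F \<Longrightarrow> continuous_on (U \<times> (UNIV \<rightarrow> E)) (\<lambda>z. F (fst z) (snd z))"
  by (cases n) auto

lemma Cn_on_Suc_imp: "Cn_on (Suc n) E U F \<Longrightarrow> Cn_on n E U F"
proof (induction n arbitrary: F)
  case (Suc n)
  then show ?case
    by (meson Cn_on.simps(2))
qed simp

lemma Cn_on_subset: "Cn_on n E U F \<Longrightarrow> V \<subseteq> U \<Longrightarrow> Cn_on n E V F"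
proof (induction n arbitrary: F)
  case 0
  then show ?case
    by (auto intro: continuous_on_subset)
next
  case (Suc n)
  have "continuous_on (V \<times> (UNIV \<rightarrow> E)) (\<lambda>z. F (fst z) (snd z))"
    using Suc.prems by (auto intro: continuous_on_subset)
  moreover have "\<exists>G. Cn_on n E V G \<and>
      (\<forall>x\<in>V. \<forall>h\<in>UNIV \<rightarrow> E. has_dirderiv (\<lambda>y. F y h) x (h k) (G x h))" for k
  proof -
    obtain G where "Cn_on n E U G"
        "\<forall>x\<in>U. \<forall>h\<in>UNIV \<rightarrow> E. has_dirderiv (\<lambda>y. F y h) x (h k) (G x h)"
      using Suc.prems(1) unfolding Cn_on.simps by blast
    with Suc.IH Suc.prems(2) show ?thesis
      by blast
  qed
  ultimately show ?case
    by simp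
qed

lemma Cn_on_Suc_I:
  assumes "continuous_on (U \<times> (UNIV \<rightarrow> E)) (\<lambda>z. F (fst z) (snd z))"
    and "\<And>k. Cn_on n E U (G k)"
    and "\<And>k x h. x \<in> U \<Longrightarrow> h \<in> UNIV \<rightarrow> E \<Longrightarrow> has_dirderiv (\<lambda>y. F y h) x (h k) (G k x h)"
  shows "Cn_on (Suc n) E U F"
  unfolding Cn_on.simps using assms by blast

lemma Cn_on_Suc_E:
  assumes "Cn_on (Suc n) E U F"
  obtains G where "\<And>k. Cn_on n E U (G k)"
    "\<And>k x h. x \<in> U \<Longrightarrow> h \<in> UNIV \<rightarrow> E \<Longrightarrow> has_dirderiv (\<lambda>y. F y h) x (h k) (G k x h)"
  using assms by simp metis

text \<open>By induction on k, the k-th iterated derivative agrees on U with a function that is C^n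
  in the point, with the directions as parameters. Every further derivative spends one order, so n
  stays arbitrary in the induction.\<close>

lemma smooth_on_if_Cn_on:
  fixes f :: "'a::lc_space \<Rightarrow> 'b::{lc_space,t2_space}"
  assumes U: "openin (top_of_set E) U" and E: "subspace E"
    and F: "\<And>n. Cn_on n E U (\<lambda>x h. F x)" and eq: "\<And>x. x \<in> U \<Longrightarrow> f x = F x"
  shows "smooth_on E U f"
proof -
  have step: "\<exists>G. Cn_on n E U G \<and> (\<forall>x\<in>U. \<forall>h\<in>UNIV \<rightarrow> E. iter_dirderiv f k h x = G x h)" for n k
  proof (induction k arbitrary: n)
    case 0
    show ?case
      using F[of n] eq by auto
  next
    case (Suc k)
    obtain G where G: "Cn_on (Suc n) E U G"
        "\<forall>x\<in>U. \<forall>h\<in>UNIV \<rightarrow> E. iter_dirderiv f k h x = G x h"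
      using Suc.IH[of "Suc n"] by blast
    obtain D where D: "Cn_on n E U (D k)"
        "\<And>k x h. x \<in> U \<Longrightarrow> h \<in> UNIV \<rightarrow> E \<Longrightarrow> has_dirderiv (\<lambda>y. G y h) x (h k) (D k x h)" for k
      using Cn_on_Suc_E[OF G(1)] by metis
    have "has_dirderiv (iter_dirderiv f k h) x (h k) (D k x h)" if "x \<in> U" "h \<in> UNIV \<rightarrow> E" for x h
    proof (rule iffD2[OF has_dirderiv_openin_cong[OF U that(1) E] D(2)[OF that]])
      show "h k \<in> E"
        using that by auto
      show "iter_dirderiv f k h y = G y h" if "y \<in> U" for y
        using G(2) that \<open>h \<in> UNIV \<rightarrow> E\<close> by blast
    qed
    then have "\<forall>x\<in>U. \<forall>h\<in>UNIV \<rightarrow> E. iter_dirderiv f (Suc k) h x = D k x h"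
      by (simp add: has_dirderiv_imp)
    with D(1)[of k] show ?case
      by blast
  qed
  show ?thesis
    unfolding smooth_on_def
  proof (intro conjI U allI ballI)
    fix k x and h :: "nat \<Rightarrow> 'a"
    assume hx: "h \<in> UNIV \<rightarrow> E" "x \<in> U"
    obtain G where G: "Cn_on (Suc 0) E U G"
        "\<forall>x\<in>U. \<forall>h\<in>UNIV \<rightarrow> E. iter_dirderiv f k h x = G x h"
      using step[of "Suc 0" k] by blast
    obtain D where "\<forall>x\<in>U. \<forall>h\<in>UNIV \<rightarrow> E. has_dirderiv (\<lambda>y. G y h) x (h k) (D x h)"
      using G(1) unfolding Cn_on.simps by blast
    with hx obtain l where l: "has_dirderiv (\<lambda>y. G y h) x (h k) l"
      by blast
    have "has_dirderiv (iter_dirderiv f k h) x (h k) l"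
    proof (rule iffD2[OF has_dirderiv_openin_cong[OF U hx(2) E] l])
      show "h k \<in> E"
        using hx by auto
      show "iter_dirderiv f k h y = G y h" if "y \<in> U" for y
        using G(2) that hx by blast
    qed
    then show "\<exists>l. has_dirderiv (iter_dirderiv f k h) x (h k) l" ..
  next
    fix k
    obtain G where G: "Cn_on 0 E U G" "\<forall>x\<in>U. \<forall>h\<in>UNIV \<rightarrow> E. iter_dirderiv f k h x = G x h"
      using step[of 0 k] by blast
    have "continuous_on (U \<times> (UNIV \<rightarrow> E)) (\<lambda>z. iter_dirderiv f k (snd z) (fst z))"
    proof (rule continuous_on_eq[OF Cn_on_continuous[OF G(1)]])
      show "G (fst z) (snd z) = iter_dirderiv f k (snd z) (fst z)" if "z \<in> U \<times> (UNIV \<rightarrow> E)" for z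
        using that G(2) by (metis SigmaE fst_conv snd_conv)
    qed
    then show "continuous_on (U \<times> (UNIV \<rightarrow> E)) (\<lambda>(x, h). iter_dirderiv f k h x)"
      by (simp add: case_prod_beta)
  qed
qed

section \<open>Closure properties of parametrised C^n maps\<close>

lemma Cn_on_const: "Cn_on n E U (\<lambda>x h. c)"
proof (induction n arbitrary: c)
  case (Suc n)
  show ?case
    by (rule Cn_on_Suc_I[where G = "\<lambda>k x h. 0"]) (auto intro: Suc has_dirderiv_const)
qed simp

text \<open>Directions are parameters, hence constant in the point. They must belong to the class
  because the derivative of the identity in the k-th direction is \<open>h k\<close>.\<close>

lemma Cn_on_dir: "Cn_on n E U (\<lambda>x h. (h k ::'a::{lc_space,t2_space}))"
proof -
  have "continuous_on (U \<times> (UNIV \<rightarrow> E)) (\<lambda>z. snd z k)"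
    by (rule continuous_on_product_then_coordinatewise[OF continuous_on_snd[OF continuous_on_id]])
  then show ?thesis
  proof (induction n)
    case (Suc n)
    then show ?case
      by (intro Cn_on_Suc_I[where G = "\<lambda>k x h. 0"]) (auto intro: Cn_on_const has_dirderiv_const)
  qed simp
qed

lemma Cn_on_ident: "Cn_on n E U (\<lambda>x h. (x::'a::{lc_space,t2_space}))"
proof (cases n)
  case (Suc m)
  show ?thesis
    unfolding Suc by (intro Cn_on_Suc_I[where G = "\<lambda>k x h. h k"])
      (auto intro: Cn_on_dir has_dirderiv_ident continuous_intros)
qed (auto intro: continuous_intros)

lemma Cn_on_add:
  "Cn_on n E U F \<Longrightarrow> Cn_on n E U G \<Longrightarrow> Cn_on n E U (\<lambda>x h. F x h + G x h)"
proof (induction n arbitrary: F G)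
  case (Suc n)
  obtain F' where F': "Cn_on n E U (F' k)"
      "x \<in> U \<Longrightarrow> h \<in> UNIV \<rightarrow> E \<Longrightarrow> has_dirderiv (\<lambda>y. F y h) x (h k) (F' k x h)" for k x h
    using Cn_on_Suc_E[OF Suc.prems(1)] by metis
  obtain G' where G': "Cn_on n E U (G' k)"
      "x \<in> U \<Longrightarrow> h \<in> UNIV \<rightarrow> E \<Longrightarrow> has_dirderiv (\<lambda>y. G y h) x (h k) (G' k x h)" for k x h
    using Cn_on_Suc_E[OF Suc.prems(2)] by metis
  show ?case
    by (rule Cn_on_Suc_I[where G = "\<lambda>k x h. F' k x h + G' k x h"])
       (intro continuous_intros Cn_on_continuous[OF Suc.prems(1)] Cn_on_continuous[OF Suc.prems(2)]
          Suc.IH F' G' has_dirderiv_add; assumption)+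
qed (auto intro: continuous_intros)

lemma Cn_on_Pair:
  "Cn_on n E U F \<Longrightarrow> Cn_on n E U G \<Longrightarrow> Cn_on n E U (\<lambda>x h. (F x h, G x h))"
proof (induction n arbitrary: F G)
  case (Suc n)
  obtain F' where F': "Cn_on n E U (F' k)"
      "x \<in> U \<Longrightarrow> h \<in> UNIV \<rightarrow> E \<Longrightarrow> has_dirderiv (\<lambda>y. F y h) x (h k) (F' k x h)" for k x h
    using Cn_on_Suc_E[OF Suc.prems(1)] by metis
  obtain G' where G': "Cn_on n E U (G' k)"
      "x \<in> U \<Longrightarrow> h \<in> UNIV \<rightarrow> E \<Longrightarrow> has_dirderiv (\<lambda>y. G y h) x (h k) (G' k x h)" for k x h
    using Cn_on_Suc_E[OF Suc.prems(2)] by metis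
  show ?case
    by (rule Cn_on_Suc_I[where G = "\<lambda>k x h. (F' k x h, G' k x h)"])
       (intro continuous_intros Cn_on_continuous[OF Suc.prems(1)] Cn_on_continuous[OF Suc.prems(2)]
          Suc.IH F' G' has_dirderiv_Pair; assumption)+
qed (auto intro: continuous_intros)

lemma (in lc_bilinear) Cn_on:
  "Cn_on n E U F \<Longrightarrow> Cn_on n E U G \<Longrightarrow> Cn_on n E U (\<lambda>x h. B (F x h) (G x h))"
proof (induction n arbitrary: F G)
  case 0
  then show ?case
    by (simp add: continuous_on)
next
  case (Suc n)
  obtain F' where F': "Cn_on n E U (F' k)"
      "x \<in> U \<Longrightarrow> h \<in> UNIV \<rightarrow> E \<Longrightarrow> has_dirderiv (\<lambda>y. F y h) x (h k) (F' k x h)" for k x h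
    using Cn_on_Suc_E[OF Suc.prems(1)] by metis
  obtain G' where G': "Cn_on n E U (G' k)"
      "x \<in> U \<Longrightarrow> h \<in> UNIV \<rightarrow> E \<Longrightarrow> has_dirderiv (\<lambda>y. G y h) x (h k) (G' k x h)" for k x h
    using Cn_on_Suc_E[OF Suc.prems(2)] by metis
  show ?case
    by (rule Cn_on_Suc_I[where G = "\<lambda>k x h. B (F' k x h) (G x h) + B (F x h) (G' k x h)"])
       (intro continuous_on Cn_on_continuous[OF Suc.prems(1)] Cn_on_continuous[OF Suc.prems(2)]
          Cn_on_add Suc.IH F' G' has_dirderiv Suc.prems[THEN Cn_on_Suc_imp]; assumption)+
qed

lemma (in lc_linear) Cn_on:
  "Cn_on n E U F \<Longrightarrow> Cn_on n E U (\<lambda>x h. L (F x h))"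
proof (induction n arbitrary: F)
  case 0
  then show ?case
    by (simp add: continuous_on)
next
  case (Suc n)
  obtain F' where F': "Cn_on n E U (F' k)"
      "x \<in> U \<Longrightarrow> h \<in> UNIV \<rightarrow> E \<Longrightarrow> has_dirderiv (\<lambda>y. F y h) x (h k) (F' k x h)" for k x h
    using Cn_on_Suc_E[OF Suc.prems] by metis
  show ?case
    by (rule Cn_on_Suc_I[where G = "\<lambda>k x h. L (F' k x h)"])
       (intro continuous_on Cn_on_continuous[OF Suc.prems(1)]
          Suc.IH F' has_dirderiv Suc.prems[THEN Cn_on_Suc_imp]; assumption)+
qed

lemma Cn_on_diff:
  assumes "Cn_on n E U F" "Cn_on n E U G"
  shows "Cn_on n E U (\<lambda>x h. F x h - G x h)"
  using Cn_on_add[OF assms(1) uminus.Cn_on[OF assms(2)]] by simp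

text \<open>F stays fixed in the induction: its derivative is \<open>F'\<close> times inverses of
  the same F, and the induction hypothesis covers those one order lower. \<open>Cn_on_sgn\<close>
  follows the same pattern.\<close>

lemma Cn_on_inverse:
  fixes F :: "'a::lc_space \<Rightarrow> (nat \<Rightarrow> 'a) \<Rightarrow> complex"
  assumes "Cn_on n E U F" and nz: "\<And>x h. x \<in> U \<Longrightarrow> h \<in> UNIV \<rightarrow> E \<Longrightarrow> F x h \<noteq> 0"
  shows "Cn_on n E U (\<lambda>x h. inverse (F x h))"
  using assms(1)
proof (induction n)
  case 0
  then show ?case
    using nz by (auto intro!: continuous_intros)
next
  case (Suc n)
  note IH = Suc.IH[OF Cn_on_Suc_imp[OF Suc.prems]]
  obtain F' where F': "Cn_on n E U (F' k)"
      "x \<in> U \<Longrightarrow> h \<in> UNIV \<rightarrow> E \<Longrightarrow> has_dirderiv (\<lambda>y. F y h) x (h k) (F' k x h)" for k x h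
    using Cn_on_Suc_E[OF Suc.prems] by metis
  show ?case
  proof (rule Cn_on_Suc_I[where G = "\<lambda>k x h. F' k x h * - (inverse (F x h) * inverse (F x h))"])
    show "continuous_on (U \<times> (UNIV \<rightarrow> E)) (\<lambda>z. inverse (F (fst z) (snd z)))"
      using Cn_on_continuous[OF Suc.prems] nz by (auto intro!: continuous_intros)
  qed (intro cmult.Cn_on uminus.Cn_on F' IH has_dirderiv_inverse nz; assumption)+
qed

lemma Cn_on_sgn:
  fixes F :: "'a::lc_space \<Rightarrow> (nat \<Rightarrow> 'a) \<Rightarrow> complex"
  assumes "Cn_on n E U F" and nz: "\<And>x h. x \<in> U \<Longrightarrow> h \<in> UNIV \<rightarrow> E \<Longrightarrow> F x h \<noteq> 0"
  shows "Cn_on n E U (\<lambda>x h. sgn (F x h))"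
  using assms(1)
proof (induction n)
  case 0
  then show ?case
    using nz by (auto intro!: continuous_intros)
next
  case (Suc n)
  note F = Cn_on_Suc_imp[OF Suc.prems]
  obtain F' where F': "Cn_on n E U (F' k)"
      "x \<in> U \<Longrightarrow> h \<in> UNIV \<rightarrow> E \<Longrightarrow> has_dirderiv (\<lambda>y. F y h) x (h k) (F' k x h)" for k x h
    using Cn_on_Suc_E[OF Suc.prems] by metis
  show ?case
  proof (rule Cn_on_Suc_I[where
        G = "\<lambda>k x h. sgn (F x h) * (\<i> * complex_of_real (Im (F' k x h * inverse (F x h))))"])
    show "continuous_on (U \<times> (UNIV \<rightarrow> E)) (\<lambda>z. sgn (F (fst z) (snd z)))"
      using Cn_on_continuous[OF Suc.prems] nz by (auto intro!: continuous_intros)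
  qed (intro cmult.Cn_on of_real.Cn_on Im.Cn_on Cn_on_inverse Cn_on_const F' Suc.IH[OF F] F
      has_dirderiv_sgn nz; assumption)+
qed

lemmas Cn_on_intros = Cn_on_const Cn_on_dir Cn_on_ident Cn_on_add Cn_on_diff Cn_on_Pair
  Cn_on_inverse Cn_on_sgn scaleC.Cn_on cinner.Cn_on cmult.Cn_on Re.Cn_on Im.Cn_on
  cnj.Cn_on of_real.Cn_on uminus.Cn_on fst.Cn_on snd.Cn_on


section \<open>The chain rule for complex-valued maps\<close>

text \<open>Linearity of the derivative in the direction is not built in; it is derived in
  \<open>dirderiv_add\<close> and \<open>C1_on_dirderiv_scaleR\<close>.\<close>

definition C1_on :: "'a::lc_space set \<Rightarrow> 'a set \<Rightarrow> ('a \<Rightarrow> 'b::{lc_space,t2_space}) \<Rightarrow> bool" where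
  "C1_on E U f \<longleftrightarrow> openin (top_of_set E) U \<and>
     (\<forall>x\<in>U. \<forall>h\<in>E. has_dirderiv f x h (dirderiv f x h)) \<and>
     continuous_on (U \<times> E) (\<lambda>(x, h). dirderiv f x h)"

lemma C1_on_has_dirderiv: "C1_on E U f \<Longrightarrow> x \<in> U \<Longrightarrow> h \<in> E \<Longrightarrow> has_dirderiv f x h (dirderiv f x h)"
  by (simp add: C1_on_def)

lemma C1_on_subset: "C1_on E U f \<Longrightarrow> U \<subseteq> E"
  by (auto simp: C1_on_def openin_open)

text \<open>\<open>smooth_on\<close> speaks of sequences of directions; a single direction enters
  through the continuous embedding as a constant sequence, at orders 0 and 1.\<close>

lemma C1_on_if_smooth_on:
  assumes "smooth_on E U f"
  shows "C1_on E U f"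
  unfolding C1_on_def
proof (intro conjI ballI)
  show "openin (top_of_set E) U"
    using assms by (simp add: smooth_on_def)
  fix x h
  assume xh: "x \<in> U" "h \<in> E"
  have "\<forall>h \<in> UNIV \<rightarrow> E. \<forall>x \<in> U. \<exists>l. has_dirderiv (iter_dirderiv f 0 h) x (h 0) l"
    using assms(1) unfolding smooth_on_def by blast
  from this[rule_format, of "\<lambda>_. h" x] xh obtain l where "has_dirderiv f x h l"
    by (auto simp: iter_dirderiv.simps(1)[abs_def])
  then show "has_dirderiv f x h (dirderiv f x h)"
    by (simp add: has_dirderiv_imp)
next
  have "continuous_on (U \<times> (UNIV \<rightarrow> E)) (\<lambda>(x, h). iter_dirderiv f (Suc 0) h x)"
    using assms unfolding smooth_on_def by blast
  then have 1: "continuous_on (U \<times> (UNIV \<rightarrow> E)) (\<lambda>z. dirderiv f (fst z) (snd z (0::nat)))"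
    by (simp add: case_prod_beta iter_dirderiv.simps(1)[abs_def])
  have "continuous_on (U \<times> E) (\<lambda>z. (fst z, \<lambda>_::nat. snd z))"
    by (intro continuous_intros continuous_on_coordinatewise_then_product)
  moreover have "(\<lambda>z. (fst z, \<lambda>_::nat. snd z)) ` (U \<times> E) \<subseteq> U \<times> (UNIV \<rightarrow> E)"
    by auto
  ultimately show "continuous_on (U \<times> E) (\<lambda>(x, h). dirderiv f x h)"
    using continuous_on_compose2[OF 1] by (fastforce simp: case_prod_beta)
qed

lemma (in lc_linear) C1_on:
  assumes f: "C1_on E U f"
  shows "C1_on E U (\<lambda>x. L (f x))"
proof -
  have D: "has_dirderiv (\<lambda>x. L (f x)) x h (L (dirderiv f x h))" if "x \<in> U" "h \<in> E" for x h
    using has_dirderiv[OF C1_on_has_dirderiv[OF f that]] .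
  have "continuous_on (U \<times> E) (\<lambda>z. L (dirderiv f (fst z) (snd z)))"
    using f by (intro continuous_on) (simp add: C1_on_def case_prod_beta)
  then have "continuous_on (U \<times> E) (\<lambda>z. dirderiv (\<lambda>x. L (f x)) (fst z) (snd z))"
    by (rule continuous_on_eq) (auto simp: has_dirderiv_imp[OF D])
  then show ?thesis
    using f D by (auto simp: C1_on_def case_prod_beta has_dirderiv_imp[OF D])
qed

lemma C1_on_eq:
  assumes f: "C1_on E U f" and E: "subspace E" and eq: "\<And>x. x \<in> U \<Longrightarrow> f x = g x"
  shows "C1_on E U g"
proof -
  have U: "openin (top_of_set E) U"
    using f by (simp add: C1_on_def)
  have D: "has_dirderiv g x h (dirderiv f x h)" if "x \<in> U" "h \<in> E" for x h
    using C1_on_has_dirderiv[OF f that] has_dirderiv_openin_cong[OF U that(1) E that(2), of f g] eq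
    by blast
  have "continuous_on (U \<times> E) (\<lambda>z. dirderiv f (fst z) (snd z))"
    using f by (simp add: C1_on_def case_prod_beta)
  then have "continuous_on (U \<times> E) (\<lambda>z. dirderiv g (fst z) (snd z))"
    by (rule continuous_on_eq) (auto simp: has_dirderiv_imp[OF D])
  then show ?thesis
    using U D by (auto simp: C1_on_def case_prod_beta has_dirderiv_imp[OF D])
qed

text \<open>The mean value theorem needs real values, so only real parts are compared. Imaginary
  parts are reached later by applying this to multiples of the function.\<close>

lemma mean_value_Re:
  fixes g :: "'a::lc_space \<Rightarrow> complex"
  assumes d: "\<And>s. 0 \<le> s \<Longrightarrow> s \<le> 1 \<Longrightarrow> has_dirderiv g (b + (s * t) *\<^sub>R k) k (D (b + (s * t) *\<^sub>R k))"
    and "t \<noteq> 0"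
  shows "\<exists>s. 0 < s \<and> s < 1 \<and> Re ((1 / t) *\<^sub>R (g (b + t *\<^sub>R k) - g b)) = Re (D (b + (s * t) *\<^sub>R k))"
proof -
  have "((\<lambda>s. Re (g (b + (s * t) *\<^sub>R k))) has_real_derivative t * Re (D (b + (s * t) *\<^sub>R k))) (at s)"
    if "0 \<le> s" "s \<le> 1" for s
  proof -
    \<comment> \<open>A directional derivative is a derivative at parameter 0. Composition with r ->
      (r - s) * t moves it to s, where the mean value theorem on [0, 1] needs it.\<close>
    have "((\<lambda>u. Re (g ((b + (s * t) *\<^sub>R k) + u *\<^sub>R k))) has_vector_derivative
        Re (D (b + (s * t) *\<^sub>R k))) (at 0)"
      using Re.has_dirderiv[OF d[OF that]] by (simp add: has_dirderiv_iff_vector_derivative)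
    then have "((\<lambda>u. Re (g ((b + (s * t) *\<^sub>R k) + u *\<^sub>R k))) has_real_derivative
        Re (D (b + (s * t) *\<^sub>R k))) (at ((s - s) * t))"
      by (simp add: has_real_derivative_iff_has_vector_derivative)
    moreover have "((\<lambda>r. (r - s) * t) has_real_derivative t) (at s)"
      by (auto intro!: derivative_eq_intros)
    ultimately have "((\<lambda>r. Re (g ((b + (s * t) *\<^sub>R k) + ((r - s) * t) *\<^sub>R k))) has_real_derivative
        Re (D (b + (s * t) *\<^sub>R k)) * t) (at s)"
      by (rule DERIV_chain2)
    then show ?thesis
      by (simp add: algebra_simps)
  qed
  from MVT2[of 0 1, OF _ this] obtain s where s: "0 < s" "s < 1"
    "Re (g (b + t *\<^sub>R k)) - Re (g b) = t * Re (D (b + (s * t) *\<^sub>R k))"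
    by auto
  then show ?thesis
    using assms(2) by (intro exI[of _ s]) (simp add: field_simps)
qed

text \<open>Both the base point and the direction may move with \<open>t\<close>; this yields the chain rule as well
  as the additivity of the derivative.\<close>

lemma C1_on_quotient_tendsto:
  fixes g :: "'a::{lc_space,t2_space} \<Rightarrow> complex"
  assumes g: "C1_on E U g" and E: "subspace E" and x: "x \<in> U" and l: "l \<in> E"
    and b: "(b \<longlongrightarrow> x) (at 0)" and k: "(k \<longlongrightarrow> l) (at 0)"
    and bE: "\<forall>\<^sub>F t in at 0. b t \<in> E" and kE: "\<forall>\<^sub>F t in at 0. k t \<in> E"
  shows "((\<lambda>t::real. (1 / t) *\<^sub>R (g (b t + t *\<^sub>R k t) - g (b t))) \<longlongrightarrow> dirderiv g x l) (at 0)"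
    (is "(?q \<longlongrightarrow> _) _")
proof -
  obtain T where T: "open T" "U = E \<inter> T"
    using g by (auto simp: C1_on_def openin_open)
  \<comment> \<open>Local convexity is used here: once both end points, translated by -x, lie in a
    convex neighbourhood W of 0, the whole segment between them stays in U.\<close>
  have "open ((\<lambda>v. x + v) -` T)"
    by (intro open_vimage T continuous_intros)
  moreover have "0 \<in> (\<lambda>v. x + v) -` T"
    using T x by auto
  ultimately obtain W where W: "open W" "0 \<in> W" "convex W" "W \<subseteq> (\<lambda>v. x + v) -` T"
    by (rule locally_convex_0)
  have "((\<lambda>t. b t - x) \<longlongrightarrow> x - x) (at 0)"
    by (intro tendsto_diff b tendsto_const)
  then have W1: "\<forall>\<^sub>F t in at 0. b t - x \<in> W"
    using W(1,2) by (intro topological_tendstoD) auto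
  have "((\<lambda>t. b t + t *\<^sub>R k t - x) \<longlongrightarrow> x + 0 *\<^sub>R l - x) (at 0)"
    by (intro tendsto_diff tendsto_add tendsto_scaleR_lc b k tendsto_const tendsto_ident_at)
  then have W2: "\<forall>\<^sub>F t in at 0. b t + t *\<^sub>R k t - x \<in> W"
    using W(1,2) by (intro topological_tendstoD) auto
  have nz: "\<forall>\<^sub>F t::real in at 0. t \<noteq> 0"
    by (simp add: eventually_at_filter)
  have seg: "\<forall>\<^sub>F t in at 0. \<forall>s. 0 \<le> s \<and> s \<le> 1 \<longrightarrow> b t + (s * t) *\<^sub>R k t \<in> U"
    using W1 W2 bE kE
  proof eventually_elim
    case (elim t)
    show ?case
    proof (intro allI impI)
      fix s :: real
      assume s: "0 \<le> s \<and> s \<le> 1"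
      have "(1 - s) *\<^sub>R (b t - x) + s *\<^sub>R (b t + t *\<^sub>R k t - x) \<in> W"
        using s elim by (intro convexD W) auto
      also have "(1 - s) *\<^sub>R (b t - x) + s *\<^sub>R (b t + t *\<^sub>R k t - x) = b t + (s * t) *\<^sub>R k t - x"
        by (simp add: algebra_simps)
      finally have "b t + (s * t) *\<^sub>R k t \<in> T"
        using W(4) by auto
      then show "b t + (s * t) *\<^sub>R k t \<in> U"
        using elim E by (auto simp: T intro: subspace_add subspace_scale)
    qed
  qed
  \<comment> \<open>The factor c = 1 yields the real part and c = -i the imaginary part. Their
    intermediate points differ, so the two limits are taken separately.\<close>
  have *: "((\<lambda>t. Re (c * ?q t)) \<longlongrightarrow> Re (c * dirderiv g x l)) (at 0)" for c
  proof -
    define P where "P t s \<longleftrightarrow> 0 < s \<and> s < 1 \<and>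
        Re (c * ?q t) = Re (c * dirderiv g (b t + (s * t) *\<^sub>R k t) (k t))" for t s
    have "\<forall>\<^sub>F t in at 0. \<exists>s. P t s"
      using seg kE nz
    proof eventually_elim
      case (elim t)
      have "has_dirderiv (\<lambda>y. c * g y) (b t + (s * t) *\<^sub>R k t) (k t)
          (c * dirderiv g (b t + (s * t) *\<^sub>R k t) (k t))" if "0 \<le> s" "s \<le> 1" for s
        using cmult.has_dirderiv[OF has_dirderiv_const[of c]
            C1_on_has_dirderiv[OF g, of "b t + (s * t) *\<^sub>R k t" "k t"]] elim that by simp
      from mean_value_Re[OF this elim(3)] show ?case
        by (simp add: P_def algebra_simps)
    qed
    \<comment> \<open>The intermediate parameter is chosen for each t without any regularity; its
      bounds 0 and 1 suffice to make s t * t tend to 0.\<close>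
    then have "\<forall>\<^sub>F t in at 0. P t (SOME s. P t s)"
      by (rule eventually_mono) (rule someI_ex)
    moreover define s where "s = (\<lambda>t. SOME s. P t s)"
    ultimately have "\<forall>\<^sub>F t in at 0. P t (s t)"
      by simp
    then have s: "\<forall>\<^sub>F t in at 0. 0 < s t \<and> s t < 1 \<and>
        Re (c * ?q t) = Re (c * dirderiv g (b t + (s t * t) *\<^sub>R k t) (k t))"
      unfolding P_def .
    have "((\<lambda>t. s t * t) \<longlongrightarrow> 0) (at 0)"
    proof (rule Lim_null_comparison)
      show "\<forall>\<^sub>F t in at 0. norm (s t * t) \<le> \<bar>t\<bar>"
        using s by eventually_elim (auto simp: abs_mult mult_left_le_one_le)
      show "((\<lambda>t. \<bar>t\<bar>) \<longlongrightarrow> (0::real)) (at 0)"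
        by (intro tendsto_rabs_zero tendsto_ident_at)
    qed
    then have "((\<lambda>t. b t + (s t * t) *\<^sub>R k t) \<longlongrightarrow> x + 0 *\<^sub>R l) (at 0)"
      by (intro tendsto_add tendsto_scaleR_lc b k)
    then have "((\<lambda>t. (b t + (s t * t) *\<^sub>R k t, k t)) \<longlongrightarrow> (x, l)) (at 0)"
      by (intro tendsto_Pair k) simp
    moreover have "\<forall>\<^sub>F t in at 0. (b t + (s t * t) *\<^sub>R k t, k t) \<in> U \<times> E"
      using seg s kE by eventually_elim auto
    ultimately have "((\<lambda>t. dirderiv g (b t + (s t * t) *\<^sub>R k t) (k t)) \<longlongrightarrow> dirderiv g x l) (at 0)"
      using continuous_on_tendsto_compose[OF g[unfolded C1_on_def, THEN conjunct2, THEN conjunct2]] x l by force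
    then have "((\<lambda>t. Re (c * dirderiv g (b t + (s t * t) *\<^sub>R k t) (k t))) \<longlongrightarrow>
        Re (c * dirderiv g x l)) (at 0)"
      by (intro tendsto_intros)
    moreover have "\<forall>\<^sub>F t in at 0. Re (c * dirderiv g (b t + (s t * t) *\<^sub>R k t) (k t)) = Re (c * ?q t)"
      using s by eventually_elim simp
    ultimately show ?thesis
      by (rule Lim_transform_eventually)
  qed
  show ?thesis
    using *[of 1] *[of "- \<i>"] by (simp add: tendsto_complex_iff minus_divide_left)
qed

text \<open>Hadamard differentiability: unlike continuous differentiability, it passes to products by a
  computation at a single point.\<close>

definition has_hderiv ::
    "'a::{lc_space,t2_space} set \<Rightarrow> 'a set \<Rightarrow> ('a \<Rightarrow> complex) \<Rightarrow> 'a \<Rightarrow> ('a \<Rightarrow> complex) \<Rightarrow> bool" where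
  "has_hderiv E U g x D \<longleftrightarrow> (\<forall>\<gamma> l. \<gamma> 0 = x \<longrightarrow> l \<in> E \<longrightarrow> (\<forall>\<^sub>F t in at 0. \<gamma> t \<in> U) \<longrightarrow>
     has_dirderiv \<gamma> (0::real) 1 l \<longrightarrow> has_dirderiv (\<lambda>t. g (\<gamma> t)) 0 1 (D l))"

lemma has_hderivD:
  "has_hderiv E U g x D \<Longrightarrow> \<gamma> 0 = x \<Longrightarrow> l \<in> E \<Longrightarrow> \<forall>\<^sub>F t in at 0. \<gamma> t \<in> U \<Longrightarrow>
     has_dirderiv \<gamma> (0::real) 1 l \<Longrightarrow> has_dirderiv (\<lambda>t. g (\<gamma> t)) 0 1 (D l)"
  unfolding has_hderiv_def by blast

lemma has_dirderiv_curve: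
  "has_dirderiv (\<lambda>t. f (x + t *\<^sub>R h)) (0::real) 1 l \<longleftrightarrow> has_dirderiv f x h l"
  by (simp add: has_dirderiv_def)

text \<open>A curve is written as \<gamma> t = x + t k(t), where k(t) = (\<gamma> t - x) / t tends
  to l. This is \<open>C1_on_quotient_tendsto\<close> with fixed base point and moving
  direction.\<close>

lemma has_hderiv_C1_on:
  assumes g: "C1_on E U g" and E: "subspace E" and x: "x \<in> U"
  shows "has_hderiv E U g x (dirderiv g x)"
  unfolding has_hderiv_def
proof (intro allI impI)
  fix \<gamma> :: "real \<Rightarrow> _" and l
  assume \<gamma>: "\<gamma> 0 = x" "l \<in> E" "\<forall>\<^sub>F t in at 0. \<gamma> t \<in> U" "has_dirderiv \<gamma> 0 1 l"
  have UE: "U \<subseteq> E"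
    using g by (rule C1_on_subset)
  have "((\<lambda>t. (1 / t) *\<^sub>R (g (x + t *\<^sub>R ((1 / t) *\<^sub>R (\<gamma> t - x))) - g x)) \<longlongrightarrow> dirderiv g x l) (at 0)"
  proof (rule C1_on_quotient_tendsto[OF g E x \<gamma>(2) tendsto_const])
    show "((\<lambda>t. (1 / t) *\<^sub>R (\<gamma> t - x)) \<longlongrightarrow> l) (at 0)"
      using \<gamma>(4) by (simp add: has_dirderiv_def \<gamma>(1))
    show "\<forall>\<^sub>F t in at 0. (1 / t) *\<^sub>R (\<gamma> t - x) \<in> E"
      using \<gamma>(3) by eventually_elim (use UE x E in \<open>auto intro: subspace_scale subspace_diff\<close>)
  qed (use x UE in auto)
  moreover have "\<forall>\<^sub>F t in at 0. (1 / t) *\<^sub>R (g (x + t *\<^sub>R ((1 / t) *\<^sub>R (\<gamma> t - x))) - g x) =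
      (1 / t) *\<^sub>R (g (\<gamma> (0 + t *\<^sub>R 1)) - g (\<gamma> 0))"
    unfolding eventually_at_filter by (intro always_eventually) (simp add: \<gamma>(1))
  ultimately show "has_dirderiv (\<lambda>t. g (\<gamma> t)) 0 1 (dirderiv g x l)"
    unfolding has_dirderiv_def by (rule Lim_transform_eventually)
qed

text \<open>The increment along h + k is the increment along h followed by the one along k from the
  moving base point x + t h; the latter quotient converges by
  \<open>C1_on_quotient_tendsto\<close>.\<close>

lemma dirderiv_add:
  fixes g :: "'a::{lc_space,t2_space} \<Rightarrow> complex"
  assumes g: "C1_on E U g" and E: "subspace E" and x: "x \<in> U" and hk: "h \<in> E" "k \<in> E"
  shows "dirderiv g x (h + k) = dirderiv g x h + dirderiv g x k"
proof -
  have UE: "U \<subseteq> E"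
    using g by (rule C1_on_subset)
  have "((\<lambda>t. (1 / t) *\<^sub>R (g ((x + t *\<^sub>R h) + t *\<^sub>R k) - g (x + t *\<^sub>R h))) \<longlongrightarrow> dirderiv g x k) (at 0)"
  proof (rule C1_on_quotient_tendsto[OF g E x hk(2) _ tendsto_const])
    have "((\<lambda>t. x + t *\<^sub>R h) \<longlongrightarrow> x + 0 *\<^sub>R h) (at 0)"
      by (intro tendsto_add tendsto_scaleR_lc tendsto_const tendsto_ident_at)
    then show "((\<lambda>t. x + t *\<^sub>R h) \<longlongrightarrow> x) (at 0)"
      by simp
  qed (use x UE hk E in \<open>auto intro!: always_eventually subspace_add subspace_scale\<close>)
  moreover have "((\<lambda>t. (1 / t) *\<^sub>R (g (x + t *\<^sub>R h) - g x)) \<longlongrightarrow> dirderiv g x h) (at 0)"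
    using C1_on_has_dirderiv[OF g x hk(1)] by (simp add: has_dirderiv_def)
  ultimately have "((\<lambda>t. (1 / t) *\<^sub>R (g ((x + t *\<^sub>R h) + t *\<^sub>R k) - g (x + t *\<^sub>R h)) +
      (1 / t) *\<^sub>R (g (x + t *\<^sub>R h) - g x)) \<longlongrightarrow> dirderiv g x k + dirderiv g x h) (at 0)"
    by (rule tendsto_add)
  then have "has_dirderiv g x (h + k) (dirderiv g x k + dirderiv g x h)"
    by (simp add: has_dirderiv_def algebra_simps)
  from has_dirderiv_imp[OF this] show ?thesis
    by (simp add: add.commute)
qed

lemma has_dirderiv_scaleR:
  assumes "has_dirderiv g x h l"
  shows "has_dirderiv g x (r *\<^sub>R h) (r *\<^sub>R l)"
proof (cases "r = 0")
  case True
  then show ?thesis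
    by (simp add: has_dirderiv_def)
next
  case False
  have "filterlim (\<lambda>t. t * r) (at 0) (at 0)"
  proof (rule filterlim_atI)
    show "((\<lambda>t. t * r) \<longlongrightarrow> 0) (at 0)"
      by (intro tendsto_mult_left_zero tendsto_ident_at)
    show "\<forall>\<^sub>F t in at 0. t * r \<noteq> 0"
      unfolding eventually_at_filter using False by (intro always_eventually) simp
  qed
  from tendsto_scaleR_lc[OF tendsto_const filterlim_compose[OF assms[unfolded has_dirderiv_def] this]]
  have "((\<lambda>t. r *\<^sub>R (1 / (t * r)) *\<^sub>R (g (x + (t * r) *\<^sub>R h) - g x)) \<longlongrightarrow> r *\<^sub>R l) (at 0)" .
  then show ?thesis
    using False by (simp add: has_dirderiv_def)
qed

lemma has_dirderiv_curve_tendsto: "has_dirderiv \<gamma> (0::real) 1 l \<Longrightarrow> (\<gamma> \<longlongrightarrow> \<gamma> 0) (at 0)"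
  using has_dirderiv_tendsto[of \<gamma> 0 1 l] by simp

lemma has_hderiv_eq:
  assumes "has_hderiv E U g x D" "\<And>y. y \<in> U \<Longrightarrow> g y = g' y" "x \<in> U"
  shows "has_hderiv E U g' x D"
  unfolding has_hderiv_def
proof (intro allI impI)
  fix \<gamma> :: "real \<Rightarrow> _" and l
  assume \<gamma>: "\<gamma> 0 = x" "l \<in> E" "\<forall>\<^sub>F t in at 0. \<gamma> t \<in> U" "has_dirderiv \<gamma> 0 1 l"
  have "\<forall>\<^sub>F t in at 0. g (\<gamma> (0 + t *\<^sub>R 1)) = g' (\<gamma> (0 + t *\<^sub>R 1))"
    using \<gamma>(3) by eventually_elim (simp add: assms(2))
  moreover have "g (\<gamma> 0) = g' (\<gamma> 0)"
    using assms(2,3) \<gamma>(1) by simp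
  ultimately have "has_dirderiv (\<lambda>t. g (\<gamma> t)) 0 1 (D l) \<longleftrightarrow> has_dirderiv (\<lambda>t. g' (\<gamma> t)) 0 1 (D l)"
    by (rule has_dirderiv_cong)
  then show "has_dirderiv (\<lambda>t. g' (\<gamma> t)) 0 1 (D l)"
    using has_hderivD[OF assms(1) \<gamma>] by simp
qed

lemma has_hderiv_add:
  assumes "has_hderiv E U f x D" "has_hderiv E U g x D'"
  shows "has_hderiv E U (\<lambda>y. f y + g y) x (\<lambda>l. D l + D' l)"
  unfolding has_hderiv_def
  by (intro allI impI has_dirderiv_add has_hderivD[OF assms(1)] has_hderivD[OF assms(2)])

lemma has_hderiv_mult:
  assumes "has_hderiv E U f x D" "has_hderiv E U g x D'"
  shows "has_hderiv E U (\<lambda>y. f y * g y) x (\<lambda>l. D l * g x + f x * D' l)"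
  unfolding has_hderiv_def
proof (intro allI impI)
  fix \<gamma> :: "real \<Rightarrow> _" and l
  assume \<gamma>: "\<gamma> 0 = x" "l \<in> E" "\<forall>\<^sub>F t in at 0. \<gamma> t \<in> U" "has_dirderiv \<gamma> 0 1 l"
  from cmult.has_dirderiv[OF has_hderivD[OF assms(1) \<gamma>] has_hderivD[OF assms(2) \<gamma>]]
  show "has_dirderiv (\<lambda>t. f (\<gamma> t) * g (\<gamma> t)) 0 1 (D l * g x + f x * D' l)"
    by (simp add: \<gamma>(1))
qed

lemma C1_on_dirderiv_scaleR:
  "C1_on E U g \<Longrightarrow> x \<in> U \<Longrightarrow> h \<in> E \<Longrightarrow> dirderiv g x (r *\<^sub>R h) = r *\<^sub>R dirderiv g x h"
  by (intro has_dirderiv_imp has_dirderiv_scaleR C1_on_has_dirderiv)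


section \<open>Quotient topologies\<close>

lemma continuous_map_quotient: "continuous_map X (quotient_topology X f) f"
  by (auto simp: continuous_map_def openin_quotient_topology topspace_quotient_topology)

text \<open>Because D is open, f restricted to the preimage of D is again a quotient map: relatively
  open sets on both sides are open in the whole spaces.\<close>

lemma continuous_map_from_quotient:
  assumes D: "openin (quotient_topology X f) D"
    and g: "continuous_map (subtopology X {x \<in> topspace X. f x \<in> D}) Y (\<lambda>x. g (f x))"
  shows "continuous_map (subtopology (quotient_topology X f) D) Y g"
proof -
  have DX: "D \<subseteq> f ` topspace X" and oD: "openin X {x \<in> topspace X. f x \<in> D}"
    using D by (auto simp: openin_quotient_topology)
  show ?thesis
    unfolding continuous_map_def
  proof (intro conjI allI impI)
    show "g \<in> topspace (subtopology (quotient_topology X f) D) \<rightarrow> topspace Y"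
      using g DX by (auto simp: continuous_map_def topspace_quotient_topology Pi_iff)
    fix U
    assume "openin Y U"
    with g have "openin (subtopology X {x \<in> topspace X. f x \<in> D})
        {x \<in> topspace (subtopology X {x \<in> topspace X. f x \<in> D}). g (f x) \<in> U}"
      unfolding continuous_map_def by blast
    moreover have "{x \<in> topspace (subtopology X {x \<in> topspace X. f x \<in> D}). g (f x) \<in> U} =
        {x \<in> topspace X. f x \<in> D \<and> g (f x) \<in> U}"
      by auto
    ultimately have "openin X {x \<in> topspace X. f x \<in> D \<and> g (f x) \<in> U}"
      by (simp add: openin_open_subtopology[OF oD])
    moreover have "{x \<in> topspace (subtopology (quotient_topology X f) D). g x \<in> U} = {y \<in> D. g y \<in> U}"
      using DX by (auto simp: topspace_quotient_topology)
    moreover have "{x \<in> topspace X. f x \<in> {y \<in> D. g y \<in> U}} =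
        {x \<in> topspace X. f x \<in> D \<and> g (f x) \<in> U}"
      by auto
    ultimately show "openin (subtopology (quotient_topology X f) D)
        {x \<in> topspace (subtopology (quotient_topology X f) D). g x \<in> U}"
      using DX by (auto simp: openin_open_subtopology[OF D] openin_quotient_topology)
  qed
qed

lemma continuous_map_from_quotient_UNIV:
  assumes "continuous_map X Y (\<lambda>x. g (f x))"
  shows "continuous_map (quotient_topology X f) Y g"
proof -
  have "{x \<in> topspace X. f x \<in> topspace (quotient_topology X f)} = topspace X"
    by (auto simp: topspace_quotient_topology)
  then show ?thesis
    using continuous_map_from_quotient[of X f "topspace (quotient_topology X f)" Y g] assms
    by simp
qed


section \<open>Affine charts of projective type\<close>

definition qmap :: "('v::hermitian_lc_space \<Rightarrow> complex) \<Rightarrow> 'v \<Rightarrow> 'v \<Rightarrow> 'v" where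
  "qmap L j x = inverse (L x) *\<^sub>C x - j"

text \<open>The differential of \<open>qmap L j\<close> at x in the direction u, by the quotient
  rule; the shift j drops out.\<close>

definition dq :: "('v::hermitian_lc_space \<Rightarrow> complex) \<Rightarrow> 'v \<Rightarrow> 'v \<Rightarrow> 'v" where
  "dq L x u = inverse (L x) *\<^sub>C u - (L u * inverse (L x) * inverse (L x)) *\<^sub>C x"

lemma lc_linear_cinner: "lc_linear (cinner (j::'v::hermitian_lc_space))"
  by unfold_locales (auto simp: cinner_simps scaleR_conv_of_real intro!: continuous_intros)

text \<open>The real part is kept as a complex number so that the charts of the sphere and of the
  projective space are instances of the same \<open>qmap\<close>.\<close>

definition rinner :: "'v::hermitian_lc_space \<Rightarrow> 'v \<Rightarrow> complex" where
  "rinner j x = complex_of_real (Re (cinner j x))"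

lemma lc_linear_rinner: "lc_linear (rinner j)"
  unfolding rinner_def
  by unfold_locales (auto simp: cinner_simps scaleR_conv_of_real intro!: continuous_intros)

lemma has_dirderiv_qmap:
  assumes "lc_linear L" "has_dirderiv f x h f'" "L (f x) \<noteq> 0"
  shows "has_dirderiv (\<lambda>y. qmap L j (f y)) x h (dq L (f x) f')"
  unfolding qmap_def
  by (rule has_dirderiv_eq[OF has_dirderiv_diff[OF scaleC.has_dirderiv[OF
          has_dirderiv_inverse[OF lc_linear.has_dirderiv[OF assms(1,2)] assms(3)] assms(2)]
        has_dirderiv_const]])
     (simp add: dq_def algebra_simps)

lemma Cn_on_qmap:
  assumes "lc_linear L" "Cn_on n E U F" "\<And>x h. x \<in> U \<Longrightarrow> h \<in> UNIV \<rightarrow> E \<Longrightarrow> L (F x h) \<noteq> 0"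
  shows "Cn_on n E U (\<lambda>x h. qmap L j (F x h))"
  unfolding qmap_def using assms by (intro Cn_on_intros lc_linear.Cn_on[OF assms(1)]) auto

lemma dq_add: "lc_linear L \<Longrightarrow> dq L x (u + v) = dq L x u + dq L x v"
  by (simp add: dq_def lc_linear.add algebra_simps)

lemma dq_scaleC: "L (c *\<^sub>C u) = c * L u \<Longrightarrow> dq L x (c *\<^sub>C u) = c *\<^sub>C dq L x u"
  by (simp add: dq_def algebra_simps)

lemma dq_scale_both:
  "c \<noteq> 0 \<Longrightarrow> L (c *\<^sub>C x) = c * L x \<Longrightarrow> L (c *\<^sub>C u) = c * L u \<Longrightarrow> dq L (c *\<^sub>C x) (c *\<^sub>C u) = dq L x u"
  by (cases "L x = 0") (simp_all add: dq_def field_simps)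

lemma dq_1: "L x = 1 \<Longrightarrow> L u = 0 \<Longrightarrow> dq L x u = u"
  by (simp add: dq_def)

text \<open>\<open>inverse (L x) *\<^sub>C x\<close> does not change when x is multiplied by a
  scalar with which L commutes, so its differential kills the radial direction
  \<open>c *\<^sub>C x\<close>.\<close>

lemma dq_shift:
  assumes "lc_linear L" "L x \<noteq> 0" "L (c *\<^sub>C x) = c * L x"
  shows "dq L x (u + c *\<^sub>C x) = dq L x u" "dq L x (u - c *\<^sub>C x) = dq L x u"
  using assms by (simp_all add: dq_def lc_linear.add lc_linear.diff algebra_simps)

text \<open>The differential of a chart change; here \<open>inverse (L x) *\<^sub>C x\<close> represents the point with
  representative \<open>x\<close> in the chart given by \<open>L\<close>.\<close>

lemma dq_chain:
  assumes "lc_linear L'" "L x \<noteq> 0" "L' x \<noteq> 0"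
    and "\<And>y. L' (inverse (L x) *\<^sub>C y) = inverse (L x) * L' y"
    and "L' ((L u * inverse (L x)) *\<^sub>C x) = L u * inverse (L x) * L' x"
  shows "dq L' (inverse (L x) *\<^sub>C x) (dq L x u) = dq L' x u"
proof -
  have "dq L x u = inverse (L x) *\<^sub>C (u - (L u * inverse (L x)) *\<^sub>C x)"
    by (simp add: dq_def algebra_simps)
  then have "dq L' (inverse (L x) *\<^sub>C x) (dq L x u) = dq L' x (u - (L u * inverse (L x)) *\<^sub>C x)"
    using assms by (simp add: dq_scale_both)
  also have "\<dots> = dq L' x u"
    using assms by (intro dq_shift)
  finally show ?thesis .
qed

text \<open>Both the projective space and the sphere are quotients of \<open>V - {0}\<close>, by all nonzero scalars
  and by the positive ones, and have charts of the form \<^const>\<open>qmap\<close>. Here \<open>cl\<close> is the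
  projection, \<open>K\<close> is the field of scalars for which the functionals \<open>L j\<close> are linear, and \<open>G\<close>
  is the group of scalars divided out.\<close>

locale qcharts =
  fixes X :: "('m, 'v::hermitian_lc_space, 'v) mfd"
    and cl :: "'v \<Rightarrow> 'm"
    and L :: "'v \<Rightarrow> 'v \<Rightarrow> complex"
    and K G :: "complex set"
  assumes lin: "lc_linear (L j)"
    and L_K: "L j x \<in> K"
    and L_scale: "c \<in> K \<Longrightarrow> L j (c *\<^sub>C x) = c * L j x"
    and L_unit: "hnorm j = 1 \<Longrightarrow> L j j = 1"
    and K_mult: "a \<in> K \<Longrightarrow> b \<in> K \<Longrightarrow> a * b \<in> K"
    and K_inverse: "a \<in> K \<Longrightarrow> inverse a \<in> K"
    and G_open: "open G"
    and G_0: "0 \<notin> G"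
    and G_1: "1 \<in> G"
    and G_inverse: "a \<in> G \<Longrightarrow> inverse a \<in> G"
    and cl_scale: "a \<in> G \<Longrightarrow> a \<in> K \<Longrightarrow> cl (a *\<^sub>C x) = cl x"
    and top_X: "mtop X = quotient_topology (top_of_set (- {0})) cl"
    and mix_X [simp]: "mix X = {j. hnorm j = 1}"
    and mmodel_X: "mmodel X j = {v. L j v = 0}"
    and mdom_X: "hnorm j = 1 \<Longrightarrow> mdom X j \<subseteq> cl ` {x. L j x \<in> G}"
    and cl_mdom: "hnorm j = 1 \<Longrightarrow> x \<noteq> 0 \<Longrightarrow> cl x \<in> mdom X j \<longleftrightarrow> L j x \<in> G"
    and mchart_X: "hnorm j = 1 \<Longrightarrow> L j x \<in> G \<Longrightarrow> mchart X j (cl x) = qmap (L j) j x"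
    and chart_ex: "x \<noteq> 0 \<Longrightarrow> \<exists>c\<in>G \<inter> K. hnorm (c *\<^sub>C x) = 1"
begin

section \<open>Charts and chart changes of a quotient of V - {0}\<close>

lemma L_add: "L j (x + y) = L j x + L j y"
  by (rule lc_linear.add[OF lin])

lemma L_diff: "L j (x - y) = L j x - L j y"
  by (rule lc_linear.diff[OF lin])

lemma L_zero: "L j 0 = 0"
  by (rule lc_linear.zero[OF lin])

lemma continuous_on_L [continuous_intros]: "continuous_on S f \<Longrightarrow> continuous_on S (\<lambda>x. L j (f x))"
  by (rule lc_linear.continuous_on[OF lin])

lemma G_nonzero: "c \<in> G \<Longrightarrow> c \<noteq> 0"
  using G_0 by auto

lemma L_G_nonzero: "L j x \<in> G \<Longrightarrow> x \<noteq> 0"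
  using L_zero G_0 by auto

lemma L_translate: "hnorm j = 1 \<Longrightarrow> L j x = 0 \<Longrightarrow> L j (j + x) = 1"
  by (simp add: L_add L_unit)

lemma translate_nonzero: "hnorm j = 1 \<Longrightarrow> L j x = 0 \<Longrightarrow> j + x \<noteq> 0"
  using L_translate[of j x] L_zero by force

lemma translate_mdom: "hnorm j = 1 \<Longrightarrow> L j x = 0 \<Longrightarrow> cl (j + x) \<in> mdom X j"
  using translate_nonzero[of j x] by (simp add: cl_mdom L_translate G_1)

lemma L_qmap: "hnorm j = 1 \<Longrightarrow> L j x \<in> G \<Longrightarrow> L j (qmap (L j) j x) = 0"
  using G_nonzero[of "L j x"] by (simp add: qmap_def L_diff L_scale K_inverse L_K L_unit)

lemma translate_qmap: "j + qmap (L j) j x = inverse (L j x) *\<^sub>C x"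
  by (simp add: qmap_def)

lemma cl_translate_qmap: "L j x \<in> G \<Longrightarrow> cl (j + qmap (L j) j x) = cl x"
  by (simp add: translate_qmap cl_scale G_inverse K_inverse L_K)

lemma mchart_translate: "hnorm j = 1 \<Longrightarrow> L j x = 0 \<Longrightarrow> mchart X j (cl (j + x)) = x"
  by (simp add: mchart_X L_translate G_1 qmap_def)

lemma mdom_E:
  assumes "p \<in> mdom X j" "hnorm j = 1"
  obtains x where "L j x = 0" "p = cl (j + x)"
proof -
  from assms mdom_X[of j] obtain y where "p = cl y" "L j y \<in> G"
    by auto
  with assms that[of "qmap (L j) j y"] show thesis
    by (simp add: L_qmap cl_translate_qmap)
qed

lemma inj_mchart: "hnorm j = 1 \<Longrightarrow> inj_on (mchart X j) (mdom X j)"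
  by (rule inj_on_inverseI[where g = "\<lambda>x. cl (j + x)"]) (auto elim!: mdom_E simp: mchart_translate)

lemma mchart_image_Int:
  "hnorm j = 1 \<Longrightarrow> mchart X j ` (mdom X j \<inter> S) = {x. L j x = 0 \<and> cl (j + x) \<in> S}"
  by (force elim!: mdom_E simp: mchart_translate translate_mdom intro: image_eqI)

lemma mchart_image: "hnorm j = 1 \<Longrightarrow> mchart X j ` mdom X j = mmodel X j"
  using mchart_image_Int[of j UNIV] by (simp add: mmodel_X)

lemma param_translate: "hnorm j = 1 \<Longrightarrow> L j x = 0 \<Longrightarrow> param X j x = cl (j + x)"
  unfolding param_def
  using inv_into_f_f[OF inj_mchart translate_mdom[of j x]] by (simp add: mchart_translate)

lemma subspace_mmodel: "subspace (mmodel X j)"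
  by (rule subspaceI)
     (auto simp: mmodel_X L_zero L_add lc_linear.scaleR[OF lin])

lemma points_X: "points X = cl ` (- {0})"
  by (simp add: top_X topspace_quotient_topology)

lemma continuous_map_cl: "continuous_map (top_of_set (- {0})) (mtop X) cl"
  unfolding top_X by (rule continuous_map_quotient)

lemma openin_mdom:
  assumes "hnorm j = 1"
  shows "openin (mtop X) (mdom X j)"
proof -
  have "{x. x \<noteq> 0 \<and> cl x \<in> mdom X j} = - {0} \<inter> (\<lambda>x. L j x) -` G"
    using assms by (auto simp: cl_mdom)
  moreover have "open ((\<lambda>x. L j x) -` G)"
    by (intro open_vimage G_open continuous_intros)
  moreover have "mdom X j \<subseteq> cl ` (- {0})"
    using mdom_X[OF assms] L_G_nonzero by blast
  ultimately show ?thesis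
    unfolding top_X openin_quotient_topology by (auto simp: openin_open)
qed

lemma mchart_transition:
  assumes "hnorm i = 1" "hnorm j = 1" "L i x = 0" "L j (i + x) \<in> G"
  shows "(mchart X j \<circ> param X i) x = qmap (L j) j (i + x)"
  using assms by (simp add: param_translate mchart_X)

lemma openin_transition_dom: "openin (top_of_set (mmodel X i)) {x. L i x = 0 \<and> L j (i + x) \<in> G}"
proof -
  have "open ((\<lambda>x. L j (i + x)) -` G)"
    by (intro open_vimage G_open continuous_intros)
  moreover have "{x. L i x = 0 \<and> L j (i + x) \<in> G} = mmodel X i \<inter> (\<lambda>x. L j (i + x)) -` G"
    by (auto simp: mmodel_X)
  ultimately show ?thesis
    by (auto simp: openin_open)
qed

lemma smooth_on_transition:
  assumes "hnorm i = 1" "hnorm j = 1"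
  shows "smooth_on (mmodel X i) (mchart X i ` (mdom X i \<inter> mdom X j)) (mchart X j \<circ> param X i)"
proof -
  have eq: "mchart X i ` (mdom X i \<inter> mdom X j) = {x. L i x = 0 \<and> L j (i + x) \<in> G}"
    using assms by (auto simp: mchart_image_Int cl_mdom translate_nonzero)
  show ?thesis
    unfolding eq
  proof (rule smooth_on_if_Cn_on[OF openin_transition_dom subspace_mmodel])
    show "Cn_on n (mmodel X i) {x. L i x = 0 \<and> L j (i + x) \<in> G} (\<lambda>x h. qmap (L j) j (i + x))" for n
      using G_0 by (intro Cn_on_qmap lin Cn_on_intros) auto
  qed (use assms mchart_transition in auto)
qed

lemma has_dirderiv_transition:
  assumes "hnorm i = 1" "hnorm j = 1" "L i x = 0" "L j (i + x) \<in> G" "L i v = 0"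
  shows "has_dirderiv (mchart X j \<circ> param X i) x v (dq (L j) (i + x) v)"
proof (rule iffD2[OF has_dirderiv_openin_cong[OF openin_transition_dom _ subspace_mmodel]])
  show "has_dirderiv (\<lambda>y. qmap (L j) j (i + y)) x v (dq (L j) (i + x) v)"
    using assms G_0
    by (intro has_dirderiv_qmap lin has_dirderiv_eq[OF has_dirderiv_add[OF has_dirderiv_const has_dirderiv_ident]]) auto
qed (use assms mchart_transition in \<open>auto simp: mmodel_X\<close>)

text \<open>Continuity of the chart is checked on representatives and descends to the quotient. The
  inverse x -> cl (i + x) is a composition of continuous maps.\<close>

lemma homeomorphic_map_mchart:
  assumes "hnorm i = 1"
  shows "homeomorphic_map (subtopology (mtop X) (mdom X i)) (top_of_set (mchart X i ` mdom X i))
    (mchart X i)"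
  unfolding homeomorphic_map_maps
proof (intro exI, unfold homeomorphic_maps_def, intro conjI)
  have "x \<noteq> 0 \<and> cl x \<in> mdom X i \<longleftrightarrow> L i x \<in> G" for x
    using cl_mdom[OF assms, of x] L_G_nonzero[of i x] by blast
  then have dom: "{x \<in> topspace (top_of_set (- {0})). cl x \<in> mdom X i} = {x. L i x \<in> G}"
    by simp
  have sub: "{x. L i x \<in> G} \<subseteq> - {0}"
    using L_G_nonzero by blast
  have "continuous_on {x. L i x \<in> G} (\<lambda>x. qmap (L i) i x)"
    unfolding qmap_def using G_0 by (intro continuous_intros) auto
  then have "continuous_on {x. L i x \<in> G} (\<lambda>x. mchart X i (cl x))"
    by (rule continuous_on_eq) (simp add: mchart_X assms)
  moreover have "- {0} \<inter> {x. L i x \<in> G} = {x. L i x \<in> G}"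
    using sub by blast
  ultimately have "continuous_map (subtopology (top_of_set (- {0})) {x. L i x \<in> G}) euclidean
      (\<lambda>x. mchart X i (cl x))"
    unfolding subtopology_subtopology by simp
  then have "continuous_map (subtopology (mtop X) (mdom X i)) euclidean (mchart X i)"
    unfolding top_X using openin_mdom[OF assms, unfolded top_X]
    by (intro continuous_map_from_quotient) (simp_all only: dom)
  then show "continuous_map (subtopology (mtop X) (mdom X i)) (top_of_set (mchart X i ` mdom X i)) (mchart X i)"
    by (auto simp: continuous_map_in_subtopology)
  have "continuous_map (top_of_set (mmodel X i)) (top_of_set (- {0})) (\<lambda>x. i + x)"
    using translate_nonzero[OF assms] by (auto simp: mmodel_X continuous_map_in_subtopology intro!: continuous_intros)
  from continuous_map_compose[OF this continuous_map_cl]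
  show "continuous_map (top_of_set (mchart X i ` mdom X i)) (subtopology (mtop X) (mdom X i)) (\<lambda>x. cl (i + x))"
    using assms by (auto simp: continuous_map_in_subtopology mchart_image mmodel_X o_def translate_mdom)
qed (use assms in \<open>auto elim!: mdom_E simp: mchart_image mmodel_X mchart_translate\<close>)

lemma mdom_covers: "(\<Union>i\<in>mix X. mdom X i) = points X"
proof (intro equalityI subsetI)
  fix p
  assume "p \<in> points X"
  then obtain x where x: "x \<noteq> 0" "p = cl x"
    by (auto simp: points_X)
  obtain c where c: "c \<in> G \<inter> K" "hnorm (c *\<^sub>C x) = 1"
    using chart_ex[OF x(1)] by blast
  \<comment> \<open>The normalised representative serves as the index of the chart; the point is the
    centre of that chart.\<close>
  then show "p \<in> (\<Union>i\<in>mix X. mdom X i)"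
    using translate_mdom[of "c *\<^sub>C x" 0] x by (auto simp: L_zero cl_scale)
qed (use openin_mdom openin_subset in fastforce)

lemma smooth_manifold_X: "Hausdorff_space (mtop X) \<Longrightarrow> smooth_manifold X"
  unfolding smooth_manifold_def
  using mdom_covers openin_mdom subspace_mmodel homeomorphic_map_mchart smooth_on_transition
  by (auto simp: mchart_image)

section \<open>Tangent vectors as images of u under the differential of \<open>cl\<close> at the
  representative x\<close>

definition tangent :: "'v \<Rightarrow> 'v \<Rightarrow> 'v \<Rightarrow> 'v" where
  "tangent x u = (\<lambda>j. if hnorm j = 1 \<and> L j x \<in> G then dq (L j) x u else 0)"

lemma tangent_add: "tangent x (u + v) = (\<lambda>j. tangent x u j + tangent x v j)"
  by (auto simp: tangent_def dq_add[OF lin])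

lemma tangent_scaleC: "c \<in> K \<Longrightarrow> tangent x (c *\<^sub>C u) = (\<lambda>j. c *\<^sub>C tangent x u j)"
  by (auto simp: tangent_def dq_scaleC L_scale)

text \<open>The infinitesimal form of \<open>cl (c *\<^sub>C x) = cl x\<close>.\<close>

lemma tangent_scale_both:
  assumes "c \<in> G" "c \<in> K" and x: "x \<noteq> 0"
  shows "tangent (c *\<^sub>C x) (c *\<^sub>C u) = tangent x u"
proof -
  have c: "c \<noteq> 0"
    using assms G_nonzero by blast
  have "c * L j x \<in> G \<longleftrightarrow> L j x \<in> G" if "hnorm j = 1" for j
    using cl_mdom[OF that, of "c *\<^sub>C x"] cl_mdom[OF that, of x] cl_scale[of c x] assms c
    by (simp add: L_scale)
  then show ?thesis
    using assms c by (auto simp: tangent_def fun_eq_iff dq_scale_both L_scale)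
qed

lemma dq_transition:
  assumes "L i x \<in> G" "L j x \<in> G"
  shows "dq (L j) (inverse (L i x) *\<^sub>C x) (dq (L i) x u) = dq (L j) x u"
  using assms by (intro dq_chain lin L_scale K_mult K_inverse L_K) (auto dest: G_nonzero)

lemma L_dq: "L i x \<in> G \<Longrightarrow> L i (dq (L i) x u) = 0"
  using G_nonzero[of "L i x"] by (simp add: dq_def L_diff L_scale K_inverse K_mult L_K)

text \<open>The compatibility of the components with chart changes is the algebraic identity
  \<open>dq_transition\<close>, which stands in for the chain rule.\<close>

lemma tangent_mem:
  assumes "x \<noteq> 0"
  shows "tangent x u \<in> tangent_space X (cl x)"
proof -
  have *: "dq (L j) x u = dirderiv (mchart X j \<circ> param X i) (mchart X i (cl x)) (dq (L i) x u)"
    if "hnorm i = 1" "L i x \<in> G" "hnorm j = 1" "L j x \<in> G" for i j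
  proof -
    have "cl (i + qmap (L i) i x) \<in> mdom X j"
      using that assms by (simp add: cl_translate_qmap cl_mdom)
    then have "L j (i + qmap (L i) i x) \<in> G"
      using that cl_mdom[of j "i + qmap (L i) i x"] L_qmap[of i x] translate_nonzero by blast
    from has_dirderiv_imp[OF has_dirderiv_transition[OF that(1,3) L_qmap[OF that(1,2)] this L_dq[OF that(2)]]]
    show ?thesis
      using that by (simp add: mchart_X translate_qmap dq_transition)
  qed
  have dom: "i \<in> mix X \<and> cl x \<in> mdom X i \<longleftrightarrow> hnorm i = 1 \<and> L i x \<in> G" for i
    using cl_mdom[OF _ assms, of i] by auto
  show ?thesis
    unfolding tangent_space_def dom
    using * by (simp add: tangent_def mmodel_X L_dq)
qed

text \<open>The chart indexed by the unit vector x is centred at \<open>cl x\<close>, where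
  \<open>dq (L j) x\<close> is the differential of the change to the chart j. So the component at x
  determines all the others.\<close>

lemma tangent_space_E:
  assumes "\<xi> \<in> tangent_space X (cl x)" "hnorm x = 1"
  shows "\<xi> = tangent x (\<xi> x)" "L x (\<xi> x) = 0"
proof -
  have x: "x \<noteq> 0" "L x x \<in> G"
    using assms unit_nonzero by (auto simp: L_unit G_1)
  then show 0: "L x (\<xi> x) = 0"
    using assms by (auto simp: tangent_space_def cl_mdom mmodel_X)
  have ch: "mchart X x (cl x) = 0"
    using assms mchart_translate[of x 0] by (simp add: L_zero)
  show "\<xi> = tangent x (\<xi> x)"
  proof
    fix j
    show "\<xi> j = tangent x (\<xi> x) j"
    proof (cases "hnorm j = 1 \<and> L j x \<in> G")
      case True
      then have "\<xi> j = dirderiv (mchart X j \<circ> param X x) (mchart X x (cl x)) (\<xi> x)"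
        using assms x by (auto simp: tangent_space_def cl_mdom)
      also have "\<dots> = dq (L j) x (\<xi> x)"
        using has_dirderiv_imp[OF has_dirderiv_transition[of x j 0 "\<xi> x"]] assms True 0
        by (simp add: ch L_zero)
      finally show ?thesis
        using True by (simp add: tangent_def)
    next
      case False
      then show ?thesis
        using assms x by (auto simp: tangent_space_def cl_mdom tangent_def)
    qed
  qed
qed

lemma tangent_space_eq:
  assumes "x \<noteq> 0"
  shows "tangent_space X (cl x) = range (tangent x)"
proof (intro equalityI subsetI)
  fix \<xi>
  assume \<xi>: "\<xi> \<in> tangent_space X (cl x)"
  obtain c where c: "c \<in> G" "c \<in> K" "hnorm (c *\<^sub>C x) = 1"
    using chart_ex[OF assms] by blast
  have "\<xi> = tangent (c *\<^sub>C x) (c *\<^sub>C (inverse c *\<^sub>C \<xi> (c *\<^sub>C x)))"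
    using tangent_space_E(1)[of \<xi> "c *\<^sub>C x"] \<xi> c G_nonzero by (simp add: cl_scale)
  also have "\<dots> = tangent x (inverse c *\<^sub>C \<xi> (c *\<^sub>C x))"
    using c assms by (intro tangent_scale_both)
  finally show "\<xi> \<in> range (tangent x)"
    by blast
qed (use tangent_mem[OF assms] in auto)

lemma tangent_vector_eq:
  assumes "hnorm i = 1" "L i x = 0" "L i v = 0"
  shows "tangent_vector X i (cl (i + x)) v = tangent (i + x) v"
  unfolding tangent_vector_def tangent_def
  using assms has_dirderiv_imp[OF has_dirderiv_transition[OF assms(1) _ assms(2) _ assms(3)]]
  by (auto simp: cl_mdom translate_nonzero mchart_translate fun_eq_iff)

lemma tangent_self:
  assumes "hnorm x = 1" "L x u = 0"
  shows "tangent x u x = u"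
  using assms by (simp add: tangent_def L_unit G_1 dq_1)

end


section \<open>The charts of the projective space and of the sphere\<close>

definition nrm :: "'v::hermitian_lc_space \<Rightarrow> 'v" where
  "nrm x = complex_of_real (inverse (hnorm x)) *\<^sub>C x"

lemma hnorm_nrm: "x \<noteq> 0 \<Longrightarrow> hnorm (nrm x) = 1"
  unfolding nrm_def by (rule hnorm_normalize)

lemma nrm_unit: "hnorm x = 1 \<Longrightarrow> nrm x = x"
  by (simp add: nrm_def)

lemma nrm_scale: "0 < r \<Longrightarrow> nrm (complex_of_real r *\<^sub>C x) = nrm x"
  by (simp add: nrm_def hnorm_scaleC)

lemma nrm_scale_phase: "cmod z = 1 \<Longrightarrow> nrm (z *\<^sub>C x) = z *\<^sub>C nrm x"
  by (simp add: nrm_def hnorm_scaleC mult.commute)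

lemma nrm_nonzero: "x \<noteq> 0 \<Longrightarrow> nrm x \<noteq> 0"
  using hnorm_nrm unit_nonzero by blast

lemma self_mem_cline: "x \<in> cline x"
  unfolding cline_def by (metis rangeI scaleC_one)

lemma cline_scale: 
  assumes "c \<noteq> 0"
  shows "cline (c *\<^sub>C x) = cline x"
proof -
  have "range (\<lambda>a. a *\<^sub>C c *\<^sub>C x) = (\<lambda>a. a *\<^sub>C x) ` range (\<lambda>a. a * c)"
    by (simp add: image_image)
  also have "range (\<lambda>a. a * c) = UNIV"
    using assms by (intro surjI[of _ "\<lambda>a. a / c"]) simp
  finally show ?thesis
    by (simp add: cline_def)
qed

lemma cline_eq_E:
  assumes "cline x = cline y" "x \<noteq> 0"
  obtains c where "c \<noteq> 0" "x = c *\<^sub>C y"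
proof -
  have "x \<in> cline y"
    using self_mem_cline[of x] assms by simp
  then show thesis
    using that assms(2) by (auto simp: cline_def)
qed

lemma cline_nrm: "x \<noteq> 0 \<Longrightarrow> cline (nrm x) = cline x"
  unfolding nrm_def by (simp add: cline_scale)

lemma cline_mdom: 
  assumes "x \<noteq> 0"
  shows "cline x \<in> mdom proj_mfd j \<longleftrightarrow> cinner j x \<noteq> 0"
proof
  assume "cline x \<in> mdom proj_mfd j"
  then obtain y where y: "cline x = cline y" "cinner j y \<noteq> 0"
    by (auto simp: proj_mfd_def)
  obtain c where "c \<noteq> 0" "x = c *\<^sub>C y"
    using cline_eq_E[OF y(1) assms] .
  then show "cinner j x \<noteq> 0"
    using y by (simp add: cinner_simps)
qed (auto simp: proj_mfd_def)

interpretation proj: qcharts proj_mfd cline cinner UNIV "- {0}"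
proof unfold_locales
  fix j x :: 'a
  show "\<exists>c\<in>- {0} \<inter> UNIV. hnorm (c *\<^sub>C x) = 1" if "x \<noteq> 0"
    using hnorm_normalize[OF that] that by (intro bexI) auto
  show "mchart proj_mfd j (cline x) = qmap (cinner j) j x" if "hnorm j = 1" "cinner j x \<in> - {0}"
    using that by (simp add: proj_mfd_def proj_chart_cline qmap_def)
  show "cline x \<in> mdom proj_mfd j \<longleftrightarrow> cinner j x \<in> - {0}" if "hnorm j = 1" "x \<noteq> 0"
    using cline_mdom[OF that(2)] by simp
qed (auto simp: cinner_simps cinner_unit cline_scale proj_mfd_def scaleR_conv_of_real intro!: continuous_intros)

lemma Re_cinner_nrm: "Re (cinner j (nrm x)) = Re (cinner j x) / hnorm x"
  by (simp add: nrm_def cinner_simps divide_inverse mult.commute del: of_real_inverse)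

lemma rinner_nrm: "x \<noteq> 0 \<Longrightarrow> rinner j (nrm x) = complex_of_real (inverse (hnorm x)) * rinner j x"
  by (simp add: rinner_def Re_cinner_nrm divide_inverse mult.commute)

lemma sphere_mdom: "x \<noteq> 0 \<Longrightarrow> hnorm j = 1 \<Longrightarrow> nrm x \<in> mdom sphere_mfd j \<longleftrightarrow> 0 < Re (cinner j x)"
  using hnorm_pos[of x] by (simp add: sphere_mfd_def hnorm_nrm Re_cinner_nrm zero_less_divide_iff)

text \<open>\<open>nrm\<close> is a continuous retraction of V - {0} onto the sphere, and a
  retraction is a quotient map onto its image.\<close>

lemma sphere_quotient:
  "mtop sphere_mfd = quotient_topology (top_of_set (- {0})) (nrm :: 'v::hermitian_lc_space \<Rightarrow> 'v)"
proof (unfold topology_eq, intro allI iffI)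
  fix U :: "'v set"
  have cont: "continuous_map (top_of_set (- {0})) (top_of_set {\<psi>. hnorm \<psi> = 1}) (nrm :: 'v \<Rightarrow> 'v)"
    unfolding continuous_map_in_subtopology
  proof
    have "continuous_on (- {0}) (nrm :: 'v \<Rightarrow> 'v)"
      unfolding nrm_def[abs_def] by (intro continuous_intros) auto
    then show "continuous_map (top_of_set (- {0})) euclidean (nrm :: 'v \<Rightarrow> 'v)"
      by simp
  qed (auto simp: hnorm_nrm)
  have sph: "nrm ` (- {0}) = {\<psi>::'v. hnorm \<psi> = 1}"
    using nrm_unit unit_nonzero by (force simp: hnorm_nrm)
  show "openin (quotient_topology (top_of_set (- {0})) nrm) U" if "openin (mtop sphere_mfd) U"
  proof -
    have U: "openin (top_of_set {\<psi>. hnorm \<psi> = 1}) U"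
      using that by (simp add: sphere_mfd_def)
    have "openin (top_of_set (- {0})) {x \<in> topspace (top_of_set (- {0})). nrm x \<in> U}"
      by (rule openin_continuous_map_preimage[OF cont U])
    then show ?thesis
      using openin_subset[OF U] sph by (simp add: openin_quotient_topology)
  qed
  assume U: "openin (quotient_topology (top_of_set (- {0})) nrm) U"
  then have sub: "U \<subseteq> {\<psi>. hnorm \<psi> = 1}"
      and "openin (top_of_set (- {0})) {x \<in> - {0}. nrm x \<in> U}"
    by (auto simp: openin_quotient_topology sph)
  from this(2) obtain T where T: "open T" "{x \<in> - {0}. nrm x \<in> U} = - {0} \<inter> T"
    by (auto simp: openin_open)
  have "y \<in> U \<longleftrightarrow> y \<in> T" if "hnorm y = 1" for y
    using eqset_imp_iff[OF T(2), of y] unit_nonzero[OF that] by (simp add: nrm_unit[OF that])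
  with sub have "U = {\<psi>. hnorm \<psi> = 1} \<inter> T"
    by blast
  with T(1) show "openin (mtop sphere_mfd) U"
    by (auto simp: sphere_mfd_def openin_open)
qed

text \<open>G is the open right half-plane instead of the positive reals because
  \<open>G_open\<close> asks for openness in the complex plane. Since \<open>rinner\<close> is real,
  membership in G still means Re <j, x> > 0, and the scalars divided out are those in both G and the
  reals.\<close>

interpretation sph: qcharts sphere_mfd nrm rinner \<real> "{c. 0 < Re c}"
proof unfold_locales
  fix j x :: 'a and c a b :: complex
  show "c \<in> \<real> \<Longrightarrow> rinner j (c *\<^sub>C x) = c * rinner j x"
    by (auto simp: rinner_def cinner_simps elim!: Reals_cases)
  show "rinner j x \<in> \<real>"
    by (simp add: rinner_def)
  show "hnorm j = 1 \<Longrightarrow> rinner j j = 1"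
    by (simp add: rinner_def cinner_unit)
  show "open {c::complex. 0 < Re c}"
    by (rule open_halfspace_Re_gt)
  show "a \<in> {c. 0 < Re c} \<Longrightarrow> inverse a \<in> {c. 0 < Re c}"
    by (simp add: zero_less_divide_iff add_pos_nonneg)
  show "a \<in> {c. 0 < Re c} \<Longrightarrow> a \<in> \<real> \<Longrightarrow> nrm (a *\<^sub>C x) = nrm x"
    by (auto simp: nrm_scale elim!: Reals_cases)
  show "mtop sphere_mfd = quotient_topology (top_of_set (- {0})) (nrm :: 'a \<Rightarrow> 'a)"
    by (rule sphere_quotient)
  show "mmodel sphere_mfd j = {v. rinner j v = 0}"
    by (simp add: sphere_mfd_def rinner_def)
  show "mdom sphere_mfd j \<subseteq> nrm ` {x. rinner j x \<in> {c. 0 < Re c}}"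
    using nrm_unit by (force simp: sphere_mfd_def rinner_def)
  show "nrm x \<in> mdom sphere_mfd j \<longleftrightarrow> rinner j x \<in> {c. 0 < Re c}" if "hnorm j = 1" "x \<noteq> 0"
    using sphere_mdom[OF that(2,1)] by (simp add: rinner_def)
  show "\<exists>c\<in>{c. 0 < Re c} \<inter> \<real>. hnorm (c *\<^sub>C x) = 1" if "x \<noteq> 0"
    using hnorm_normalize[OF that] hnorm_pos[OF that]
    by (intro bexI[of _ "complex_of_real (inverse (hnorm x))"]) (simp_all del: of_real_inverse)
  show "mchart sphere_mfd j (nrm x) = qmap (rinner j) j x" if "rinner j x \<in> {c. 0 < Re c}"
  proof -
    have "x \<noteq> 0"
      using that by (auto simp: rinner_def)
    then have "inverse (rinner j (nrm x)) *\<^sub>C nrm x = inverse (rinner j x) *\<^sub>C x"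
      by (simp add: rinner_nrm) (simp add: nrm_def)
    then show ?thesis
      by (simp add: sphere_mfd_def qmap_def scaleR_scaleC rinner_def)
  qed
qed (simp_all add: sphere_mfd_def lc_linear.add[OF lc_linear_rinner]
    lc_linear.scaleR[OF lc_linear_rinner] lc_linear.continuous[OF lc_linear_rinner])


section \<open>The Hausdorff property\<close>

lemma Hausdorff_space_euclidean_t2: "Hausdorff_space (euclidean :: 'a::t2_space topology)"
  unfolding Hausdorff_space_def disjnt_def using hausdorff by auto

lemma Hausdorff_sphere: "Hausdorff_space (mtop sphere_mfd)"
  using Hausdorff_space_subtopology[OF Hausdorff_space_euclidean_t2] by (simp add: sphere_mfd_def)

text \<open>The equality case of Cauchy-Schwarz: the component w of y orthogonal to x has norm
  0.\<close>

lemma parallel_if_Cauchy_Schwarz_eq: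
  assumes "cinner x y * cinner y x = cinner x x * cinner y y" "x \<noteq> 0"
  shows "y = (cinner x y / cinner x x) *\<^sub>C x"
proof -
  define w where "w = y - (cinner x y / cinner x x) *\<^sub>C x"
  have "cinner x x \<noteq> 0" and "cnj (cinner x x) = cinner x x" "cnj (cinner x y) = cinner y x"
    using assms(2) cinner_commute[of x x] cinner_commute[of y x] by auto
  then have "cinner w w = 0"
    using assms(1) by (simp add: w_def cinner_simps field_simps)
  then show ?thesis
    by (simp add: w_def)
qed

text \<open>A line is sent to the quadratic form z -> <z, P z> of its orthogonal projector P, a
  point in the product of copies of the complex numbers indexed by V. This map is continuous and
  injective, and the product is Hausdorff.\<close>

lemma Hausdorff_proj: "Hausdorff_space (mtop (proj_mfd :: ('v::hermitian_lc_space set, 'v, 'v) mfd))"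
proof -
  define tp where "tp \<phi> z = cinner z \<phi> * cinner \<phi> z / cinner \<phi> \<phi>" for \<phi> z :: 'v
  define g where "g p = tp (SOME \<phi>. \<phi> \<noteq> 0 \<and> cline \<phi> = p)" for p :: "'v set"
  have tp_scale: "tp (c *\<^sub>C \<phi>) = tp \<phi>" if "c \<noteq> 0" for c \<phi>
    using that by (cases "\<phi> = 0") (auto simp: tp_def fun_eq_iff cinner_simps)
  have g: "g (cline \<phi>) = tp \<phi>" if "\<phi> \<noteq> 0" for \<phi>
  proof -
    define z where "z = (SOME z. z \<noteq> 0 \<and> cline z = cline \<phi>)"
    have "z \<noteq> 0 \<and> cline z = cline \<phi>"
      unfolding z_def by (rule someI[of _ \<phi>]) (use that in simp)
    then obtain c where "c \<noteq> 0" "z = c *\<^sub>C \<phi>"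
      using cline_eq_E by blast
    then show ?thesis
      unfolding g_def z_def[symmetric] using tp_scale by simp
  qed
  have "continuous_on (- {0}) tp"
    unfolding tp_def by (intro continuous_on_coordinatewise_then_product continuous_intros) auto
  then have "continuous_on (- {0}) (\<lambda>\<phi>. g (cline \<phi>))"
    by (rule continuous_on_eq) (simp add: g)
  then have "continuous_map (mtop proj_mfd) euclidean g"
    unfolding proj.top_X by (intro continuous_map_from_quotient_UNIV) simp
  moreover have "inj_on g (points proj_mfd)"
  proof (rule inj_onI)
    fix p q
    assume "p \<in> points proj_mfd" "q \<in> points proj_mfd" and eq: "g p = g q"
    then obtain x y where xy: "x \<noteq> 0" "y \<noteq> 0" "p = cline x" "q = cline y"
      by (auto simp: proj.points_X)
    \<comment> \<open>Evaluation at the single vector x already forces equality in the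
      Cauchy-Schwarz inequality for x and y.\<close>
    then have "tp x x = tp y x"
      using eq g by metis
    then have "cinner x y * cinner y x = cinner x x * cinner y y"
      using xy by (simp add: tp_def field_simps)
    from parallel_if_Cauchy_Schwarz_eq[OF this xy(1)] show "p = q"
      using xy cline_scale[of "cinner x y / cinner x x" x] by (metis scaleC.scale_zero_left)
  qed
  ultimately show ?thesis
    by (rule Hausdorff_space_injective_preimage[rotated])
      (metis euclidean_product_topology Hausdorff_space_product_topology Hausdorff_space_euclidean_t2)
qed

lemmas smooth_manifold_proj = proj.smooth_manifold_X[OF Hausdorff_proj]
lemmas smooth_manifold_sphere = sph.smooth_manifold_X[OF Hausdorff_sphere]


section \<open>The Fubini--Study form\<close>

definition fubini_study :: "'v::hermitian_lc_space \<Rightarrow> 'v \<Rightarrow> 'v \<Rightarrow> complex" where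
  "fubini_study x v w = 2 * (cinner v w * inverse (cinner x x) -
     cinner v x * cinner x w * (inverse (cinner x x) * inverse (cinner x x)))"

lemma fubini_study_scale:
  assumes "c \<noteq> 0"
  shows "fubini_study (c *\<^sub>C x) (c *\<^sub>C v) (c *\<^sub>C w) = fubini_study x v w"
proof (cases "x = 0")
  case False
  then show ?thesis
    using assms by (simp add: fubini_study_def cinner_simps field_simps)
qed (simp add: fubini_study_def)

lemma fubini_study_horizontal:
  "hnorm x = 1 \<Longrightarrow> cinner x v = 0 \<or> cinner x w = 0 \<Longrightarrow> fubini_study x v w = 2 * cinner v w"
  using cinner_commute[of v x] by (auto simp: fubini_study_def cinner_unit)

text \<open>The form is 2 <v', w'> / <x, x> for the components v', w' of v, w orthogonal to x, so
  multiples of x in either argument drop out.\<close>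

lemma fubini_study_shift:
  assumes "x \<noteq> 0"
  shows "fubini_study x (v - a *\<^sub>C x) (w - b *\<^sub>C x) = fubini_study x v w"
  using assms by (simp add: fubini_study_def cinner_simps field_simps)

text \<open>Both effects of \<open>dq\<close>, the factor \<open>inverse (L x)\<close> and the
  subtracted multiple of x, are invisible to the form; hence it has the same expression in every
  chart.\<close>

lemma fubini_study_dq:
  assumes "L x \<noteq> 0"
  shows "fubini_study (inverse (L x) *\<^sub>C x) (dq L x v) (dq L x w) = fubini_study x v w"
proof (cases "x = 0")
  case False
  have "dq L x u = inverse (L x) *\<^sub>C (u - (L u * inverse (L x)) *\<^sub>C x)" for u
    by (simp add: dq_def algebra_simps)
  then show ?thesis
    using assms False by (simp add: fubini_study_scale fubini_study_shift)
qed (simp add: fubini_study_def dq_def)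

text \<open>\<open>proj_H\<close> picks an unspecified unit vector y on the line. The representative
  x is rescaled to \<open>inverse (cinner y x) *\<^sub>C x\<close>, which is y itself, and there the
  components are orthogonal to y. The invariance of the form returns to x.\<close>

lemma proj_H_tangent:
  assumes "x \<noteq> 0"
  shows "proj_H (cline x) (proj.tangent x v) (proj.tangent x w) = fubini_study x v w"
proof -
  define y where "y = (SOME y. hnorm y = 1 \<and> cline y = cline x)"
  have y: "hnorm y = 1 \<and> cline y = cline x"
    unfolding y_def by (rule someI[of _ "nrm x"]) (simp add: hnorm_nrm cline_nrm assms)
  then obtain c where c: "c \<noteq> 0" "y = c *\<^sub>C x"
    using cline_eq_E[of y x] unit_nonzero by blast
  have yx: "cinner y x \<noteq> 0"
    using c assms by (simp add: cinner_simps)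
  have "cinner y (c *\<^sub>C x) = 1"
    using y c(2) cinner_unit by metis
  then have "cinner y x * c = 1"
    by (simp only: cinner_scaleC_right mult.commute)
  then have "inverse (cinner y x) *\<^sub>C x = y"
    using c(2) by (metis inverse_unique)
  then have "fubini_study y (dq (cinner y) x v) (dq (cinner y) x w) = fubini_study x v w"
    using fubini_study_dq[where L = "cinner y" and x = x] yx by simp
  moreover have "cinner y (dq (cinner y) x v) = 0"
    using proj.L_dq[of y x v] yx by simp
  moreover have "proj.tangent x u y = dq (cinner y) x u" for u
    using y yx by (simp add: proj.tangent_def)
  ultimately show ?thesis
    using y fubini_study_horizontal[of y "dq (cinner y) x v" "dq (cinner y) x w"]
    unfolding proj_H_def Let_def y_def[symmetric] by simp
qed

lemma proj_H_unit:
  assumes "hnorm \<psi> = 1" "\<xi> \<in> tangent_space proj_mfd (cline \<psi>)" "\<eta> \<in> tangent_space proj_mfd (cline \<psi>)"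
  shows "proj_H (cline \<psi>) \<xi> \<eta> = 2 * cinner (\<xi> \<psi>) (\<eta> \<psi>)"
  using proj_H_tangent[OF unit_nonzero[OF assms(1)], of "\<xi> \<psi>" "\<eta> \<psi>"]
    proj.tangent_space_E[OF assms(2,1)] proj.tangent_space_E[OF assms(3,1)]
    fubini_study_horizontal[OF assms(1), of "\<xi> \<psi>" "\<eta> \<psi>"]
  by simp

lemma points_proj_E:
  assumes "p \<in> points proj_mfd"
  obtains \<psi> where "hnorm \<psi> = 1" "p = cline \<psi>"
  using assms that hnorm_nrm cline_nrm by (fastforce simp: proj.points_X)

lemma proj_tangent_add:
  assumes "p \<in> points proj_mfd" "\<xi> \<in> tangent_space proj_mfd p" "\<eta> \<in> tangent_space proj_mfd p"
  shows "(\<lambda>j. \<xi> j + \<eta> j) \<in> tangent_space proj_mfd p"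
proof -
  obtain x where x: "x \<noteq> 0" "p = cline x"
    using assms(1) by (auto simp: proj.points_X)
  show ?thesis
    using assms(2,3) unfolding x(2) proj.tangent_space_eq[OF x(1)]
    by (auto simp: proj.tangent_add[symmetric])
qed

lemma proj_tangent_scaleC:
  assumes "p \<in> points proj_mfd" "\<xi> \<in> tangent_space proj_mfd p"
  shows "(\<lambda>j. c *\<^sub>C \<xi> j) \<in> tangent_space proj_mfd p"
proof -
  obtain x where x: "x \<noteq> 0" "p = cline x"
    using assms(1) by (auto simp: proj.points_X)
  show ?thesis
    using assms(2) unfolding x(2) proj.tangent_space_eq[OF x(1)]
    by (auto simp: proj.tangent_scaleC[symmetric])
qed

lemma local_form2_proj_H:
  assumes "hnorm i = 1" "cinner i x = 0" "cinner i v = 0" "cinner i w = 0"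
  shows "local_form2 proj_mfd proj_H i x v w = fubini_study (i + x) v w"
  using assms unfolding local_form2_def
  by (simp add: proj.param_translate proj.tangent_vector_eq proj_H_tangent proj.translate_nonzero)

lemma local_form2_Im: "local_form2 M (\<lambda>p \<xi> \<eta>. Im (H p \<xi> \<eta>)) i x v w = Im (local_form2 M H i x v w)"
  by (simp add: local_form2_def)

lemma Cn_on_fubini_study:
  assumes "Cn_on n E U F" "Cn_on n E U V" "Cn_on n E U W"
    and "\<And>x h. x \<in> U \<Longrightarrow> h \<in> UNIV \<rightarrow> E \<Longrightarrow> F x h \<noteq> 0"
  shows "Cn_on n E U (\<lambda>x h. fubini_study (F x h) (V x h) (W x h))"
  unfolding fubini_study_def using assms by (intro Cn_on_intros) auto

text \<open>One proof for H and for its imaginary part: L is the identity or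
  \<open>Im\<close>.\<close>

lemma smooth_tensor2_proj:
  fixes L :: "complex \<Rightarrow> 'b::{lc_space,t2_space}"
  assumes "lc_linear L"
    and "\<And>i x v w. local_form2 proj_mfd \<omega> i x v w = L (local_form2 proj_mfd proj_H i x v w)"
  shows "smooth_tensor2 (proj_mfd :: ('v::hermitian_lc_space set, 'v, 'v) mfd) \<omega>"
  unfolding smooth_tensor2_def
proof
  fix i :: 'v
  assume "i \<in> mix proj_mfd"
  then have i: "hnorm i = 1"
    by simp
  define T where "T = mmodel proj_mfd i"
  have im: "mchart proj_mfd i ` mdom proj_mfd i = T"
    by (simp add: proj.mchart_image[OF i] T_def)
  have T: "cinner i v = 0" if "v \<in> T" for v
    using that by (simp add: T_def proj.mmodel_X)
  have "smooth_on (T \<times> T \<times> T) (T \<times> T \<times> T) (\<lambda>(x, v, w). local_form2 proj_mfd \<omega> i x v w)"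
  proof (rule smooth_on_if_Cn_on)
    show "openin (top_of_set (T \<times> T \<times> T)) (T \<times> T \<times> T)" "subspace (T \<times> T \<times> T)"
      using proj.subspace_mmodel by (auto simp: T_def intro!: subspace_Times)
    show "Cn_on n (T \<times> T \<times> T) (T \<times> T \<times> T)
        (\<lambda>z h. L (fubini_study (i + fst z) (fst (snd z)) (snd (snd z))))" for n
      using proj.translate_nonzero[OF i] T
      by (intro lc_linear.Cn_on[OF assms(1)] Cn_on_fubini_study Cn_on_intros) auto
  qed (auto simp: assms(2) local_form2_proj_H i T)
  then show "smooth_on (mmodel proj_mfd i \<times> mmodel proj_mfd i \<times> mmodel proj_mfd i)
      (mchart proj_mfd i ` mdom proj_mfd i \<times> mmodel proj_mfd i \<times> mmodel proj_mfd i)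
      (\<lambda>(x, v, w). local_form2 proj_mfd \<omega> i x v w)"
    unfolding im T_def .
qed

lemma hermitean_form_proj: "hermitean_form proj_mfd proj_H"
  unfolding hermitean_form_def
proof (intro conjI ballI allI)
  fix p :: "'a set" and \<xi> \<eta> \<zeta> and c
  assume p: "p \<in> points proj_mfd" and \<xi>: "\<xi> \<in> tangent_space proj_mfd p"
    and \<eta>: "\<eta> \<in> tangent_space proj_mfd p" and \<zeta>: "\<zeta> \<in> tangent_space proj_mfd p"
  obtain \<psi> where \<psi>: "hnorm \<psi> = 1" "p = cline \<psi>"
    using points_proj_E[OF p] .
  note H = proj_H_unit[OF \<psi>(1), folded \<psi>(2)]
  show "proj_H p \<xi> (\<lambda>j. \<eta> j + \<zeta> j) = proj_H p \<xi> \<eta> + proj_H p \<xi> \<zeta>"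
    by (simp add: H \<xi> \<eta> \<zeta> proj_tangent_add[OF p] cinner_simps distrib_left)
  show "proj_H p \<xi> (\<lambda>j. c *\<^sub>C \<eta> j) = c * proj_H p \<xi> \<eta>"
    by (simp add: H \<xi> \<eta> proj_tangent_scaleC[OF p] cinner_simps)
  show "proj_H p \<eta> \<xi> = cnj (proj_H p \<xi> \<eta>)"
    using cinner_commute[of "\<eta> \<psi>" "\<xi> \<psi>"] by (simp add: H \<xi> \<eta>)
  show "\<xi> \<noteq> (\<lambda>_. 0) \<longrightarrow> 0 < Re (proj_H p \<xi> \<xi>)"
  proof
    assume "\<xi> \<noteq> (\<lambda>_. 0)"
    moreover have "\<xi> = proj.tangent \<psi> (\<xi> \<psi>)"
      using proj.tangent_space_E(1) \<xi> \<psi> by blast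
    moreover have "proj.tangent \<psi> 0 = (\<lambda>_. 0)"
      by (simp add: proj.tangent_def dq_def fun_eq_iff)
    ultimately have "\<xi> \<psi> \<noteq> 0"
      by metis
    then show "0 < Re (proj_H p \<xi> \<xi>)"
      using cinner_pos[of "\<xi> \<psi>"] by (simp add: H \<xi>)
  qed
qed (rule smooth_tensor2_proj[where L = "\<lambda>z. z"], unfold_locales, auto)

lemma complex_manifold_proj: "complex_manifold proj_mfd"
  unfolding complex_manifold_def
proof (intro conjI ballI allI smooth_manifold_proj)
  fix i j v :: 'a and p c
  assume i: "i \<in> mix proj_mfd"
  show "v \<in> mmodel proj_mfd i \<Longrightarrow> c *\<^sub>C v \<in> mmodel proj_mfd i"
    by (simp add: proj.mmodel_X cinner_simps)
  assume j: "j \<in> mix proj_mfd" and p: "p \<in> mdom proj_mfd i \<inter> mdom proj_mfd j"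
    and v: "v \<in> mmodel proj_mfd i"
  from p i obtain x where x: "cinner i x = 0" "p = cline (i + x)"
    by (auto elim: proj.mdom_E)
  have "cinner j (i + x) \<in> - {0}"
    using p i j x proj.cl_mdom[of j "i + x"] proj.translate_nonzero[of i x] by simp
  then have d: "dirderiv (mchart proj_mfd j \<circ> param proj_mfd i) x u = dq (cinner j) (i + x) u"
    if "cinner i u = 0" for u
    using has_dirderiv_imp[OF proj.has_dirderiv_transition[of i j x u]] that i j x by simp
  show "dirderiv (mchart proj_mfd j \<circ> param proj_mfd i) (mchart proj_mfd i p) (c *\<^sub>C v) =
      c *\<^sub>C dirderiv (mchart proj_mfd j \<circ> param proj_mfd i) (mchart proj_mfd i p) v"
    using v i x by (simp add: proj.mchart_translate proj.mmodel_X d cinner_simps dq_scaleC)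
qed

section \<open>Closedness and nondegeneracy of the imaginary part\<close>

definition dfubini_study :: "'v::hermitian_lc_space \<Rightarrow> 'v \<Rightarrow> 'v \<Rightarrow> 'v \<Rightarrow> complex" where
  "dfubini_study x u v w = (let n = inverse (cinner x x); dN = cinner u x + cinner x u in
     2 * (cinner v w * (dN * - (n * n)) -
       ((cinner v u * cinner x w + cinner v x * cinner u w) * (n * n) -
        cinner v x * cinner x w * (2 * dN * (n * n * n)))))"

text \<open>\<open>has_dirderiv_eq\<close> leaves the derivative open, the differentiation rules
  construct it, and simplification matches it with \<open>dfubini_study\<close>, in which
  \<open>dN\<close> is the derivative of <x, x>.\<close>

lemma has_dirderiv_fubini_study:
  assumes "i + x \<noteq> 0"
  shows "has_dirderiv (\<lambda>y. fubini_study (i + y) v w) x u (dfubini_study (i + x) u v w)"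
proof -
  have nz: "cinner (i + x) (i + x) \<noteq> 0"
    using assms by simp
  show ?thesis
    unfolding fubini_study_def
    by (rule has_dirderiv_eq, (rule dirderiv_intros nz)+)
       (simp add: dfubini_study_def Let_def algebra_simps)
qed

text \<open>The three inner products of \<open>x\<close> with \<open>u\<close>, \<open>v\<close>, \<open>w\<close>, those of \<open>u\<close>, \<open>v\<close>, \<open>w\<close> with each other,
  and \<open>\<langle>x, x\<rangle>\<close>, which is real, are the variables of a polynomial identity.\<close>

lemma Im_dfubini_study_cyclic:
  "Im (dfubini_study x u v w) - Im (dfubini_study x v u w) + Im (dfubini_study x w u v) = 0"
proof -
  define n where "n = inverse ((hnorm x)\<^sup>2)"
  have n: "inverse (cinner x x) = complex_of_real n"
    by (simp add: n_def cinner_self)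
  have "cinner u x = cnj (cinner x u)" "cinner v x = cnj (cinner x v)" "cinner w x = cnj (cinner x w)"
      "cinner v u = cnj (cinner u v)" "cinner w u = cnj (cinner u w)" "cinner w v = cnj (cinner v w)"
    by (rule cinner_commute)+
  then show ?thesis
    by (simp add: dfubini_study_def Let_def n) (simp add: algebra_simps)
qed

lemma symplectic_form_proj: "symplectic_form proj_mfd (\<lambda>p \<xi> \<eta>. Im (proj_H p \<xi> \<eta>))"
  unfolding symplectic_form_def
proof (intro conjI ballI impI)
  note herm = hermitean_form_proj[unfolded hermitean_form_def, THEN conjunct1, rule_format]
  \<comment> \<open>\<open>hermitean_form\<close> records linearity in the second argument;
    additivity and real homogeneity in the first are read off from the formula at a unit
    representative.\<close>
  have *: "proj_H p (\<lambda>j. \<xi> j + \<eta> j) \<zeta> = proj_H p \<xi> \<zeta> + proj_H p \<eta> \<zeta>"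
      "proj_H p (\<lambda>j. r *\<^sub>R \<xi> j) \<zeta> = r *\<^sub>R proj_H p \<xi> \<zeta>"
      "Im (proj_H p \<xi> \<eta>) = - Im (proj_H p \<eta> \<xi>)"
    if p: "p \<in> points proj_mfd" and tan: "\<xi> \<in> tangent_space proj_mfd p" "\<eta> \<in> tangent_space proj_mfd p"
      "\<zeta> \<in> tangent_space proj_mfd p" for p :: "'a set" and \<xi> \<eta> \<zeta> and r :: real
  proof -
    obtain \<psi> where \<psi>: "hnorm \<psi> = 1" "p = cline \<psi>"
      using points_proj_E[OF p] .
    note H = proj_H_unit[OF \<psi>(1), folded \<psi>(2)]
    show "proj_H p (\<lambda>j. \<xi> j + \<eta> j) \<zeta> = proj_H p \<xi> \<zeta> + proj_H p \<eta> \<zeta>"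
      using tan by (simp add: H proj_tangent_add[OF p] cinner_simps distrib_left)
    show "proj_H p (\<lambda>j. r *\<^sub>R \<xi> j) \<zeta> = r *\<^sub>R proj_H p \<xi> \<zeta>"
      using tan by (simp add: H proj_tangent_scaleC[OF p] cinner_simps scaleR_scaleC
          scaleC_complex_def)
    show "Im (proj_H p \<xi> \<eta>) = - Im (proj_H p \<eta> \<xi>)"
      using tan cinner_commute[of "\<xi> \<psi>" "\<eta> \<psi>"] by (simp add: H)
  qed
  show "two_form proj_mfd (\<lambda>p (\<xi>::'a \<Rightarrow> 'a) \<eta>. Im (proj_H p \<xi> \<eta>))"
    unfolding two_form_def
    by (intro conjI ballI allI smooth_tensor2_proj[OF Im.lc_linear_axioms local_form2_Im] *(3))
       (simp_all add: *(1,2))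
  show "closed_form2 proj_mfd (\<lambda>p (\<xi>::'a \<Rightarrow> 'a) \<eta>. Im (proj_H p \<xi> \<eta>))"
    unfolding closed_form2_def
  proof (intro ballI)
    fix i x u v w :: 'a
    assume "i \<in> mix proj_mfd" and x: "x \<in> mchart proj_mfd i ` mdom proj_mfd i"
      and uvw: "u \<in> mmodel proj_mfd i" "v \<in> mmodel proj_mfd i" "w \<in> mmodel proj_mfd i"
    then have i: "hnorm i = 1" and x: "x \<in> mmodel proj_mfd i"
      by (simp_all add: proj.mchart_image)
    have D: "dirderiv (\<lambda>y. local_form2 proj_mfd (\<lambda>p \<xi> \<eta>. Im (proj_H p \<xi> \<eta>)) i y v w) x u =
        Im (dfubini_study (i + x) u v w)"
      if "u \<in> mmodel proj_mfd i" "v \<in> mmodel proj_mfd i" "w \<in> mmodel proj_mfd i" for u v w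
    proof (rule has_dirderiv_imp, rule iffD2[OF has_dirderiv_openin_cong])
      show "has_dirderiv (\<lambda>y. Im (fubini_study (i + y) v w)) x u (Im (dfubini_study (i + x) u v w))"
        using x i by (intro Im.has_dirderiv has_dirderiv_fubini_study)
          (simp add: proj.mmodel_X proj.translate_nonzero)
      show "openin (top_of_set (mmodel proj_mfd i)) (mmodel proj_mfd i)"
        by simp
    qed (use x that i proj.subspace_mmodel in
        \<open>auto simp: local_form2_Im local_form2_proj_H proj.mmodel_X\<close>)
    show "ext_deriv2 proj_mfd (\<lambda>p \<xi> \<eta>. Im (proj_H p \<xi> \<eta>)) i x u v w = 0"
      using uvw Im_dfubini_study_cyclic by (simp add: ext_deriv2_def D)
  qed
  fix p :: "'a set" and \<xi> :: "'a \<Rightarrow> 'a"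
  assume p: "p \<in> points proj_mfd" and \<xi>: "\<xi> \<in> tangent_space proj_mfd p"
    and 0: "\<forall>\<eta>\<in>tangent_space proj_mfd p. Im (proj_H p \<xi> \<eta>) = 0"
  \<comment> \<open>The complex structure supplies the test vector: Im H(\<xi>, i \<xi>) = Re
    H(\<xi>, \<xi>), which is positive unless \<xi> is 0.\<close>
  have "Im (proj_H p \<xi> (\<lambda>j. \<i> *\<^sub>C \<xi> j)) = 0"
    using 0 proj_tangent_scaleC[OF p \<xi>] by blast
  then have "Re (proj_H p \<xi> \<xi>) = 0"
    using herm[OF p \<xi> \<xi> \<xi>, of \<i>] by simp
  then show "\<xi> = (\<lambda>_. 0)"
    using herm[OF p \<xi> \<xi> \<xi>, of 0] by fastforce
qed

lemma kaehler_manifold_proj: "kaehler_manifold proj_mfd proj_H"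
  unfolding kaehler_manifold_def
  using complex_manifold_proj hermitean_form_proj symplectic_form_proj by blast


section \<open>Smooth maps in charts\<close>

text \<open>The properties of the charts that make the chart domains in the definition of a smooth map
  open; they pass to products and open submanifolds.\<close>

definition open_charts :: "('m, 'v::lc_space, 'i) mfd \<Rightarrow> bool" where
  "open_charts M \<longleftrightarrow> (\<forall>i\<in>mix M. openin (mtop M) (mdom M i) \<and> subspace (mmodel M i) \<and>
     inj_on (mchart M i) (mdom M i) \<and>
     (\<forall>S. openin (mtop M) S \<longrightarrow> S \<subseteq> mdom M i \<longrightarrow>
        openin (top_of_set (mmodel M i)) (mchart M i ` S)))"

lemma open_charts_smooth_manifold:
  assumes "smooth_manifold M"
  shows "open_charts M"
  unfolding open_charts_def
proof (intro ballI conjI allI impI)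
  fix i
  assume i: "i \<in> mix M"
  show o: "openin (mtop M) (mdom M i)" and "subspace (mmodel M i)"
    using assms i by (auto simp: smooth_manifold_def)
  have hom: "homeomorphic_map (subtopology (mtop M) (mdom M i)) (top_of_set (mchart M i ` mdom M i)) (mchart M i)"
    and im: "openin (top_of_set (mmodel M i)) (mchart M i ` mdom M i)"
    using assms i by (auto simp: smooth_manifold_def)
  have "topspace (subtopology (mtop M) (mdom M i)) = mdom M i"
    using openin_subset[OF o] by auto
  then show "inj_on (mchart M i) (mdom M i)"
    using homeomorphic_imp_injective_map[OF hom] by simp
  fix S
  assume "openin (mtop M) S" "S \<subseteq> mdom M i"
  then have "openin (subtopology (mtop M) (mdom M i)) S"
    by (simp add: openin_open_subtopology[OF o])
  then have "openin (top_of_set (mchart M i ` mdom M i)) (mchart M i ` S)"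
    using homeomorphic_imp_open_map[OF hom] by (simp add: open_map_def)
  then show "openin (top_of_set (mmodel M i)) (mchart M i ` S)"
    by (rule openin_trans[OF _ im])
qed

lemma mtop_open_submfd [simp]: "mtop (open_submfd M W) = subtopology (mtop M) W"
  and mix_open_submfd [simp]: "mix (open_submfd M W) = mix M"
  and mdom_open_submfd [simp]: "mdom (open_submfd M W) i = mdom M i \<inter> W"
  and mchart_open_submfd [simp]: "mchart (open_submfd M W) = mchart M"
  and mmodel_open_submfd [simp]: "mmodel (open_submfd M W) = mmodel M"
  by (simp_all add: open_submfd_def)

lemma mtop_prod_mfd [simp]: "mtop (prod_mfd M N) = prod_topology (mtop M) (mtop N)"
  and mix_prod_mfd [simp]: "mix (prod_mfd M N) = mix M \<times> mix N"
  and mdom_prod_mfd [simp]: "mdom (prod_mfd M N) (i, j) = mdom M i \<times> mdom N j"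
  and mchart_prod_mfd [simp]: "mchart (prod_mfd M N) (i, j) (p, q) = (mchart M i p, mchart N j q)"
  and mmodel_prod_mfd [simp]: "mmodel (prod_mfd M N) (i, j) = mmodel M i \<times> mmodel N j"
  by (simp_all add: prod_mfd_def)

lemma complex_plane_simps [simp]:
  "mtop complex_plane = euclidean" "mix complex_plane = UNIV" "mdom complex_plane i = UNIV"
  "mchart complex_plane i = id" "mmodel complex_plane i = UNIV"
  by (simp_all add: complex_plane_def)

lemma open_charts_open_submfd:
  assumes "open_charts M" "openin (mtop M) W"
  shows "open_charts (open_submfd M W)"
  using assms unfolding open_charts_def
  by (auto simp: openin_open_subtopology intro: inj_on_subset)

text \<open>An open set of the product is only a union of boxes, so openness of its image is checked
  near each point, where a box is mapped to a box.\<close>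

lemma open_charts_prod_mfd:
  assumes M: "open_charts M" and N: "open_charts N"
  shows "open_charts (prod_mfd M N)"
  unfolding open_charts_def
proof (intro ballI conjI allI impI)
  fix k
  assume k: "k \<in> mix (prod_mfd M N)"
  obtain i j where ij: "k = (i, j)" "i \<in> mix M" "j \<in> mix N"
    using k by auto
  note Mi = M[unfolded open_charts_def, rule_format, OF ij(2)]
  note Nj = N[unfolded open_charts_def, rule_format, OF ij(3)]
  show "openin (mtop (prod_mfd M N)) (mdom (prod_mfd M N) k)"
    "subspace (mmodel (prod_mfd M N) k)"
    using Mi Nj by (auto simp: ij(1) openin_prod_Times_iff intro: subspace_Times)
  show "inj_on (mchart (prod_mfd M N) k) (mdom (prod_mfd M N) k)"
    using Mi Nj by (auto simp: ij(1) inj_on_def)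
  fix S
  assume S: "openin (mtop (prod_mfd M N)) S" "S \<subseteq> mdom (prod_mfd M N) k"
  show "openin (top_of_set (mmodel (prod_mfd M N) k)) (mchart (prod_mfd M N) k ` S)"
  proof (subst openin_subopen, intro ballI)
    fix y
    assume "y \<in> mchart (prod_mfd M N) k ` S"
    then obtain p q where pq: "(p, q) \<in> S" "y = (mchart M i p, mchart N j q)"
      by (force simp: ij(1))
    have "\<forall>x y. (x, y) \<in> S \<longrightarrow> (\<exists>U V. openin (mtop M) U \<and> openin (mtop N) V \<and>
        x \<in> U \<and> y \<in> V \<and> U \<times> V \<subseteq> S)"
      using S(1) unfolding mtop_prod_mfd openin_prod_topology_alt .
    from this[rule_format, OF pq(1)] obtain A B where
      AB: "openin (mtop M) A" "openin (mtop N) B" "p \<in> A" "q \<in> B" "A \<times> B \<subseteq> S"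
      by (elim exE conjE)
    then have "A \<subseteq> mdom M i" "B \<subseteq> mdom N j"
      using S(2) by (auto simp: ij(1))
    then have "openin (top_of_set (mmodel M i \<times> mmodel N j)) (mchart M i ` A \<times> mchart N j ` B)"
      using AB Mi Nj by (intro openin_Times) auto
    moreover have "mchart M i ` A \<times> mchart N j ` B \<subseteq> mchart (prod_mfd M N) k ` S"
    proof
      fix z
      assume "z \<in> mchart M i ` A \<times> mchart N j ` B"
      then obtain a b where "a \<in> A" "b \<in> B" "z = mchart (prod_mfd M N) k (a, b)"
        by (auto simp: ij(1))
      then show "z \<in> mchart (prod_mfd M N) k ` S"
        using AB(5) by auto
    qed
    ultimately show "\<exists>T. openin (top_of_set (mmodel (prod_mfd M N) k)) T \<and> y \<in> T \<and>
        T \<subseteq> mchart (prod_mfd M N) k ` S"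
      using AB(3,4) pq(2) ij(1) by (intro exI[of _ "mchart M i ` A \<times> mchart N j ` B"]) auto
  qed
qed

lemma open_charts_complex_plane: "open_charts complex_plane"
  by (simp add: open_charts_def)

text \<open>The formulas \<open>f\<close> are required to be C^n on a set \<open>V i j\<close> that
  merely contains the coordinate domain, so V can be given by simple nonvanishing or positivity
  conditions. Openness of the actual domain comes from the continuity of F.\<close>

lemma smooth_mapI:
  assumes M: "open_charts M" and N: "open_charts N"
    and F: "continuous_map (mtop M) (mtop N) F"
    and Cn: "\<And>i j n. i \<in> mix M \<Longrightarrow> j \<in> mix N \<Longrightarrow> Cn_on n (mmodel M i) (V i j) (\<lambda>x h. f i j x)"
    and rep: "\<And>i j p. i \<in> mix M \<Longrightarrow> j \<in> mix N \<Longrightarrow> p \<in> mdom M i \<Longrightarrow> F p \<in> mdom N j \<Longrightarrow>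
      mchart M i p \<in> V i j \<and> mchart N j (F p) = f i j (mchart M i p)"
  shows "smooth_map M N F"
  unfolding smooth_map_def
proof (intro conjI F ballI)
  fix i j
  assume ij: "i \<in> mix M" "j \<in> mix N"
  note Mi = M[unfolded open_charts_def, rule_format, OF ij(1)]
  note Nj = N[unfolded open_charts_def, rule_format, OF ij(2)]
  let ?U = "mchart M i ` (mdom M i \<inter> F -` mdom N j)"
  have "openin (mtop M) (mdom M i \<inter> {p \<in> topspace (mtop M). F p \<in> mdom N j})"
    using Mi Nj openin_continuous_map_preimage[OF F] by blast
  moreover have "mdom M i \<inter> {p \<in> topspace (mtop M). F p \<in> mdom N j} = mdom M i \<inter> F -` mdom N j"
    using Mi openin_subset by fastforce
  ultimately have U: "openin (top_of_set (mmodel M i)) ?U"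
    using Mi by auto
  have "?U \<subseteq> V i j"
    using rep[OF ij] by auto
  note Cn' = Cn_on_subset[OF Cn[OF ij] this]
  show "smooth_on (mmodel M i) ?U (mchart N j \<circ> F \<circ> param M i)"
  proof (rule smooth_on_if_Cn_on[OF U _ Cn'])
    fix x
    assume "x \<in> ?U"
    then obtain p where p: "p \<in> mdom M i" "F p \<in> mdom N j" "x = mchart M i p"
      by auto
    then have "param M i x = p"
      using Mi by (simp add: param_def)
    then show "(mchart N j \<circ> F \<circ> param M i) x = f i j x"
      using rep[OF ij p(1,2)] p(3) by simp
  qed (use Mi in blast)
qed

lemma prod_topology_euclidean:
  "prod_topology (euclidean :: 'a::topological_space topology) (euclidean :: 'b::topological_space topology)
    = euclidean"
  unfolding topology_eq openin_prod_topology_alt open_openin[symmetric]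
proof (intro allI iffI impI)
  fix S :: "('a \<times> 'b) set" and x y
  assume "open S" "(x, y) \<in> S"
  then obtain A B where "open A" "open B" "(x, y) \<in> A \<times> B" "A \<times> B \<subseteq> S"
    by (rule open_prod_elim)
  then show "\<exists>U V. open U \<and> open V \<and> x \<in> U \<and> y \<in> V \<and> U \<times> V \<subseteq> S"
    by (intro exI[of _ A] exI[of _ B]) simp
next
  fix S :: "('a \<times> 'b) set"
  assume *: "\<forall>x y. (x, y) \<in> S \<longrightarrow> (\<exists>U V. open U \<and> open V \<and> x \<in> U \<and> y \<in> V \<and> U \<times> V \<subseteq> S)"
  show "open S"
  proof (rule open_prod_intro)
    fix z
    assume "z \<in> S"
    with *[rule_format, of "fst z" "snd z"] obtain U V
      where "open U" "open V" "fst z \<in> U" "snd z \<in> V" "U \<times> V \<subseteq> S"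
      by auto
    then show "\<exists>A B. open A \<and> open B \<and> z \<in> A \<times> B \<and> A \<times> B \<subseteq> S"
      by (intro exI[of _ U] exI[of _ V]) (simp add: mem_Times_iff)
  qed
qed

lemma prod_topology_top_of_set:
  "prod_topology (top_of_set A) (top_of_set B) = top_of_set (A \<times> B)"
  by (metis subtopology_Times prod_topology_euclidean)

lemma continuous_map_top_of_set:
  "continuous_map (top_of_set A) (top_of_set B) f \<longleftrightarrow> continuous_on A f \<and> f ` A \<subseteq> B"
  by (auto simp: continuous_map_in_subtopology)

lemma (in qcharts) continuous_map_mchart:
  "hnorm i = 1 \<Longrightarrow> continuous_map (subtopology (mtop X) (mdom X i)) (top_of_set (mmodel X i)) (mchart X i)"
  using homeomorphic_imp_continuous_map[OF homeomorphic_map_mchart] by (simp add: mchart_image)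

lemma continuous_on_nrm [continuous_intros]:
  "continuous_on S f \<Longrightarrow> (\<And>x. x \<in> S \<Longrightarrow> f x \<noteq> 0) \<Longrightarrow> continuous_on S (\<lambda>x. nrm (f x))"
  unfolding nrm_def by (intro continuous_intros) auto

lemmas open_charts_proj = open_charts_smooth_manifold[OF smooth_manifold_proj]
lemmas open_charts_sphere = open_charts_smooth_manifold[OF smooth_manifold_sphere]


section \<open>The principal bundle\<close>

lemma points_sphere: "points sphere_mfd = {\<psi>. hnorm \<psi> = 1}"
  by (simp add: sphere_mfd_def)

lemma mtop_sphere: "mtop sphere_mfd = top_of_set {\<psi>. hnorm \<psi> = 1}"
  by (simp add: sphere_mfd_def)

lemma mdom_sphere: "mdom sphere_mfd j = {x. hnorm x = 1 \<and> 0 < Re (cinner j x)}"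
  by (simp add: sphere_mfd_def)

lemma nrm_complex: "nrm (z::complex) = sgn z"
  by (simp add: nrm_def hnorm_complex scaleC_complex_def sgn_eq divide_inverse mult.commute)

lemma nrm_scaleC: "nrm (c *\<^sub>C x) = sgn c *\<^sub>C nrm x"
  by (simp add: nrm_def hnorm_scaleC sgn_eq divide_inverse mult.commute mult.left_commute)

lemma sgn_unit: "cmod z = 1 \<Longrightarrow> sgn z = z"
  by (simp add: sgn_eq)

lemma sgn_cinner_nrm: "x \<noteq> 0 \<Longrightarrow> sgn (cinner j (nrm x)) = sgn (cinner j x)"
  using hnorm_pos[of x] by (simp add: nrm_def cinner_simps sgn_mult sgn_of_real del: of_real_inverse)

lemma mchart_sphere_unit:
  "hnorm j = 1 \<Longrightarrow> hnorm q = 1 \<Longrightarrow> 0 < Re (cinner j q) \<Longrightarrow> mchart sphere_mfd j q = qmap (rinner j) j q"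
  using sph.mchart_X[of j q] by (simp add: nrm_unit rinner_def)

lemma continuous_map_cline:
  "continuous_map (mtop sphere_mfd) (mtop proj_mfd) (cline :: 'v::hermitian_lc_space \<Rightarrow> 'v set)"
proof -
  have "- {0} \<inter> {\<psi>::'v. hnorm \<psi> = 1} = {\<psi>. hnorm \<psi> = 1}"
    using unit_nonzero by auto
  then show ?thesis
    using continuous_map_from_subtopology[OF proj.continuous_map_cl, of "{\<psi>::'v. hnorm \<psi> = 1}"]
    by (simp add: mtop_sphere subtopology_subtopology)
qed

lemma smooth_map_cline: "smooth_map sphere_mfd proj_mfd (cline :: 'v::hermitian_lc_space \<Rightarrow> 'v set)"
proof (rule smooth_mapI[OF open_charts_sphere open_charts_proj continuous_map_cline,
      where V = "\<lambda>i j. {x. cinner j (i + x) \<noteq> 0}" and f = "\<lambda>i j x. qmap (cinner j) j (i + x)"],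
    goal_cases)
  case (1 i j n)
  show ?case
    by (intro Cn_on_qmap lc_linear_cinner Cn_on_intros) simp
next
  case (2 i j q)
  then have ij: "hnorm i = 1" "hnorm j = 1"
    by auto
  obtain x where x: "rinner i x = 0" "q = nrm (i + x)"
    using sph.mdom_E[OF 2(3) ij(1)] .
  have nz: "i + x \<noteq> 0"
    by (rule sph.translate_nonzero[OF ij(1) x(1)])
  then show ?case
    using x ij 2(4) proj.cl_mdom[of j "i + x"] proj.mchart_X[of j "i + x"]
    by (simp add: sph.mchart_translate cline_nrm)
qed

lemma smooth_map_scaleC:
  "smooth_map (prod_mfd circle sphere_mfd) sphere_mfd (\<lambda>(z, q::'v::hermitian_lc_space). z *\<^sub>C q)"
proof (rule smooth_mapI[OF open_charts_prod_mfd[OF open_charts_sphere open_charts_sphere] open_charts_sphere,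
      where V = "\<lambda>i j. {x. 0 < Re (rinner j ((fst i + fst x) *\<^sub>C (snd i + snd x)))}"
        and f = "\<lambda>i j x. qmap (rinner j) j ((fst i + fst x) *\<^sub>C (snd i + snd x))"], goal_cases)
  case 1
  show ?case
    unfolding mtop_prod_mfd mtop_sphere prod_topology_top_of_set continuous_map_top_of_set
    by (auto simp: hnorm_scaleC hnorm_complex case_prod_beta intro!: continuous_intros)
next
  case (2 i j n)
  show ?case
    by (intro Cn_on_qmap lc_linear_rinner Cn_on_intros) auto
next
  case (3 i j p)
  obtain k l where i: "i = (k, l)" "hnorm k = 1" "hnorm l = 1" and j: "hnorm j = 1"
    using 3 by (cases i) auto
  obtain a x where ax: "rinner k a = 0" "rinner l x = 0" "p = (nrm (k + a), nrm (l + x))"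
    using 3(3) i by (auto elim!: sph.mdom_E)
  have "k + a \<noteq> 0" "l + x \<noteq> 0"
    using ax i sph.translate_nonzero by auto
  \<comment> \<open>Normalisation is multiplicative and the charts of the sphere ignore positive
    factors, so no norm enters the coordinate formula of the action.\<close>
  moreover have "nrm (k + a) *\<^sub>C nrm (l + x) = nrm ((k + a) *\<^sub>C (l + x))"
    by (simp add: nrm_scaleC nrm_complex)
  ultimately show ?case
    using 3(4) ax i j sph.cl_mdom[of j "(k + a) *\<^sub>C (l + x)"] sph.mchart_X[of j "(k + a) *\<^sub>C (l + x)"]
    by (simp add: sph.mchart_translate)
qed

text \<open>\<open>nrm (i + mchart proj_mfd i (cline q))\<close> is the unit vector on the line of q
  with positive scalar product with i; the phase of <i, q> turns it back into q.\<close>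

lemma sphere_triv_inverse:
  assumes "hnorm i = 1" "hnorm q = 1" "cinner i q \<noteq> 0"
  shows "sgn (cinner i q) *\<^sub>C nrm (i + mchart proj_mfd i (cline q)) = q"
proof -
  have "i + mchart proj_mfd i (cline q) = inverse (cinner i q) *\<^sub>C q"
    using assms proj.mchart_X[of i q] by (simp add: proj.translate_qmap)
  moreover have "sgn (cinner i q) * sgn (inverse (cinner i q)) = 1"
    using assms(3) by (simp add: sgn_zero_iff)
  ultimately show ?thesis
    using assms by (simp add: nrm_scaleC nrm_unit)
qed

lemma diffeomorphism_sphere_triv:
  fixes i :: "'v::hermitian_lc_space"
  assumes i: "hnorm i = 1"
  shows "diffeomorphism (open_submfd sphere_mfd {q \<in> points sphere_mfd. cline q \<in> mdom proj_mfd i})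
    (prod_mfd (open_submfd proj_mfd (mdom proj_mfd i)) circle) (\<lambda>q. (cline q, sphere_triv i q))"
    (is "diffeomorphism ?P ?B ?F")
proof -
  define W where "W = {q::'v. hnorm q = 1 \<and> cinner i q \<noteq> 0}"
  have W: "{q \<in> points sphere_mfd. cline q \<in> mdom proj_mfd i} = W"
    using i unit_nonzero proj.cl_mdom[of i] by (auto simp: points_sphere W_def)
  have oW: "openin (mtop sphere_mfd) W"
    using openin_continuous_map_preimage[OF continuous_map_cline proj.openin_mdom[OF i]] W by simp
  have topP: "mtop ?P = top_of_set W"
    unfolding W by (auto simp: mtop_sphere subtopology_subtopology W_def intro!: arg_cong[where f = top_of_set])
  have P: "open_charts ?P"
    unfolding W by (intro open_charts_open_submfd open_charts_sphere oW)
  have B: "open_charts ?B"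
    using i by (intro open_charts_prod_mfd open_charts_open_submfd open_charts_proj
        open_charts_sphere proj.openin_mdom)
  have F: "continuous_map (mtop ?P) (mtop ?B) ?F"
  proof -
    have "continuous_map (top_of_set W) (mtop proj_mfd) cline"
      using continuous_map_from_subtopology[OF continuous_map_cline, of W] topP by (simp add: W)
    moreover have "continuous_on W (\<lambda>q. sgn (cinner i q))"
      by (intro continuous_intros) (auto simp: W_def)
    ultimately show ?thesis
      unfolding topP using W
      by (auto simp: mtop_sphere sphere_triv_def continuous_map_in_subtopology hnorm_complex norm_sgn W_def
          intro!: continuous_map_pairedI)
  qed
  have "smooth_map ?P ?B ?F"
  proof (rule smooth_mapI[OF P B F,
        where V = "\<lambda>k j. {x. cinner (fst j) (k + x) \<noteq> 0 \<and> cinner i (k + x) \<noteq> 0 \<and>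
            0 < Re (cinner (snd j) (sgn (cinner i (k + x))))}"
          and f = "\<lambda>k j x. (qmap (cinner (fst j)) (fst j) (k + x),
            qmap (rinner (snd j)) (snd j) (sgn (cinner i (k + x))))"], goal_cases)
    case (1 k jz n)
    show ?case
      by (intro Cn_on_qmap lc_linear_cinner lc_linear_rinner Cn_on_intros) (auto simp: rinner_def)
  next
    case (2 k jz q)
    obtain j z where jz: "jz = (j, z)" "hnorm j = 1" "hnorm z = 1" and k: "hnorm k = 1"
      using 2 by (cases jz) auto
    obtain x where x: "rinner k x = 0" "q = nrm (k + x)"
      using 2(3) k by (auto elim: sph.mdom_E)
    have nz: "k + x \<noteq> 0"
      by (rule sph.translate_nonzero[OF k x(1)])
    have "cinner j (k + x) \<noteq> 0" "cinner i (k + x) \<noteq> 0" "0 < Re (cinner z (sgn (cinner i (k + x))))"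
      using 2(4) jz(1) x(2) nz proj.cl_mdom[OF jz(2) nz] proj.cl_mdom[OF i nz]
      by (auto simp: cline_nrm mdom_sphere sphere_triv_def sgn_cinner_nrm)
    then show ?case
      using x nz k proj.mchart_X[of j "k + x"] jz
      by (simp add: sph.mchart_translate cline_nrm sphere_triv_def sgn_cinner_nrm
          mchart_sphere_unit hnorm_complex norm_sgn)
  qed
  moreover
  \<comment> \<open>The inverse of the trivialisation: the unit vector on the line p with positive
    scalar product with i, turned by the phase z.\<close>
  let ?G = "\<lambda>(p, z). z *\<^sub>C nrm (i + mchart proj_mfd i p)"
  have GF: "?G (?F q) = q" if "q \<in> points ?P" for q
    using that i W by (auto simp: W_def sphere_triv_def sphere_triv_inverse)
  have pointsB: "\<exists>x z. pz = (cline (i + x), z) \<and> cinner i x = 0 \<and> cmod z = 1" if "pz \<in> points ?B" for pz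
    using that i by (auto simp: points_sphere hnorm_complex elim!: proj.mdom_E)
  have G: "?G (cline (i + x), z) = z *\<^sub>C nrm (i + x)" if "cinner i x = 0" for x z
    using that i by (simp add: proj.mchart_translate)
  have FG: "?F (?G pz) = pz" if pz0: "pz \<in> points ?B" for pz
  proof -
    obtain x z where pz: "pz = (cline (i + x), z)" "cinner i x = 0" "cmod z = 1"
      using pointsB[OF pz0] by blast
    have Gpz: "?G pz = z *\<^sub>C nrm (i + x)"
      unfolding pz(1) by (rule G[OF pz(2)])
    have "z \<noteq> 0" "i + x \<noteq> 0"
      using pz i proj.translate_nonzero[of i x] by auto
    then show ?thesis
      unfolding Gpz using pz i
      by (simp add: cline_scale cline_nrm sphere_triv_def cinner_scaleC_right sgn_mult
          sgn_cinner_nrm proj.L_translate sgn_unit)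
  qed
  have "smooth_map ?B ?P ?G"
  proof (rule smooth_mapI[OF B P,
        where V = "\<lambda>jz k. {x. cinner i (fst jz + fst x) \<noteq> 0 \<and>
            0 < Re (rinner k ((snd jz + snd x) *\<^sub>C inverse (cinner i (fst jz + fst x)) *\<^sub>C (fst jz + fst x)))}"
          and f = "\<lambda>jz k x. qmap (rinner k) k
            ((snd jz + snd x) *\<^sub>C inverse (cinner i (fst jz + fst x)) *\<^sub>C (fst jz + fst x))"], goal_cases)
    case 1
    have "continuous_map (mtop ?B) (prod_topology (top_of_set (mmodel proj_mfd i)) (mtop circle))
        (\<lambda>(p, z). (mchart proj_mfd i p, z))"
      unfolding mtop_prod_mfd mtop_open_submfd
      by (subst continuous_map_prod_top) (simp add: proj.continuous_map_mchart[OF i])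
    moreover have "continuous_map (prod_topology (top_of_set (mmodel proj_mfd i)) (mtop circle))
        (top_of_set W) (\<lambda>(x, z). z *\<^sub>C nrm (i + x))"
      unfolding mtop_sphere prod_topology_top_of_set continuous_map_top_of_set
    proof
      show "continuous_on (mmodel proj_mfd i \<times> {z. hnorm z = 1}) (\<lambda>(x, z). z *\<^sub>C nrm (i + x))"
        unfolding case_prod_beta using proj.translate_nonzero[OF i]
        by (intro continuous_intros) (auto simp: proj.mmodel_X)
      have "hnorm (z *\<^sub>C nrm (i + x)) = 1 \<and> cinner i (z *\<^sub>C nrm (i + x)) \<noteq> 0"
        if "cinner i x = 0" "cmod z = 1" for x z
        using that i proj.translate_nonzero[OF i that(1)] sgn_cinner_nrm[of "i + x" i]
          proj.L_translate[OF i that(1)]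
        by (auto simp: hnorm_scaleC hnorm_nrm cinner_scaleC_right)
      then show "(\<lambda>(x, z). z *\<^sub>C nrm (i + x)) ` (mmodel proj_mfd i \<times> {z. hnorm z = 1}) \<subseteq> W"
        by (auto simp: W_def proj.mmodel_X hnorm_complex)
    qed
    ultimately have "continuous_map (mtop ?B) (top_of_set W)
        ((\<lambda>(x, z). z *\<^sub>C nrm (i + x)) \<circ> (\<lambda>(p, z). (mchart proj_mfd i p, z)))"
      by (rule continuous_map_compose)
    moreover have "(\<lambda>(x, z). z *\<^sub>C nrm (i + x)) \<circ> (\<lambda>(p, z). (mchart proj_mfd i p, z)) = ?G"
      by (simp add: fun_eq_iff)
    ultimately show ?case
      by (simp only: topP)
  next
    case (2 jz k n)
    show ?case
      by (intro Cn_on_qmap lc_linear_rinner Cn_on_intros) auto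
  next
    case (3 jz k pz)
    obtain j z where jz: "jz = (j, z)" "hnorm j = 1" "hnorm z = 1" and k: "hnorm k = 1"
      using 3 by (cases jz) auto
    obtain p w where pw: "pz = (p, w)" "p \<in> mdom proj_mfd j" "p \<in> mdom proj_mfd i" "w \<in> mdom circle z"
      using 3(3) jz(1) by (cases pz) auto
    obtain x where x: "cinner j x = 0" "p = cline (j + x)"
      using proj.mdom_E[OF pw(2) jz(2)] .
    obtain a where a: "rinner z a = 0" "w = nrm (z + a)"
      using sph.mdom_E[OF pw(4) jz(3)] .
    \<comment> \<open>An unnormalised lift of \<open>?G pz\<close>; its class under
      \<open>nrm\<close> is all that the charts of the sphere see.\<close>
    define y where "y = (z + a) *\<^sub>C inverse (cinner i (j + x)) *\<^sub>C (j + x)"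
    have nz: "j + x \<noteq> 0" "z + a \<noteq> 0" "cinner i (j + x) \<noteq> 0"
      using x a pw(3) jz i proj.translate_nonzero[of j x] sph.translate_nonzero[of z a]
        proj.cl_mdom[of i "j + x"] by auto
    have G_eq: "?G pz = nrm y"
      using pw x a nz i proj.mchart_X[of i "j + x"]
      by (simp add: y_def proj.translate_qmap nrm_scaleC nrm_complex sgn_mult)
    have "y \<noteq> 0"
      using nz by (simp add: y_def)
    then have "0 < Re (rinner k y)"
      using 3(4) G_eq sph.cl_mdom[OF k, of y] by simp
    moreover from this have "mchart sphere_mfd k (nrm y) = qmap (rinner k) k y"
      by (intro sph.mchart_X[OF k]) simp
    moreover have "mchart ?B jz pz = (x, a)"
      using pw x a jz by (simp add: proj.mchart_translate sph.mchart_translate)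
    ultimately show ?case
      using nz(3) unfolding G_eq by (simp add: jz(1) y_def)
  qed
  ultimately show ?thesis
    unfolding diffeomorphism_def using GF FG by blast
qed

lemma principal_U1_bundle_sphere:
  "principal_U1_bundle sphere_mfd proj_mfd scaleC (cline :: 'v::hermitian_lc_space \<Rightarrow> 'v set) sphere_triv"
  unfolding principal_U1_bundle_def
proof (intro conjI ballI allI impI smooth_manifold_sphere smooth_manifold_proj smooth_map_cline
    smooth_map_scaleC)
  show "cline ` points sphere_mfd = points (proj_mfd :: ('v set, 'v, 'v) mfd)"
  proof (intro equalityI subsetI)
    fix p :: "'v set"
    assume "p \<in> points proj_mfd"
    then obtain \<psi> where "hnorm \<psi> = 1" "p = cline \<psi>"
      by (rule points_proj_E)
    then show "p \<in> cline ` points sphere_mfd"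
      by (simp add: points_sphere)
  next
    fix p :: "'v set"
    assume "p \<in> cline ` points sphere_mfd"
    then show "p \<in> points proj_mfd"
      using unit_nonzero by (auto simp: points_sphere proj.points_X)
  qed
  fix q :: 'v and z :: complex
  show "cline (z *\<^sub>C q) = cline q" if "cmod z = 1"
    using that by (intro cline_scale) auto
  fix i :: 'v
  show "sphere_triv i (z *\<^sub>C q) = z * sphere_triv i q" if "cmod z = 1"
    using that by (simp add: sphere_triv_def cinner_simps sgn_mult sgn_unit)
  show "diffeomorphism (open_submfd sphere_mfd {q \<in> points sphere_mfd. cline q \<in> mdom proj_mfd i})
      (prod_mfd (open_submfd proj_mfd (mdom proj_mfd i)) circle) (\<lambda>q. (cline q, sphere_triv i q))"
    if "i \<in> mix proj_mfd"
    using that by (intro diffeomorphism_sphere_triv) simp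
qed simp_all


section \<open>The connection form\<close>

lemma (in qcharts) chart_at:
  assumes "x \<noteq> 0"
  shows "hnorm (chart_at X (cl x)) = 1" "L (chart_at X (cl x)) x \<in> G"
proof -
  have "\<exists>i. i \<in> mix X \<and> cl x \<in> mdom X i"
    using mdom_covers assms points_X by blast
  then have "chart_at X (cl x) \<in> mix X \<and> cl x \<in> mdom X (chart_at X (cl x))"
    unfolding chart_at_def by (rule someI_ex)
  then show "hnorm (chart_at X (cl x)) = 1" "L (chart_at X (cl x)) x \<in> G"
    using cl_mdom[OF _ assms] by auto
qed

text \<open>A function on the manifold is differentiated in the chart i through a lift g to an open
  subset of V; \<open>inverse (L i x) *\<^sub>C x\<close> is the representative i + y whose
  coordinate y is that of the base point.\<close>

lemma (in qcharts) has_dirderiv_param: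
  assumes i: "hnorm i = 1" "L i x \<in> G" and S: "open S" "inverse (L i x) *\<^sub>C x \<in> S"
    and f: "\<And>y. y \<in> S \<Longrightarrow> f (cl y) = g y"
    and g: "has_dirderiv g (inverse (L i x) *\<^sub>C x) (dq (L i) x u) D"
  shows "has_dirderiv (f \<circ> param X i) (mchart X i (cl x)) (dq (L i) x u) D"
proof -
  define U where "U = {y \<in> mmodel X i. i + y \<in> S}"
  have x: "i + mchart X i (cl x) = inverse (L i x) *\<^sub>C x"
    using i by (simp add: mchart_X translate_qmap)
  have "open ((\<lambda>y. i + y) -` S)"
    by (intro open_vimage S continuous_intros)
  then have U: "openin (top_of_set (mmodel X i)) U"
    unfolding U_def openin_open by blast
  show ?thesis
  proof (rule iffD2[OF has_dirderiv_openin_cong[OF U _ subspace_mmodel]])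
    show "mchart X i (cl x) \<in> U"
      using i S by (simp add: U_def x) (simp add: mchart_X mmodel_X L_qmap)
    show "dq (L i) x u \<in> mmodel X i"
      using i by (simp add: mmodel_X L_dq)
    show "(f \<circ> param X i) y = g (i + y)" if "y \<in> U" for y
      using that i f by (simp add: U_def mmodel_X param_translate)
    show "has_dirderiv (\<lambda>y. g (i + y)) (mchart X i (cl x)) (dq (L i) x u) D"
      using g by (simp add: has_dirderiv_def x[symmetric] add.assoc)
  qed
qed

text \<open>One proof for \<open>cline\<close> (with u = 1) and for the action of a phase u on the
  sphere. \<open>\<real> \<subseteq> K\<close> lets the target charts absorb the real factor by
  which the chart selected by \<open>chart_at\<close> rescales q.\<close>

lemma (in qcharts) tangent_map_sphere:
  assumes F: "\<And>y. y \<noteq> 0 \<Longrightarrow> F (nrm y) = cl (u *\<^sub>C y)" and u: "u \<noteq> 0"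
    and q: "hnorm q = 1" and K: "\<real> \<subseteq> K"
  shows "tangent_map sphere_mfd X F q (sph.tangent q z) = tangent (u *\<^sub>C q) (u *\<^sub>C z)"
proof
  fix j
  define i where "i = chart_at sphere_mfd q"
  have nz: "q \<noteq> 0" "u *\<^sub>C q \<noteq> 0" and nq: "nrm q = q"
    using q u unit_nonzero nrm_unit by auto
  have i: "hnorm i = 1" "rinner i q \<in> {c. 0 < Re c}"
    using sph.chart_at[OF nz(1)] by (simp_all only: nq i_def)
  define c where "c = inverse (rinner i q)"
  have c: "c \<noteq> 0" "c \<in> K" "rinner i z * c \<in> K"
    using i(2) sph.K_inverse[OF sph.L_K, of i q] K by (auto simp: c_def K_mult rinner_def)
  have "dirderiv (mchart X j \<circ> F \<circ> param sphere_mfd i) (mchart sphere_mfd i q) (sph.tangent q z i) =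
      dq (L j) (u *\<^sub>C q) (u *\<^sub>C z)" if j: "hnorm j = 1" "L j (u *\<^sub>C q) \<in> G"
  proof -
    have nrm_c: "nrm (c *\<^sub>C q) = q"
      unfolding c_def sph.cl_scale[OF sph.G_inverse[OF i(2)] sph.K_inverse[OF sph.L_K]] by (rule nq)
    then have "cl (u *\<^sub>C c *\<^sub>C q) = cl (u *\<^sub>C q)"
      using F[of "c *\<^sub>C q"] F[of q] nz c by (simp add: nq)
    then have x: "L j (u *\<^sub>C c *\<^sub>C q) \<in> G"
      using j cl_mdom[OF j(1) nz(2)] cl_mdom[OF j(1), of "u *\<^sub>C c *\<^sub>C q"] u c nz by simp
    have "has_dirderiv (mchart X j \<circ> F \<circ> param sphere_mfd i) (mchart sphere_mfd i (nrm q))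
        (dq (rinner i) q z) (dq (L j) (u *\<^sub>C c *\<^sub>C q) (u *\<^sub>C dq (rinner i) q z))"
      unfolding c_def
    proof (rule sph.has_dirderiv_param[OF i, where S = "(\<lambda>y. L j (u *\<^sub>C y)) -` G"])
      show "open ((\<lambda>y. L j (u *\<^sub>C y)) -` G)"
        by (intro open_vimage G_open continuous_intros)
      show "(mchart X j \<circ> F) (nrm y) = qmap (L j) j (u *\<^sub>C y)" if "y \<in> (\<lambda>y. L j (u *\<^sub>C y)) -` G" for y
      proof -
        have "y \<noteq> 0"
          using that L_G_nonzero[of j "u *\<^sub>C y"] by auto
        then show ?thesis
          using that j F by (simp add: mchart_X)
      qed
      show "has_dirderiv (\<lambda>y. qmap (L j) j (u *\<^sub>C y)) (inverse (rinner i q) *\<^sub>C q) (dq (rinner i) q z)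
          (dq (L j) (u *\<^sub>C inverse (rinner i q) *\<^sub>C q) (u *\<^sub>C dq (rinner i) q z))"
        using x G_nonzero[of "L j (u *\<^sub>C c *\<^sub>C q)"]
        by (intro has_dirderiv_qmap lin
            has_dirderiv_eq[OF scaleC.has_dirderiv[OF has_dirderiv_const has_dirderiv_ident]])
          (auto simp: c_def)
    qed (use x in \<open>simp add: c_def\<close>)
    moreover have "dq (L j) (u *\<^sub>C c *\<^sub>C q) (u *\<^sub>C dq (rinner i) q z) =
        dq (L j) (c *\<^sub>C u *\<^sub>C q) (c *\<^sub>C (u *\<^sub>C z - (rinner i z * c) *\<^sub>C u *\<^sub>C q))"
      by (simp add: dq_def c_def algebra_simps)
    moreover have "\<dots> = dq (L j) (u *\<^sub>C q) (u *\<^sub>C z - (rinner i z * c) *\<^sub>C u *\<^sub>C q)"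
      using c by (intro dq_scale_both L_scale)
    moreover have "\<dots> = dq (L j) (u *\<^sub>C q) (u *\<^sub>C z)"
      using c j G_nonzero by (intro dq_shift lin L_scale) auto
    ultimately show ?thesis
      using i has_dirderiv_imp by (simp add: sph.tangent_def nq)
  qed
  moreover have "F q = cl (u *\<^sub>C q)"
    using F[OF nz(1)] by (simp add: nq)
  then have "j \<in> mix X \<and> F q \<in> mdom X j \<longleftrightarrow> hnorm j = 1 \<and> L j (u *\<^sub>C q) \<in> G"
    using cl_mdom[OF _ nz(2), of j] by auto
  ultimately show "tangent_map sphere_mfd X F q (sph.tangent q z) j = tangent (u *\<^sub>C q) (u *\<^sub>C z) j"
    unfolding tangent_map_def i_def[symmetric] Let_def by (simp add: tangent_def)
qed

lemma tangent_map_cline: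
  "hnorm q = 1 \<Longrightarrow> tangent_map sphere_mfd proj_mfd cline q (sph.tangent q z) = proj.tangent q z"
  using proj.tangent_map_sphere[of cline 1 q z] by (simp add: cline_nrm)

lemma tangent_map_scaleC:
  assumes "hnorm q = 1" "cmod u = 1"
  shows "tangent_map sphere_mfd sphere_mfd (scaleC u) q (sph.tangent q z) = sph.tangent (u *\<^sub>C q) (u *\<^sub>C z)"
  using assms by (intro sph.tangent_map_sphere) (auto simp: nrm_scale_phase)

section \<open>The form \<alpha> on V - {0} and its exterior derivative\<close>

definition sphere_form :: "'v::hermitian_lc_space \<Rightarrow> 'v \<Rightarrow> real" where
  "sphere_form x v = Im (cinner x v * inverse (cinner x x))"

lemma sphere_form_scale: "c \<noteq> 0 \<Longrightarrow> sphere_form (c *\<^sub>C x) (c *\<^sub>C v) = sphere_form x v"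
  by (cases "x = 0") (simp_all add: sphere_form_def cinner_simps field_simps)

text \<open>In the chart at \<open>nrm x\<close> the differential only subtracts a real multiple of
  \<open>nrm x\<close> from the direction, which Im <nrm x, .> does not see; homogeneity then
  removes the normalisation.\<close>

lemma sphere_alpha_tangent:
  assumes "x \<noteq> 0"
  shows "sphere_alpha (nrm x) (sph.tangent x v) = sphere_form x v"
proof -
  define c where "c = complex_of_real (inverse (hnorm x))"
  have c: "c \<in> \<real>" "0 < Re c" "nrm x = c *\<^sub>C x"
    using hnorm_pos[OF assms] by (simp_all add: c_def nrm_def del: of_real_inverse)
  have n: "hnorm (nrm x) = 1"
    using hnorm_nrm[OF assms] .
  have "sph.tangent x v = sph.tangent (nrm x) (c *\<^sub>C v)"
    using sph.tangent_scale_both[of c x v] c assms by simp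
  moreover have "rinner (nrm x) (nrm x) = 1"
    using n by (simp add: rinner_def cinner_unit)
  ultimately have "sphere_alpha (nrm x) (sph.tangent x v) = Im (cinner (nrm x) (c *\<^sub>C v))"
    using n by (simp add: sphere_alpha_def sph.tangent_def dq_def cinner_diff_right cinner_scaleC_right
        cinner_unit rinner_def)
  also have "\<dots> = sphere_form (nrm x) (c *\<^sub>C v)"
    using n by (simp add: sphere_form_def cinner_unit)
  also have "\<dots> = sphere_form x v"
    using c by (subst c(3)) (intro sphere_form_scale, auto)
  finally show ?thesis .
qed

lemma local_form1_sphere_alpha:
  assumes "hnorm i = 1" "rinner i x = 0" "rinner i v = 0"
  shows "local_form1 sphere_mfd sphere_alpha i x v = sphere_form (i + x) v"
  using assms unfolding local_form1_def
  by (simp add: sph.param_translate sph.tangent_vector_eq sphere_alpha_tangent sph.translate_nonzero)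

lemma Cn_on_sphere_form:
  assumes "Cn_on n E U F" "Cn_on n E U V"
    and "\<And>x h. x \<in> U \<Longrightarrow> h \<in> UNIV \<rightarrow> E \<Longrightarrow> F x h \<noteq> 0"
  shows "Cn_on n E U (\<lambda>x h. sphere_form (F x h) (V x h))"
  unfolding sphere_form_def using assms by (intro Cn_on_intros) auto

lemma has_dirderiv_sphere_form:
  assumes "i + x \<noteq> 0"
  shows "has_dirderiv (\<lambda>y. sphere_form (i + y) w) x v
    (Im (cinner v w * inverse (cinner (i + x) (i + x)) + cinner (i + x) w *
      ((cinner v (i + x) + cinner (i + x) v) *
       - (inverse (cinner (i + x) (i + x)) * inverse (cinner (i + x) (i + x))))))"
proof -
  have nz: "cinner (i + x) (i + x) \<noteq> 0"
    using assms by simp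
  show ?thesis
    unfolding sphere_form_def
    by (rule has_dirderiv_eq, (rule dirderiv_intros nz)+) simp
qed

text \<open>Antisymmetrising doubles Im <v, w>, which is the origin of the factor 2 in
  \<open>proj_H\<close>; the derivatives of 1 / <x, x> combine to the term with <v, x> <x,
  w>.\<close>

lemma sphere_form_ext_deriv:
  assumes "i + x \<noteq> 0"
  shows "dirderiv (\<lambda>y. sphere_form (i + y) w) x v - dirderiv (\<lambda>y. sphere_form (i + y) v) x w =
    Im (fubini_study (i + x) v w)"
proof -
  define y where "y = i + x"
  define n where "n = inverse ((hnorm y)\<^sup>2)"
  have n: "inverse (cinner y y) = complex_of_real n"
    by (simp add: n_def cinner_self)
  have "cinner v y = cnj (cinner y v)" "cinner w y = cnj (cinner y w)" "cinner w v = cnj (cinner v w)"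
    by (rule cinner_commute)+
  then show ?thesis
    unfolding has_dirderiv_imp[OF has_dirderiv_sphere_form[OF assms]] y_def[symmetric] n fubini_study_def
    by (simp add: algebra_simps)
qed

lemma one_form_sphere_alpha: "one_form sphere_mfd sphere_alpha"
  unfolding one_form_def
proof (intro conjI ballI allI)
  fix i :: 'a
  assume "i \<in> mix sphere_mfd"
  then have i: "hnorm i = 1"
    by simp
  define T where "T = mmodel sphere_mfd i"
  have im: "mchart sphere_mfd i ` mdom sphere_mfd i = T"
    by (simp add: sph.mchart_image[OF i] T_def)
  have T: "rinner i v = 0" if "v \<in> T" for v
    using that by (simp add: T_def sph.mmodel_X)
  have "smooth_on (T \<times> T) (T \<times> T) (\<lambda>(x, v). local_form1 sphere_mfd sphere_alpha i x v)"
  proof (rule smooth_on_if_Cn_on)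
    show "openin (top_of_set (T \<times> T)) (T \<times> T)" "subspace (T \<times> T)"
      using sph.subspace_mmodel by (auto simp: T_def intro!: subspace_Times)
    show "Cn_on n (T \<times> T) (T \<times> T) (\<lambda>z h. sphere_form (i + fst z) (snd z))" for n
      using sph.translate_nonzero[OF i] T
      by (intro Cn_on_sphere_form Cn_on_intros) auto
  qed (auto simp: local_form1_sphere_alpha i T)
  then show "smooth_on (mmodel sphere_mfd i \<times> mmodel sphere_mfd i)
      (mchart sphere_mfd i ` mdom sphere_mfd i \<times> mmodel sphere_mfd i)
      (\<lambda>(x, v). local_form1 sphere_mfd sphere_alpha i x v)"
    unfolding im T_def .
qed (simp_all add: sphere_alpha_def cinner_simps)

lemma sphere_tangent_E:
  assumes "hnorm q = 1" "\<xi> \<in> tangent_space sphere_mfd q"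
  shows "\<xi> = sph.tangent q (\<xi> q)" "rinner q (\<xi> q) = 0"
  using sph.tangent_space_E[of \<xi> q] assms by (simp_all add: nrm_unit)

lemma sphere_alpha_unit: "hnorm q = 1 \<Longrightarrow> sphere_alpha q (sph.tangent q z) = Im (cinner q z)"
  using sphere_alpha_tangent[of q z] unit_nonzero[of q] by (simp add: nrm_unit sphere_form_def cinner_unit)

lemma has_dirderiv_cis: "has_dirderiv cis 0 (1::real) \<i>"
  unfolding has_dirderiv_iff_vector_derivative has_vector_derivative_def
  by (auto intro!: derivative_eq_intros simp: scaleR_conv_of_real)

text \<open>\<open>sphere_alpha\<close> at q reads only the component in the chart at q, so this one
  is computed. The curve stays in the chart domain as long as cos t is positive, and i q is already
  tangent to the sphere.\<close>

lemma fundamental_vector_sphere: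
  assumes q: "hnorm q = 1"
  shows "fundamental_vector sphere_mfd scaleC q q = \<i> *\<^sub>C q"
proof -
  have "has_dirderiv (\<lambda>t. qmap (rinner q) q (cis t *\<^sub>C q)) (0::real) 1 (dq (rinner q) q (\<i> *\<^sub>C q))"
    using q by (intro has_dirderiv_eq[OF has_dirderiv_qmap[OF lc_linear_rinner
          scaleC.has_dirderiv[OF has_dirderiv_cis has_dirderiv_const]]])
      (simp_all add: rinner_def cinner_unit)
  moreover have "dq (rinner q) q (\<i> *\<^sub>C q) = \<i> *\<^sub>C q"
    using q by (simp add: dq_def rinner_def cinner_simps cinner_unit)
  moreover have "\<forall>\<^sub>F t in at 0. mchart sphere_mfd q (cis (0 + t *\<^sub>R 1) *\<^sub>C q) =
      qmap (rinner q) q (cis (0 + t *\<^sub>R 1) *\<^sub>C q)"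
  proof -
    have "(cos \<longlongrightarrow> cos 0) (at (0::real))"
      by (intro tendsto_cos tendsto_ident_at)
    then have "\<forall>\<^sub>F t::real in at 0. 0 < cos t"
      by (rule order_tendstoD(1)) simp
    then show ?thesis
    proof eventually_elim
      case (elim t)
      have "hnorm (cis t *\<^sub>C q) = 1" "0 < Re (cinner q (cis t *\<^sub>C q))"
        using q elim by (simp_all add: hnorm_scaleC cinner_simps cinner_unit)
      then show ?case
        using mchart_sphere_unit[OF q] by simp
    qed
  qed
  moreover have "mchart sphere_mfd q (cis 0 *\<^sub>C q) = qmap (rinner q) q (cis 0 *\<^sub>C q)"
    using mchart_sphere_unit[OF q q] q by (simp add: cinner_unit)
  ultimately have "has_dirderiv (\<lambda>t. mchart sphere_mfd q (cis t *\<^sub>C q)) 0 1 (\<i> *\<^sub>C q)"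
    using has_dirderiv_cong[of "\<lambda>t. mchart sphere_mfd q (cis t *\<^sub>C q)" 0 1 "\<lambda>t. qmap (rinner q) q (cis t *\<^sub>C q)"]
    by simp
  from has_dirderiv_imp[OF this] show ?thesis
    using q by (simp add: fundamental_vector_def mdom_sphere cinner_unit)
qed

lemma principal_connection_sphere: "principal_connection sphere_mfd scaleC sphere_alpha"
  unfolding principal_connection_def
proof (intro conjI ballI allI impI one_form_sphere_alpha)
  fix q :: 'a
  assume "q \<in> points sphere_mfd"
  then have q: "hnorm q = 1"
    by (simp add: points_sphere)
  show "sphere_alpha q (fundamental_vector sphere_mfd scaleC q) = 1"
    using q by (simp add: sphere_alpha_def fundamental_vector_sphere cinner_simps cinner_unit)
  fix \<xi> and u :: complex
  assume "\<xi> \<in> tangent_space sphere_mfd q" and u: "cmod u = 1"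
  then have \<xi>: "\<xi> = sph.tangent q (\<xi> q)"
    using sphere_tangent_E q by blast
  have "hnorm (u *\<^sub>C q) = 1"
    using q u by (simp add: hnorm_scaleC)
  moreover have "cinner (u *\<^sub>C q) (u *\<^sub>C \<xi> q) = cinner q (\<xi> q)"
  proof -
    have "cinner (u *\<^sub>C q) (u *\<^sub>C \<xi> q) = (u * cnj u) * cinner q (\<xi> q)"
      by (simp add: cinner_simps)
    also have "u * cnj u = 1"
      unfolding complex_norm_square[symmetric] using u by simp
    finally show ?thesis
      by simp
  qed
  ultimately show "sphere_alpha (u *\<^sub>C q) (tangent_map sphere_mfd sphere_mfd (scaleC u) q \<xi>) = sphere_alpha q \<xi>"
    using q u by (subst (1 2) \<xi>) (simp add: tangent_map_scaleC sphere_alpha_unit)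
qed

text \<open>Both sides are expressions in a representative and two directions: the pullback is the
  imaginary part of \<open>fubini_study\<close> at q, which \<open>fubini_study_dq\<close> moves to
  the representative i + x of the chart, where \<open>sphere_form_ext_deriv\<close> applies.\<close>

lemma is_ext_deriv1_sphere:
  "is_ext_deriv1 sphere_mfd sphere_alpha (pullback2 sphere_mfd proj_mfd cline proj_Omega)"
  unfolding is_ext_deriv1_def
proof (intro ballI)
  fix i q :: 'a and \<xi> \<eta>
  assume "i \<in> mix sphere_mfd" and "q \<in> mdom sphere_mfd i"
    and \<xi>: "\<xi> \<in> tangent_space sphere_mfd q" and \<eta>: "\<eta> \<in> tangent_space sphere_mfd q"
  then have i: "hnorm i = 1" and q: "hnorm q = 1" "0 < Re (cinner i q)"
    by (auto simp: mdom_sphere)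
  note \<xi>' = sphere_tangent_E(1)[OF q(1) \<xi>] and \<eta>' = sphere_tangent_E(1)[OF q(1) \<eta>]
  define v w where "v = \<xi> q" and "w = \<eta> q"
  have G: "rinner i q \<in> {c. 0 < Re c}"
    using q by (simp add: rinner_def)
  have D1: "\<xi> i = dq (rinner i) q v" "\<eta> i = dq (rinner i) q w"
    using i G by (subst \<xi>' \<eta>', simp add: sph.tangent_def v_def w_def)+
  have "pullback2 sphere_mfd proj_mfd cline proj_Omega q \<xi> \<eta> = Im (fubini_study q v w)"
    by (subst \<xi>', subst \<eta>') (simp add: pullback2_def tangent_map_cline q proj_Omega_def
        proj_H_tangent unit_nonzero v_def w_def)
  also have "\<dots> = Im (fubini_study (i + mchart sphere_mfd i q) (\<xi> i) (\<eta> i))"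
  proof -
    have "rinner i q \<noteq> 0"
      using G by auto
    moreover have "i + mchart sphere_mfd i q = inverse (rinner i q) *\<^sub>C q"
      using i q by (simp add: mchart_sphere_unit sph.translate_qmap)
    ultimately show ?thesis
      by (simp add: fubini_study_dq D1)
  qed
  also have "\<dots> = ext_deriv1 sphere_mfd sphere_alpha i (mchart sphere_mfd i q) (\<xi> i) (\<eta> i)"
  proof -
    define x where "x = mchart sphere_mfd i q"
    have x: "rinner i x = 0"
      using i q G sph.L_qmap[OF i G] by (simp add: x_def mchart_sphere_unit)
    have T: "rinner i (\<xi> i) = 0" "rinner i (\<eta> i) = 0"
      unfolding D1 by (rule sph.L_dq[OF G])+
    have D: "dirderiv (\<lambda>y. local_form1 sphere_mfd sphere_alpha i y w) x v =
        dirderiv (\<lambda>y. sphere_form (i + y) w) x v" if "rinner i v = 0" "rinner i w = 0" for v w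
    proof (rule dirderiv_cong)
      show "\<forall>\<^sub>F t in at 0. local_form1 sphere_mfd sphere_alpha i (x + t *\<^sub>R v) w = sphere_form (i + (x + t *\<^sub>R v)) w"
        using that i x by (intro always_eventually allI local_form1_sphere_alpha)
          (simp_all add: sph.L_add lc_linear.scaleR[OF lc_linear_rinner])
    qed (use that i x local_form1_sphere_alpha in auto)
    show ?thesis
      unfolding ext_deriv1_def x_def[symmetric] D[OF T] D[OF T(2,1)]
      using sph.translate_nonzero[OF i x] by (simp add: sphere_form_ext_deriv)
  qed
  finally show "pullback2 sphere_mfd proj_mfd cline proj_Omega q \<xi> \<eta> =
      ext_deriv1 sphere_mfd sphere_alpha i (mchart sphere_mfd i q) (\<xi> i) (\<eta> i)" .
qed


section \<open>The tautological line bundle\<close>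

abbreviation (input) taut_class :: "'v::hermitian_lc_space \<Rightarrow> complex \<Rightarrow> ('v \<times> complex) set" where
  "taut_class \<equiv> assoc_class scaleC"

abbreviation (input) taut_proj :: "('v::hermitian_lc_space \<times> complex) set \<Rightarrow> 'v set" where
  "taut_proj \<equiv> assoc_proj cline"

lemma mem_taut_class: "(q', z') \<in> taut_class q z \<longleftrightarrow> (\<exists>u. cmod u = 1 \<and> q' = u *\<^sub>C q \<and> z' = z / u)"
  by (auto simp: assoc_class_def)

lemma taut_class_phase:
  assumes "cmod u = 1"
  shows "taut_class (u *\<^sub>C q) z = taut_class q (u * z)"
proof -
  have u: "u \<noteq> 0"
    using assms by auto
  have "(q', z') \<in> taut_class (u *\<^sub>C q) z \<longleftrightarrow> (q', z') \<in> taut_class q (u * z)" for q' z'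
    unfolding mem_taut_class
  proof
    assume "\<exists>v. cmod v = 1 \<and> q' = v *\<^sub>C u *\<^sub>C q \<and> z' = z / v"
    then obtain v where "cmod v = 1" "q' = v *\<^sub>C u *\<^sub>C q" "z' = z / v"
      by blast
    then show "\<exists>v. cmod v = 1 \<and> q' = v *\<^sub>C q \<and> z' = u * z / v"
      using assms u by (intro exI[of _ "v * u"]) (simp add: norm_mult)
  next
    assume "\<exists>v. cmod v = 1 \<and> q' = v *\<^sub>C q \<and> z' = u * z / v"
    then obtain v where "cmod v = 1" "q' = v *\<^sub>C q" "z' = u * z / v"
      by blast
    then show "\<exists>v. cmod v = 1 \<and> q' = v *\<^sub>C u *\<^sub>C q \<and> z' = z / v"
      using assms u by (intro exI[of _ "v / u"]) (simp add: norm_divide)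
  qed
  then show ?thesis
    by auto
qed

text \<open>\<open>assoc_rep\<close> selects an unspecified representative, known only up to a phase
  u; the operations below are computed by letting u cancel.\<close>

lemma assoc_rep_taut_class:
  obtains u where "cmod u = 1" "assoc_rep (taut_class q z) = (u *\<^sub>C q, z / u)"
proof -
  have "(1 *\<^sub>C q, z / 1) \<in> taut_class q z"
    unfolding mem_taut_class by (intro exI[of _ 1]) simp
  then have "assoc_rep (taut_class q z) \<in> taut_class q z"
    unfolding assoc_rep_def by (rule someI)
  then show thesis
    using that by (cases "assoc_rep (taut_class q z)") (auto simp: mem_taut_class)
qed

lemma mem_taut_class_self: "q \<noteq> 0 \<Longrightarrow> (q, w) \<in> taut_class q z \<longleftrightarrow> w = z"
proof -
  assume "q \<noteq> 0"
  then have "q = u *\<^sub>C q \<longleftrightarrow> u = 1" for u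
    using scaleC.scale_cancel_right[of 1 q u] by auto
  then show ?thesis
    by (auto simp: mem_taut_class intro: exI[of _ 1])
qed

lemma assoc_proj_taut_class [simp]: "taut_proj (taut_class q z) = cline q"
proof -
  obtain u where "cmod u = 1" "assoc_rep (taut_class q z) = (u *\<^sub>C q, z / u)"
    by (rule assoc_rep_taut_class)
  moreover from this(1) have "u \<noteq> 0"
    by auto
  ultimately show ?thesis
    by (simp add: assoc_proj_def cline_scale)
qed

lemma assoc_scale_taut_class [simp]: "assoc_scale scaleC c (taut_class q z) = taut_class q (c * z)"
proof -
  obtain u where "cmod u = 1" "assoc_rep (taut_class q z) = (u *\<^sub>C q, z / u)"
    by (rule assoc_rep_taut_class)
  moreover from this(1) have "u \<noteq> 0"
    by auto
  ultimately show ?thesis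
    by (simp add: assoc_scale_def taut_class_phase)
qed

lemma assoc_add_taut_class [simp]:
  assumes "q \<noteq> 0"
  shows "assoc_add scaleC (taut_class q z) (taut_class q w) = taut_class q (z + w)"
proof -
  obtain u where u: "cmod u = 1" "assoc_rep (taut_class q z) = (u *\<^sub>C q, z / u)"
    by (rule assoc_rep_taut_class)
  then have nz: "u \<noteq> 0" "u *\<^sub>C q \<noteq> 0"
    using assms by auto
  \<comment> \<open>Rewriting the second class over the same vector \<open>u *\<^sub>C q\<close>
    makes the coordinate selected by \<open>THE\<close> unique.\<close>
  have "taut_class q w = taut_class (u *\<^sub>C q) (w / u)"
    using u nz by (simp add: taut_class_phase)
  then have "(THE w'. (u *\<^sub>C q, w') \<in> taut_class q w) = w / u"
    using mem_taut_class_self[OF nz(2)] by simp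
  then show ?thesis
    using u nz by (simp add: assoc_add_def taut_class_phase distrib_left)
qed

lemma taut_vector_taut_class [simp]: "taut_vector (taut_class q z) = z *\<^sub>C q"
proof -
  obtain u where "cmod u = 1" "assoc_rep (taut_class q z) = (u *\<^sub>C q, z / u)"
    by (rule assoc_rep_taut_class)
  moreover from this(1) have "u \<noteq> 0"
    by auto
  ultimately show ?thesis
    by (simp add: taut_vector_def)
qed

section \<open>Topology and charts of the total space\<close>

lemma mix_taut [simp]: "mix taut_bundle = {j. hnorm j = 1}"
  and mmodel_taut: "mmodel taut_bundle i = mmodel proj_mfd i \<times> UNIV"
  by (simp_all add: taut_bundle_def assoc_line_bundle_def)

lemma mtop_taut: "mtop taut_bundle =
    quotient_topology (top_of_set ({\<psi>. hnorm \<psi> = 1} \<times> UNIV)) (\<lambda>(q, z). taut_class q z)"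
  using prod_topology_top_of_set[of "{\<psi>::'a. hnorm \<psi> = 1}" "UNIV :: complex set"]
  by (simp add: taut_bundle_def assoc_line_bundle_def mtop_sphere)

lemma mchart_taut: "mchart taut_bundle i (taut_class q z) =
    (mchart proj_mfd i (cline q), sgn (cinner i q) * z)"
proof -
  obtain u where "cmod u = 1" "assoc_rep (taut_class q z) = (u *\<^sub>C q, z / u)"
    by (rule assoc_rep_taut_class)
  moreover from this(1) have "u \<noteq> 0"
    by auto
  ultimately show ?thesis
    by (simp add: taut_bundle_def assoc_line_bundle_def cline_scale sphere_triv_def cinner_simps
        sgn_mult sgn_unit)
qed

lemma points_taut: "points taut_bundle = {taut_class q z |q z. hnorm q = 1}"
  by (auto simp: mtop_taut topspace_quotient_topology)

lemma mdom_taut: "mdom taut_bundle i = {l \<in> points taut_bundle. taut_proj l \<in> mdom proj_mfd i}"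
proof -
  have "mdom taut_bundle i = {taut_class q z |q z. hnorm q = 1 \<and> cline q \<in> mdom proj_mfd i}"
    by (simp add: taut_bundle_def assoc_line_bundle_def points_sphere)
  then show ?thesis
    unfolding points_taut by auto
qed

lemma taut_class_points: "hnorm q = 1 \<Longrightarrow> taut_class q z \<in> points taut_bundle"
  unfolding points_taut by blast

lemma taut_class_mdom:
  assumes "hnorm i = 1" "hnorm q = 1"
  shows "taut_class q z \<in> mdom taut_bundle i \<longleftrightarrow> cinner i q \<noteq> 0"
  using proj.cl_mdom[OF assms(1) unit_nonzero[OF assms(2)]]
  by (simp add: mdom_taut taut_class_points assms(2))

lemma taut_fibre_E:
  assumes "l \<in> points taut_bundle" "taut_proj l = cline q" "hnorm q = 1"
  obtains z where "l = taut_class q z"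
proof -
  obtain q' z where l: "l = taut_class q' z" "hnorm q' = 1"
    using assms(1) by (auto simp: points_taut)
  have "cline q' = cline q" "q' \<noteq> 0"
    using l assms(2) unit_nonzero[OF l(2)] by simp_all
  then obtain c where c: "q' = c *\<^sub>C q"
    by (rule cline_eq_E)
  then have "cmod c = 1"
    using l assms(3) by (simp add: hnorm_scaleC)
  then show thesis
    using that l c by (simp add: taut_class_phase)
qed

lemma taut_proj_points: "l \<in> points taut_bundle \<Longrightarrow> taut_proj l \<in> points proj_mfd"
  by (auto simp: points_taut proj.points_X dest: unit_nonzero)

lemma continuous_map_taut_class:
  "continuous_map (top_of_set ({\<psi>. hnorm \<psi> = 1} \<times> UNIV)) (mtop taut_bundle) (\<lambda>(q, z). taut_class q z)"
  unfolding mtop_taut by (rule continuous_map_quotient)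

lemma continuous_map_taut_proj: "continuous_map (mtop taut_bundle) (mtop proj_mfd) taut_proj"
  unfolding mtop_taut
proof (rule continuous_map_from_quotient_UNIV)
  have "continuous_map (top_of_set ({\<psi>::'a. hnorm \<psi> = 1} \<times> (UNIV::complex set))) (mtop sphere_mfd) fst"
    unfolding mtop_sphere continuous_map_top_of_set by (auto intro!: continuous_intros)
  from continuous_map_compose[OF this continuous_map_cline]
  show "continuous_map (top_of_set ({\<psi>. hnorm \<psi> = 1} \<times> UNIV)) (mtop proj_mfd)
      (\<lambda>x. taut_proj (case x of (q, z) \<Rightarrow> taut_class (q::'a) z))"
    by (simp add: o_def case_prod_beta)
qed

lemma openin_mdom_taut: "hnorm i = 1 \<Longrightarrow> openin (mtop taut_bundle) (mdom taut_bundle i)"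
  unfolding mdom_taut
  by (rule openin_continuous_map_preimage[OF continuous_map_taut_proj proj.openin_mdom])

text \<open>Since <i, i + x> = 1, the vector \<open>nrm (i + x)\<close> has phase 1 in the
  trivialisation over i; so (x, c) -> [nrm (i + x), c] inverts the chart.\<close>

lemma taut_class_mem:
  assumes "hnorm i = 1" "cinner i x = 0"
  shows "taut_class (nrm (i + x)) c \<in> mdom taut_bundle i"
    and "mchart taut_bundle i (taut_class (nrm (i + x)) c) = (x, c)"
  using assms proj.translate_nonzero[OF assms] proj.L_translate[OF assms] proj.translate_mdom[OF assms]
    hnorm_nrm[of "i + x"]
  by (auto simp: mdom_taut points_taut cline_nrm mchart_taut proj.mchart_translate sgn_cinner_nrm)

lemma mdom_taut_E:
  assumes "l \<in> mdom taut_bundle i" "hnorm i = 1"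
  obtains x c where "cinner i x = 0" "l = taut_class (nrm (i + x)) c"
proof -
  obtain x where x: "cinner i x = 0" "taut_proj l = cline (i + x)"
    using assms by (auto simp: mdom_taut elim: proj.mdom_E)
  have "i + x \<noteq> 0"
    by (rule proj.translate_nonzero[OF assms(2) x(1)])
  then have "l \<in> points taut_bundle" "taut_proj l = cline (nrm (i + x))" "hnorm (nrm (i + x)) = 1"
    using assms(1) x(2) by (simp_all add: mdom_taut cline_nrm hnorm_nrm)
  then obtain c where "l = taut_class (nrm (i + x)) c"
    by (rule taut_fibre_E)
  with that x(1) show thesis .
qed

lemma mchart_taut_image:
  assumes i: "hnorm i = 1"
  shows "mchart taut_bundle i ` mdom taut_bundle i = mmodel taut_bundle i"
proof (intro equalityI subsetI)
  fix y
  assume "y \<in> mchart taut_bundle i ` mdom taut_bundle i"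
  then obtain l where l: "l \<in> mdom taut_bundle i" "y = mchart taut_bundle i l"
    by auto
  obtain x c where "cinner i x = 0" "l = taut_class (nrm (i + x)) c"
    using mdom_taut_E[OF l(1) i] .
  then show "y \<in> mmodel taut_bundle i"
    using l i by (simp add: mmodel_taut proj.mmodel_X taut_class_mem)
next
  fix y
  assume "y \<in> mmodel taut_bundle i"
  then have "cinner i (fst y) = 0"
    by (auto simp: mmodel_taut proj.mmodel_X)
  from taut_class_mem[OF i this, of "snd y"] show "y \<in> mchart taut_bundle i ` mdom taut_bundle i"
    by (metis image_eqI prod.collapse)
qed

lemma homeomorphic_map_mchart_taut:
  fixes i :: "'v::hermitian_lc_space"
  assumes i: "hnorm i = 1"
  shows "homeomorphic_map (subtopology (mtop taut_bundle) (mdom taut_bundle i))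
    (top_of_set (mchart taut_bundle i ` mdom taut_bundle i)) (mchart taut_bundle i)"
  unfolding homeomorphic_map_maps homeomorphic_maps_def
proof (intro exI conjI)
  let ?S = "{\<psi>::'v. hnorm \<psi> = 1}"
  define D where "D = {(q::'v, z::complex). hnorm q = 1 \<and> cinner i q \<noteq> 0}"
  have D: "{x \<in> topspace (top_of_set (?S \<times> UNIV)). (case x of (q, z) \<Rightarrow> taut_class q z) \<in> mdom taut_bundle i} = D"
    by (auto simp: D_def taut_class_mdom i)
  have "continuous_on D (\<lambda>x. (qmap (cinner i) i (fst x), sgn (cinner i (fst x)) * snd x))"
    unfolding qmap_def by (intro continuous_intros) (auto simp: D_def)
  then have "continuous_on D (\<lambda>x. mchart taut_bundle i (case x of (q, z) \<Rightarrow> taut_class q z))"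
  proof (rule continuous_on_eq)
    show "(qmap (cinner i) i (fst x), sgn (cinner i (fst x)) * snd x) =
        mchart taut_bundle i (case x of (q, z) \<Rightarrow> taut_class q z)" if "x \<in> D" for x
      using that i proj.mchart_X[of i "fst x"] by (auto simp: D_def mchart_taut)
  qed
  moreover have "?S \<times> UNIV \<inter> D = D"
    by (auto simp: D_def)
  ultimately have "continuous_map (subtopology (top_of_set (?S \<times> UNIV)) D) euclidean
      (\<lambda>x. mchart taut_bundle i (case x of (q, z) \<Rightarrow> taut_class q z))"
    by (simp add: subtopology_subtopology)
  then have "continuous_map (subtopology (mtop taut_bundle) (mdom taut_bundle i)) euclidean (mchart taut_bundle i)"
    unfolding mtop_taut using openin_mdom_taut[OF i]
    by (intro continuous_map_from_quotient) (simp_all only: D mtop_taut)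
  then show "continuous_map (subtopology (mtop taut_bundle) (mdom taut_bundle i))
      (top_of_set (mchart taut_bundle i ` mdom taut_bundle i)) (mchart taut_bundle i)"
    by (auto simp: continuous_map_in_subtopology)
  have "continuous_map (top_of_set (mmodel taut_bundle i)) (top_of_set (?S \<times> UNIV))
      (\<lambda>(x, c). (nrm (i + x), c))"
    unfolding continuous_map_top_of_set case_prod_beta
  proof
    show "continuous_on (mmodel taut_bundle i) (\<lambda>x. (nrm (i + fst x), snd x))"
      using proj.translate_nonzero[OF i]
      by (intro continuous_intros) (auto simp: mmodel_taut proj.mmodel_X)
  qed (use proj.translate_nonzero[OF i] in \<open>auto simp: mmodel_taut proj.mmodel_X hnorm_nrm\<close>)
  from continuous_map_compose[OF this continuous_map_taut_class]
  have "continuous_map (top_of_set (mmodel taut_bundle i)) (mtop taut_bundle)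
      ((\<lambda>(q, z). taut_class q z) \<circ> (\<lambda>(x, c). (nrm (i + x), c)))"
    by (simp add: case_prod_beta)
  moreover have "(\<lambda>(q, z). taut_class q z) \<circ> (\<lambda>(x, c). (nrm (i + x), c)) =
      (\<lambda>(x, c). taut_class (nrm (i + x)) c)"
    by (simp add: fun_eq_iff)
  ultimately have "continuous_map (top_of_set (mmodel taut_bundle i)) (mtop taut_bundle)
      (\<lambda>(x, c). taut_class (nrm (i + x)) c)"
    by (simp only:)
  then show "continuous_map (top_of_set (mchart taut_bundle i ` mdom taut_bundle i))
      (subtopology (mtop taut_bundle) (mdom taut_bundle i)) (\<lambda>(x, c). taut_class (nrm (i + x)) c)"
    using i by (auto simp: mchart_taut_image continuous_map_in_subtopology mmodel_taut proj.mmodel_X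
        taut_class_mem)
  show "\<forall>l\<in>topspace (subtopology (mtop taut_bundle) (mdom taut_bundle i)).
      (case mchart taut_bundle i l of (x, c) \<Rightarrow> taut_class (nrm (i + x)) c) = l"
    using i by (auto simp: taut_class_mem elim!: mdom_taut_E)
  show "\<forall>y\<in>topspace (top_of_set (mchart taut_bundle i ` mdom taut_bundle i)).
      mchart taut_bundle i (case y of (x, c) \<Rightarrow> taut_class (nrm (i + x)) c) = y"
    using i by (auto simp: mchart_taut_image mmodel_taut proj.mmodel_X taut_class_mem)
qed

text \<open>The bundle is mapped continuously and injectively into the product of the projective
  space and V. The base point is needed to separate the zero vectors of different fibres, which
  \<open>taut_vector\<close> identifies.\<close>

lemma Hausdorff_taut: "Hausdorff_space (mtop (taut_bundle :: (('v::hermitian_lc_space \<times> complex) set, 'v \<times> complex, 'v) mfd))"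
proof (rule Hausdorff_space_injective_preimage)
  show "Hausdorff_space (prod_topology (mtop (proj_mfd :: ('v set, 'v, 'v) mfd)) (euclidean :: 'v topology))"
    unfolding Hausdorff_space_prod_topology using Hausdorff_proj Hausdorff_space_euclidean_t2 by blast
  have "continuous_map (mtop taut_bundle) (euclidean :: 'v topology) taut_vector"
    unfolding mtop_taut
    by (rule continuous_map_from_quotient_UNIV) (auto simp: case_prod_beta intro!: continuous_intros)
  then show "continuous_map (mtop taut_bundle) (prod_topology (mtop proj_mfd) euclidean)
      (\<lambda>l. (taut_proj l, taut_vector l :: 'v))"
    by (intro continuous_map_pairedI continuous_map_taut_proj)
  show "inj_on (\<lambda>l. (taut_proj l, taut_vector l :: 'v)) (points taut_bundle)"
  proof (rule inj_onI)
    fix l l' :: "('v \<times> complex) set"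
    assume l: "l \<in> points taut_bundle" "l' \<in> points taut_bundle"
      and eq: "(taut_proj l, taut_vector l) = (taut_proj l', taut_vector l')"
    obtain q z where q: "l = taut_class q z" "hnorm q = 1"
      using l(1) by (auto simp: points_taut)
    moreover obtain w where "l' = taut_class q w"
      using taut_fibre_E[OF l(2) _ q(2)] eq q(1) by auto
    ultimately show "l = l'"
      using eq unit_nonzero[OF q(2)] by simp
  qed
qed

text \<open>A chart change is that of the base, paired with multiplication of the fibre coordinate
  by the phase of <j, i + x>.\<close>

lemma smooth_manifold_taut: "smooth_manifold taut_bundle"
  unfolding smooth_manifold_def
proof (intro conjI ballI Hausdorff_taut)
  show "(\<Union>i\<in>mix taut_bundle. mdom taut_bundle i) = points (taut_bundle :: (('a \<times> complex) set, _, _) mfd)"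
  proof (intro equalityI subsetI)
    fix l :: "('a \<times> complex) set"
    assume l: "l \<in> points taut_bundle"
    then obtain i where "i \<in> mix proj_mfd" "taut_proj l \<in> mdom proj_mfd i"
      using taut_proj_points[OF l] unfolding proj.mdom_covers[symmetric] by blast
    with l show "l \<in> (\<Union>i\<in>mix taut_bundle. mdom taut_bundle i)"
      by (auto simp: mdom_taut)
  qed (auto simp: mdom_taut)
  fix i j :: 'a
  assume "i \<in> mix taut_bundle"
  then have i: "hnorm i = 1"
    by simp
  show "openin (mtop taut_bundle) (mdom taut_bundle i)"
    by (rule openin_mdom_taut[OF i])
  show sub: "subspace (mmodel taut_bundle i)"
    unfolding mmodel_taut by (intro subspace_Times proj.subspace_mmodel subspace_UNIV)
  show "openin (top_of_set (mmodel taut_bundle i)) (mchart taut_bundle i ` mdom taut_bundle i)"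
    by (simp add: mchart_taut_image[OF i])
  show "homeomorphic_map (subtopology (mtop taut_bundle) (mdom taut_bundle i))
      (top_of_set (mchart taut_bundle i ` mdom taut_bundle i)) (mchart taut_bundle i)"
    by (rule homeomorphic_map_mchart_taut[OF i])
  assume "j \<in> mix taut_bundle"
  then have j: "hnorm j = 1"
    by simp
  define U where "U = {x. cinner i x = 0 \<and> cinner j (i + x) \<in> - {0}} \<times> (UNIV :: complex set)"
  have inj: "inj_on (mchart taut_bundle i) (mdom taut_bundle i)"
    by (rule inj_on_inverseI[where g = "\<lambda>(x, c). taut_class (nrm (i + x)) c"])
       (auto simp: taut_class_mem i elim!: mdom_taut_E[OF _ i])
  have mem: "taut_class (nrm (i + x)) c \<in> mdom taut_bundle j \<longleftrightarrow> cinner j (i + x) \<noteq> 0"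
    if "cinner i x = 0" for x c
  proof -
    have nz: "i + x \<noteq> 0"
      by (rule proj.translate_nonzero[OF i that])
    show ?thesis
      using sgn_cinner_nrm[OF nz, of j] by (auto simp: taut_class_mdom[OF j hnorm_nrm[OF nz]] sgn_zero_iff)
  qed
  have eq: "mchart taut_bundle i ` (mdom taut_bundle i \<inter> mdom taut_bundle j) = U"
  proof (intro equalityI subsetI)
    fix y
    assume "y \<in> mchart taut_bundle i ` (mdom taut_bundle i \<inter> mdom taut_bundle j)"
    then obtain l where l: "l \<in> mdom taut_bundle i" "l \<in> mdom taut_bundle j" "y = mchart taut_bundle i l"
      by auto
    obtain x c where "cinner i x = 0" "l = taut_class (nrm (i + x)) c"
      using mdom_taut_E[OF l(1) i] .
    then show "y \<in> U"
      using l i mem by (simp add: U_def taut_class_mem)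
  next
    fix y
    assume "y \<in> U"
    then have y: "cinner i (fst y) = 0" "cinner j (i + fst y) \<noteq> 0"
      by (auto simp: U_def)
    then have "y = mchart taut_bundle i (taut_class (nrm (i + fst y)) (snd y))"
      using i by (simp add: taut_class_mem)
    moreover have "taut_class (nrm (i + fst y)) (snd y) \<in> mdom taut_bundle i \<inter> mdom taut_bundle j"
      using i y mem[OF y(1)] by (simp add: taut_class_mem)
    ultimately show "y \<in> mchart taut_bundle i ` (mdom taut_bundle i \<inter> mdom taut_bundle j)"
      by (rule image_eqI)
  qed
  have "smooth_on (mmodel taut_bundle i) U (mchart taut_bundle j \<circ> param taut_bundle i)"
  proof (rule smooth_on_if_Cn_on[OF _ sub])
    show "openin (top_of_set (mmodel taut_bundle i)) U"
      unfolding mmodel_taut U_def by (intro openin_Times proj.openin_transition_dom) simp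
    show "Cn_on n (mmodel taut_bundle i) U
        (\<lambda>x h. (qmap (cinner j) j (i + fst x), sgn (cinner j (i + fst x)) * snd x))" for n
      by (intro Cn_on_qmap lc_linear_cinner Cn_on_intros) (auto simp: U_def)
    fix y
    assume "y \<in> U"
    then have y: "cinner i (fst y) = 0" "cinner j (i + fst y) \<noteq> 0"
      by (auto simp: U_def)
    have nz: "i + fst y \<noteq> 0"
      by (rule proj.translate_nonzero[OF i y(1)])
    have "param taut_bundle i y = taut_class (nrm (i + fst y)) (snd y)"
      unfolding param_def using i y
      by (intro inv_into_f_eq[OF inj]) (simp_all add: taut_class_mem)
    then show "(mchart taut_bundle j \<circ> param taut_bundle i) y =
        (qmap (cinner j) j (i + fst y), sgn (cinner j (i + fst y)) * snd y)"
      using nz y j proj.mchart_X[of j "i + fst y"] by (simp add: mchart_taut cline_nrm sgn_cinner_nrm)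
  qed
  then show "smooth_on (mmodel taut_bundle i) (mchart taut_bundle i ` (mdom taut_bundle i \<inter> mdom taut_bundle j))
      (mchart taut_bundle j \<circ> param taut_bundle i)"
    unfolding eq .
qed

lemmas open_charts_taut = open_charts_smooth_manifold[OF smooth_manifold_taut]

lemma smooth_map_taut_proj:
  "smooth_map taut_bundle proj_mfd (taut_proj :: ('v::hermitian_lc_space \<times> complex) set \<Rightarrow> 'v set)"
proof (rule smooth_mapI[OF open_charts_taut open_charts_proj continuous_map_taut_proj,
      where V = "\<lambda>i j. {x. cinner j (i + fst x) \<noteq> 0}" and f = "\<lambda>i j x. qmap (cinner j) j (i + fst x)"],
    goal_cases)
  case (1 i j n)
  show ?case
    by (intro Cn_on_qmap lc_linear_cinner Cn_on_intros) simp
next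
  case (2 i j l)
  then have ij: "hnorm i = 1" "hnorm j = 1"
    by auto
  obtain x c where x: "cinner i x = 0" "l = taut_class (nrm (i + x)) c"
    using mdom_taut_E[OF 2(3) ij(1)] .
  have "i + x \<noteq> 0"
    by (rule proj.translate_nonzero[OF ij(1) x(1)])
  then show ?case
    using 2(4) x ij proj.cl_mdom[of j "i + x"] proj.mchart_X[of j "i + x"]
    by (simp add: taut_class_mem cline_nrm)
qed

section \<open>Local triviality of the line bundle\<close>

lemma diffeomorphism_taut_triv:
  fixes i :: "'v::hermitian_lc_space"
  assumes i: "hnorm i = 1"
  shows "diffeomorphism (open_submfd taut_bundle {l \<in> points taut_bundle. taut_proj l \<in> mdom proj_mfd i})
    (prod_mfd (open_submfd proj_mfd (mdom proj_mfd i)) complex_plane)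
    (\<lambda>l. (taut_proj l, snd (mchart taut_bundle i l)))"
    (is "diffeomorphism ?L ?B ?F")
proof -
  have L_eq: "?L = open_submfd taut_bundle (mdom taut_bundle i)"
    by (simp add: mdom_taut)
  have L: "open_charts ?L"
    unfolding L_eq by (intro open_charts_open_submfd open_charts_taut openin_mdom_taut i)
  have B: "open_charts ?B"
    using i by (intro open_charts_prod_mfd open_charts_open_submfd open_charts_proj
        open_charts_complex_plane proj.openin_mdom)
  have chart: "continuous_map (subtopology (mtop taut_bundle) (mdom taut_bundle i)) euclidean (mchart taut_bundle i)"
    using homeomorphic_imp_continuous_map[OF homeomorphic_map_mchart_taut[OF i]]
    by (simp add: continuous_map_in_subtopology)
  have F: "continuous_map (mtop ?L) (mtop ?B) ?F"
  proof -
    have "continuous_map (subtopology (mtop taut_bundle) (mdom taut_bundle i)) euclidean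
        (snd \<circ> mchart taut_bundle i)"
      by (rule continuous_map_compose[OF chart]) (auto intro!: continuous_intros)
    moreover have "continuous_map (subtopology (mtop taut_bundle) (mdom taut_bundle i))
        (subtopology (mtop proj_mfd) (mdom proj_mfd i)) taut_proj"
      using continuous_map_from_subtopology[OF continuous_map_taut_proj]
      by (auto simp: continuous_map_in_subtopology mdom_taut)
    ultimately show ?thesis
      unfolding L_eq by (auto simp: o_def intro: continuous_map_pairedI)
  qed
  let ?G = "\<lambda>(p, c). taut_class (nrm (i + mchart proj_mfd i p)) c"
  have FG: "?F (?G pc) = pc" if pc0: "pc \<in> points ?B" for pc
  proof -
    obtain p c where pc: "pc = (p, c)" "p \<in> mdom proj_mfd i"
      using pc0 by (cases pc) auto
    obtain x where x: "cinner i x = 0" "p = cline (i + x)"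
      using proj.mdom_E[OF pc(2) i] .
    then show ?thesis
      using i pc proj.translate_nonzero[OF i x(1)]
      by (simp add: proj.mchart_translate cline_nrm taut_class_mem)
  qed
  have GF: "?G (?F l) = l" if l0: "l \<in> points ?L" for l
  proof -
    have "l \<in> mdom taut_bundle i"
      using l0 by (simp add: mdom_taut)
    then obtain x c where x: "cinner i x = 0" "l = taut_class (nrm (i + x)) c"
      using mdom_taut_E i by blast
    then show ?thesis
      using i proj.translate_nonzero[OF i x(1)]
      by (simp add: proj.mchart_translate cline_nrm taut_class_mem)
  qed
  have "smooth_map ?L ?B ?F"
  proof (rule smooth_mapI[OF L B F,
        where V = "\<lambda>k j. {y. cinner (fst j) (k + fst y) \<noteq> 0 \<and> cinner i (k + fst y) \<noteq> 0}"
          and f = "\<lambda>k j y. (qmap (cinner (fst j)) (fst j) (k + fst y), sgn (cinner i (k + fst y)) * snd y)"],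
      goal_cases)
    case (1 k j n)
    show ?case
      by (intro Cn_on_qmap lc_linear_cinner Cn_on_intros) auto
  next
    case (2 k jz l)
    obtain j where jz: "jz = (j, ())" "hnorm j = 1" and k: "hnorm k = 1"
      using 2 by (cases jz) auto
    obtain x c where x: "cinner k x = 0" "l = taut_class (nrm (k + x)) c"
      using 2(3) mdom_taut_E[of l k] k by auto
    have "k + x \<noteq> 0"
      by (rule proj.translate_nonzero[OF k x(1)])
    then show ?case
      using 2(4) x k i jz proj.cl_mdom[of j "k + x"] proj.cl_mdom[of i "k + x"] proj.mchart_X[of j "k + x"]
      by (simp add: mchart_taut cline_nrm sgn_cinner_nrm proj.mchart_translate proj.L_translate)
  qed
  moreover have "smooth_map ?B ?L ?G"
  proof (rule smooth_mapI[OF B L,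
        where V = "\<lambda>j k. {y. cinner k (fst j + fst y) \<noteq> 0 \<and> cinner i (fst j + fst y) \<noteq> 0}"
          and f = "\<lambda>j k y. (qmap (cinner k) k (fst j + fst y),
            sgn (cinner k (fst j + fst y) * inverse (cinner i (fst j + fst y))) * snd y)"], goal_cases)
    case 1
    have "continuous_map (mtop ?B) (prod_topology (top_of_set (mmodel proj_mfd i)) euclidean)
        (\<lambda>(p, c). (mchart proj_mfd i p, c))"
      unfolding mtop_prod_mfd mtop_open_submfd complex_plane_simps
      by (subst continuous_map_prod_top) (simp add: proj.continuous_map_mchart[OF i])
    moreover have "continuous_map (prod_topology (top_of_set (mmodel proj_mfd i)) euclidean)
        (top_of_set ({\<psi>. hnorm \<psi> = 1} \<times> UNIV)) (\<lambda>(x, c). (nrm (i + x), c :: complex))"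
    proof -
      have "continuous_on (mmodel proj_mfd i \<times> (UNIV :: complex set)) (\<lambda>x. (nrm (i + fst x), snd x))"
        using proj.translate_nonzero[OF i] by (intro continuous_intros) (auto simp: proj.mmodel_X)
      then show ?thesis
        using prod_topology_top_of_set[of "mmodel proj_mfd i" "UNIV :: complex set"]
          proj.translate_nonzero[OF i]
        by (auto simp: continuous_map_top_of_set case_prod_beta hnorm_nrm proj.mmodel_X)
    qed
    ultimately have "continuous_map (mtop ?B) (top_of_set ({\<psi>. hnorm \<psi> = 1} \<times> UNIV))
        ((\<lambda>(x, c). (nrm (i + x), c)) \<circ> (\<lambda>(p, c). (mchart proj_mfd i p, c)))"
      by (rule continuous_map_compose)
    from continuous_map_compose[OF this continuous_map_taut_class]
    have "continuous_map (mtop ?B) (mtop taut_bundle) ((\<lambda>(q, z). taut_class q z) \<circ>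
        ((\<lambda>(x, c). (nrm (i + x), c)) \<circ> (\<lambda>(p, c). (mchart proj_mfd i p, c))))" .
    moreover have "(\<lambda>(q, z). taut_class q z) \<circ>
        ((\<lambda>(x, c). (nrm (i + x), c)) \<circ> (\<lambda>(p, c). (mchart proj_mfd i p, c))) = ?G"
      by (simp add: fun_eq_iff)
    ultimately have "continuous_map (mtop ?B) (mtop taut_bundle) ?G"
      by (simp only:)
    moreover have "?G pc \<in> mdom taut_bundle i" if pc0: "pc \<in> topspace (mtop ?B)" for pc
    proof -
      obtain p c where pc: "pc = (p, c)" "p \<in> mdom proj_mfd i"
        using pc0 by (cases pc) auto
      obtain x where x: "cinner i x = 0" "p = cline (i + x)"
        using proj.mdom_E[OF pc(2) i] .
      then show ?thesis
        using i pc by (simp add: proj.mchart_translate taut_class_mem)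
    qed
    ultimately show ?case
      unfolding L_eq by (simp add: continuous_map_in_subtopology image_subset_iff)
  next
    case (2 j k n)
    show ?case
      by (intro Cn_on_qmap lc_linear_cinner Cn_on_intros) auto
  next
    case (3 jz k pc)
    obtain j where jz: "jz = (j, ())" "hnorm j = 1" and k: "hnorm k = 1"
      using 3 by (cases jz) auto
    obtain p c where pc: "pc = (p, c)" "p \<in> mdom proj_mfd j" "p \<in> mdom proj_mfd i"
      using 3(3) jz(1) by (cases pc) auto
    obtain x where x: "cinner j x = 0" "p = cline (j + x)"
      using proj.mdom_E[OF pc(2) jz(2)] .
    have nz: "j + x \<noteq> 0" "cinner i (j + x) \<noteq> 0"
      using proj.translate_nonzero[OF jz(2) x(1)] proj.cl_mdom[OF i, of "j + x"] pc(3) x(2) by auto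
    \<comment> \<open>The unit vectors that the charts i and j attach to the same line differ by
      this phase, which \<open>taut_class_phase\<close> moves into the fibre coordinate.\<close>
    have "nrm (i + mchart proj_mfd i p) = sgn (inverse (cinner i (j + x))) *\<^sub>C nrm (j + x)"
      using x(2) nz i proj.mchart_X[of i "j + x"] by (simp add: proj.translate_qmap nrm_scaleC)
    moreover have "cmod (sgn (inverse (cinner i (j + x)))) = 1"
      using nz(2) by (simp add: norm_sgn norm_inverse)
    ultimately have G: "?G pc = taut_class (nrm (j + x)) (sgn (inverse (cinner i (j + x))) * c)"
      unfolding pc(1) by (simp add: taut_class_phase)
    then have "cinner k (nrm (j + x)) \<noteq> 0"
      using 3(4) taut_class_mdom[OF k hnorm_nrm[OF nz(1)]] by simp
    then have "cinner k (j + x) \<noteq> 0"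
      using sgn_cinner_nrm[OF nz(1), of k] by (auto simp: sgn_zero_iff)
    then show ?case
      unfolding G using pc x jz nz k proj.mchart_X[of k "j + x"]
      by (simp add: proj.mchart_translate mchart_taut cline_nrm sgn_cinner_nrm sgn_mult)
  qed
  ultimately show ?thesis
    unfolding diffeomorphism_def using GF FG by blast
qed

lemma taut_add_scale_points:
  assumes l: "l \<in> points taut_bundle"
  shows "l' \<in> points taut_bundle \<Longrightarrow> taut_proj l' = taut_proj l \<Longrightarrow>
      assoc_add scaleC l l' \<in> points taut_bundle \<and> taut_proj (assoc_add scaleC l l') = taut_proj l"
    and "assoc_scale scaleC c l \<in> points taut_bundle \<and> taut_proj (assoc_scale scaleC c l) = taut_proj l"
proof -
  obtain q z where q: "l = taut_class q z" "hnorm q = 1"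
    using l by (auto simp: points_taut)
  show "assoc_scale scaleC c l \<in> points taut_bundle \<and> taut_proj (assoc_scale scaleC c l) = taut_proj l"
    using q by (simp add: taut_class_points)
  assume l': "l' \<in> points taut_bundle" "taut_proj l' = taut_proj l"
  then obtain w where "l' = taut_class q w"
    using taut_fibre_E[OF l'(1) _ q(2)] q(1) by auto
  then show "assoc_add scaleC l l' \<in> points taut_bundle \<and> taut_proj (assoc_add scaleC l l') = taut_proj l"
    using q unit_nonzero[OF q(2)] by (simp add: taut_class_points)
qed

lemma complex_line_bundle_taut:
  "complex_line_bundle (proj_mfd :: ('v::hermitian_lc_space set, 'v, 'v) mfd) taut_bundle taut_proj
     (assoc_add scaleC) (assoc_scale scaleC)"
  unfolding complex_line_bundle_def
proof (intro conjI ballI allI impI smooth_manifold_proj smooth_manifold_taut smooth_map_taut_proj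
    taut_add_scale_points[THEN conjunct1] taut_add_scale_points[THEN conjunct2])
  fix p :: "'v set"
  assume "p \<in> points proj_mfd"
  then obtain i where i: "hnorm i = 1" "p \<in> mdom proj_mfd i"
    unfolding proj.mdom_covers[symmetric] by auto
  show "\<exists>W \<Phi>. openin (mtop proj_mfd) W \<and> p \<in> W \<and>
        diffeomorphism (open_submfd taut_bundle {l \<in> points taut_bundle. taut_proj l \<in> W})
          (prod_mfd (open_submfd proj_mfd W) complex_plane) \<Phi> \<and>
        (\<forall>l\<in>points taut_bundle. taut_proj l \<in> W \<longrightarrow>
           fst (\<Phi> l) = taut_proj l \<and>
           (\<forall>l'\<in>points taut_bundle. taut_proj l' = taut_proj l \<longrightarrow>
              snd (\<Phi> (assoc_add scaleC l l')) = snd (\<Phi> l) + snd (\<Phi> l')) \<and>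
           (\<forall>c. snd (\<Phi> (assoc_scale scaleC c l)) = c * snd (\<Phi> l)))"
  proof (intro exI conjI ballI allI impI)
    show "openin (mtop proj_mfd) (mdom proj_mfd i)" "p \<in> mdom proj_mfd i"
      using i proj.openin_mdom by auto
    show "diffeomorphism (open_submfd taut_bundle {l \<in> points taut_bundle. taut_proj l \<in> mdom proj_mfd i})
          (prod_mfd (open_submfd proj_mfd (mdom proj_mfd i)) complex_plane)
          (\<lambda>l. (taut_proj l, snd (mchart taut_bundle i l)))"
      by (rule diffeomorphism_taut_triv[OF i(1)])
    fix l :: "('v \<times> complex) set"
    assume l: "l \<in> points taut_bundle"
    then obtain q z where q: "l = taut_class q z" "hnorm q = 1"
      by (auto simp: points_taut)
    show "fst (taut_proj l, snd (mchart taut_bundle i l)) = taut_proj l"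
      by simp
    show "snd (taut_proj (assoc_scale scaleC c l), snd (mchart taut_bundle i (assoc_scale scaleC c l))) =
        c * snd (taut_proj l, snd (mchart taut_bundle i l))" for c
      using q by (simp add: mchart_taut)
    fix l' :: "('v \<times> complex) set"
    assume l': "l' \<in> points taut_bundle" "taut_proj l' = taut_proj l"
    then obtain w where "l' = taut_class q w"
      using taut_fibre_E[OF l'(1) _ q(2)] q(1) by auto
    then show "snd (taut_proj (assoc_add scaleC l l'), snd (mchart taut_bundle i (assoc_add scaleC l l'))) =
        snd (taut_proj l, snd (mchart taut_bundle i l)) + snd (taut_proj l', snd (mchart taut_bundle i l'))"
      using q unit_nonzero[OF q(2)] by (simp add: mchart_taut distrib_left)
  qed
qed

section \<open>Linear identification of the fibres with the lines themselves\<close>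

lemma bij_betw_taut_vector:
  assumes "p \<in> points proj_mfd"
  shows "bij_betw taut_vector {l \<in> points taut_bundle. taut_proj l = p} p"
proof -
  obtain q where q: "hnorm q = 1" "p = cline q"
    using points_proj_E[OF assms] .
  have eq: "{l \<in> points taut_bundle. taut_proj l = p} = range (taut_class q)"
    using q by (auto simp: taut_class_points elim: taut_fibre_E)
  have "inj_on taut_vector (range (taut_class q))"
    using unit_nonzero[OF q(1)] by (auto simp: inj_on_def)
  moreover have "taut_vector ` range (taut_class q) = p"
    by (auto simp: q cline_def image_image)
  ultimately show ?thesis
    by (simp add: bij_betw_def eq)
qed

lemma taut_vector_add:
  assumes "l \<in> points taut_bundle" "l' \<in> points taut_bundle" "taut_proj l' = taut_proj l"
  shows "taut_vector (assoc_add scaleC l l') = taut_vector l + taut_vector l'"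
proof -
  obtain q z where q: "l = taut_class q z" "hnorm q = 1"
    using assms(1) by (auto simp: points_taut)
  then obtain w where "l' = taut_class q w"
    using taut_fibre_E[OF assms(2) _ q(2)] q(1) assms(3) by auto
  then show ?thesis
    using q unit_nonzero[OF q(2)] by (simp add: scaleC_add_left)
qed

lemma taut_vector_scale:
  assumes "l \<in> points taut_bundle"
  shows "taut_vector (assoc_scale scaleC c l) = c *\<^sub>C taut_vector l"
  using assms by (auto simp: points_taut)


section \<open>The connection of the tautological line bundle\<close>

text \<open>Literally the choice made inside \<open>assoc_connection\<close>, so that unfolding the
  connection produces this vector.\<close>

definition unit_rep :: "'v::hermitian_lc_space set \<Rightarrow> 'v" where
  "unit_rep p = (SOME q. q \<in> points sphere_mfd \<and> cline q = p)"

lemma unit_rep: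
  assumes "p \<in> points proj_mfd"
  shows "hnorm (unit_rep p) = 1" "cline (unit_rep p) = p"
proof -
  obtain q where "hnorm q = 1" "p = cline q"
    using points_proj_E[OF assms] .
  then have "q \<in> points sphere_mfd \<and> cline q = p"
    by (simp add: points_sphere)
  then have "unit_rep p \<in> points sphere_mfd \<and> cline (unit_rep p) = p"
    unfolding unit_rep_def by (rule someI)
  then show "hnorm (unit_rep p) = 1" "cline (unit_rep p) = p"
    by (simp_all add: points_sphere)
qed

text \<open><q, \<xi> q> = 0 says at once that the vector is tangent to the sphere (real part) and
  horizontal (imaginary part). Conversely, tangency and \<open>sphere_alpha q \<zeta> = 0\<close>
  force the full scalar product to vanish, which gives uniqueness.\<close>

lemma horizontal_lift_sphere:
  assumes q: "hnorm q = 1" and \<xi>: "\<xi> \<in> tangent_space proj_mfd (cline q)"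
  shows "horizontal_lift sphere_mfd proj_mfd cline sphere_alpha q \<xi> = sph.tangent q (\<xi> q)"
  unfolding horizontal_lift_def
proof (rule the_equality)
  note \<xi>' = proj.tangent_space_E[OF \<xi> q]
  have "sph.tangent q (\<xi> q) \<in> tangent_space sphere_mfd q"
    using sph.tangent_mem[OF unit_nonzero[OF q]] by (simp add: nrm_unit q)
  moreover have "tangent_map sphere_mfd proj_mfd cline q (sph.tangent q (\<xi> q)) = \<xi>"
    using \<xi>'(1) by (simp add: tangent_map_cline q)
  moreover have "sphere_alpha q (sph.tangent q (\<xi> q)) = 0"
    using \<xi>'(2) by (simp add: sphere_alpha_unit q)
  ultimately show "sph.tangent q (\<xi> q) \<in> tangent_space sphere_mfd q \<and>
      tangent_map sphere_mfd proj_mfd cline q (sph.tangent q (\<xi> q)) = \<xi> \<and>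
      sphere_alpha q (sph.tangent q (\<xi> q)) = 0"
    by blast
next
  fix \<zeta>
  assume \<zeta>: "\<zeta> \<in> tangent_space sphere_mfd q \<and>
      tangent_map sphere_mfd proj_mfd cline q \<zeta> = \<xi> \<and> sphere_alpha q \<zeta> = 0"
  then have \<zeta>': "\<zeta> = sph.tangent q (\<zeta> q)" "rinner q (\<zeta> q) = 0"
    using sphere_tangent_E[OF q] by blast+
  then have "Im (cinner q (\<zeta> q)) = 0"
    using \<zeta> sphere_alpha_unit[OF q, of "\<zeta> q"] by simp
  then have 0: "cinner q (\<zeta> q) = 0"
    using \<zeta>'(2) by (simp add: rinner_def complex_eq_iff)
  have "\<xi> = proj.tangent q (\<zeta> q)"
    using \<zeta> \<zeta>'(1) tangent_map_cline[OF q, of "\<zeta> q"] by simp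
  then have "\<xi> q = \<zeta> q"
    using proj.tangent_self[OF q 0] by simp
  then show "\<zeta> = sph.tangent q (\<xi> q)"
    using \<zeta>'(1) by simp
qed

lemma (in qcharts) open_cl_vimage:
  assumes "openin (mtop X) W"
  shows "open {y. y \<noteq> 0 \<and> cl y \<in> W}"
proof -
  have "openin (top_of_set (- {0})) {x \<in> - {0}. cl x \<in> W}"
    using assms by (simp add: top_X openin_quotient_topology)
  moreover have "open (- {0::'v})"
    by (simp add: open_Compl)
  ultimately show ?thesis
    using openin_open_trans by (simp add: conj_commute)
qed

section \<open>Sections and their representatives in the trivialisation of q\<close>

definition section_rep :: "('v::hermitian_lc_space set \<Rightarrow> ('v \<times> complex) set) \<Rightarrow> 'v \<Rightarrow> 'v \<Rightarrow> complex" where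
  "section_rep s q x = snd (mchart taut_bundle q (s (cline (q + x))))"

text \<open>Sections over an open set without any regularity. Sums and multiples of sections, and
  maps that agree with a section on W, qualify at once; their differentiability enters only at one
  point, through \<open>has_hderiv\<close>.\<close>

definition section_on :: "'v::hermitian_lc_space set set \<Rightarrow> ('v set \<Rightarrow> ('v \<times> complex) set) \<Rightarrow> bool" where
  "section_on W s \<longleftrightarrow> openin (mtop proj_mfd) W \<and> (\<forall>p\<in>W. s p \<in> points taut_bundle \<and> taut_proj (s p) = p)"

abbreviation (input) rep_dom :: "'v::hermitian_lc_space set set \<Rightarrow> 'v \<Rightarrow> 'v set" where
  "rep_dom W q \<equiv> {x. cinner q x = 0 \<and> cline (q + x) \<in> W}"

lemma section_on_points: "section_on W s \<Longrightarrow> p \<in> W \<Longrightarrow> p \<in> points proj_mfd"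
  unfolding section_on_def using openin_subset by blast

lemma section_on_equivariant:
  assumes "section_on W s" "hnorm q = 1" "cline q \<in> W"
  shows "s (cline q) = taut_class q (equivariant_fun cline s q)"
proof -
  obtain z where z: "s (cline q) = taut_class q z"
    using assms taut_fibre_E[of "s (cline q)" q] by (auto simp: section_on_def)
  then have "equivariant_fun cline s q = z"
    using mem_taut_class_self[OF unit_nonzero[OF assms(2)]] by (simp add: equivariant_fun_def)
  then show ?thesis
    using z by simp
qed

text \<open>The chart at q multiplies the fibre coordinate over the unit vector \<open>nrm y\<close>
  by the phase of <q, y>; its conjugate undoes this and leaves the equivariant function.\<close>

lemma equivariant_fun_section_rep:
  assumes s: "section_on W s" and q: "hnorm q = 1" and y: "y \<noteq> 0" "cinner q y \<noteq> 0" "cline y \<in> W"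
  shows "equivariant_fun cline s (nrm y) = cnj (sgn (cinner q y)) * section_rep s q (qmap (cinner q) q y)"
proof -
  have "cline (q + qmap (cinner q) q y) = cline (nrm y)"
    using y proj.cl_translate_qmap[of q y] by (simp add: cline_nrm)
  moreover have "s (cline (nrm y)) = taut_class (nrm y) (equivariant_fun cline s (nrm y))"
    using y by (intro section_on_equivariant[OF s]) (simp_all add: hnorm_nrm cline_nrm)
  ultimately have "section_rep s q (qmap (cinner q) q y) =
      sgn (cinner q y) * equivariant_fun cline s (nrm y)"
    using y(1) by (simp add: section_rep_def mchart_taut sgn_cinner_nrm)
  moreover have "cnj (sgn (cinner q y)) * sgn (cinner q y) = 1"
    using y(2) complex_norm_square[of "sgn (cinner q y)"] by (simp add: norm_sgn mult.commute)
  ultimately show ?thesis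
    by (simp add: mult.assoc[symmetric])
qed

text \<open>Along horizontal curves the trivialisation \<open>sgn \<langle>q, \<cdot>\<rangle>\<close> is stationary at \<open>q\<close>, so that the
  covariant derivative is the plain derivative of the representative with respect to \<open>q\<close>.\<close>

lemma taut_connection_eq:
  assumes s: "section_on W s" and p: "p \<in> W" and \<xi>: "\<xi> \<in> tangent_space proj_mfd p"
    and q: "q = unit_rep p"
    and D: "has_hderiv (mmodel proj_mfd q) (rep_dom W q) (section_rep s q) 0 D"
  shows "taut_connection s p \<xi> = taut_class q (D (\<xi> q))"
proof -
  have hq: "hnorm q = 1" and cq: "cline q = p"
    using unit_rep[OF section_on_points[OF s p]] q by auto
  have nz: "q \<noteq> 0" and nq: "nrm q = q"
    using hq unit_nonzero nrm_unit by auto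
  define z where "z = \<xi> q"
  have z: "cinner q z = 0"
    using proj.tangent_space_E(2)[of \<xi> q] \<xi> hq cq by (simp add: z_def)
  define f where "f = equivariant_fun cline s"
  define i where "i = chart_at sphere_mfd q"
  have i: "hnorm i = 1" "rinner i q \<in> {c. 0 < Re c}"
    using sph.chart_at[OF nz] by (simp_all only: nq i_def)
  define r where "r = Re (cinner i q)"
  have r: "0 < r" "rinner i q = complex_of_real r"
    using i(2) by (simp_all add: r_def rinner_def)
  \<comment> \<open>x and w are the lifts of the base point and of the direction in the chart i, the
    one that \<open>fun_deriv\<close> selects and that need not be centred at q.\<close>
  define x where "x = inverse (rinner i q) *\<^sub>C q"
  define w where "w = dq (rinner i) q z"
  have qx: "cinner q x = complex_of_real (inverse r)"
    using hq r by (simp add: x_def cinner_simps cinner_unit)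
  \<comment> \<open>Since <q, z> = 0, only a real multiple of q contributes to <q, w>. This makes
    the phase of <q, .> stationary along x + t w.\<close>
  have qw: "Im (cinner q w) = 0"
    using hq z r by (simp add: w_def dq_def cinner_simps cinner_unit rinner_def)
  define S where "S = {y. y \<noteq> 0 \<and> cline y \<in> W} \<inter> {y. cinner q y \<noteq> 0}"
  have oS: "open S"
    unfolding S_def using s
    by (intro open_Int proj.open_cl_vimage open_Collect_neq continuous_intros) (simp add: section_on_def)
  have xS: "x \<in> S"
    using r nz qx p by (simp add: S_def x_def cline_scale cq)
  \<comment> \<open>The straight line of the chart i, seen in the chart at q. It starts at 0 with
    velocity z but is curved in general, which is why the derivative D has to be of Hadamard
    type.\<close>
  define \<gamma> where "\<gamma> t = qmap (cinner q) q (x + t *\<^sub>R w)" for t :: real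
  have line: "has_dirderiv (\<lambda>t. x + t *\<^sub>R w) (0::real) 1 w"
    using has_dirderiv_curve[of "\<lambda>y. y" x w w] has_dirderiv_ident[of x w] by simp
  have "((\<lambda>t. x + t *\<^sub>R w) \<longlongrightarrow> x) (at 0)"
    using has_dirderiv_curve_tendsto[OF line] by simp
  then have ev: "\<forall>\<^sub>F t in at 0. x + t *\<^sub>R w \<in> S"
    using oS xS by (rule topological_tendstoD)
  have \<gamma>: "has_dirderiv \<gamma> 0 1 z"
  proof -
    have "has_dirderiv \<gamma> 0 1 (dq (cinner q) x w)"
      unfolding \<gamma>_def using has_dirderiv_qmap[OF lc_linear_cinner line, of q q] xS by (simp add: S_def)
    moreover have "dq (cinner q) x w = dq (cinner q) q z"
      unfolding x_def w_def using r hq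
      by (intro dq_chain lc_linear_cinner) (simp_all add: cinner_simps cinner_unit)
    moreover have "dq (cinner q) q z = z"
      using hq z by (simp add: dq_1 cinner_unit)
    ultimately show ?thesis
      by simp
  qed
  have \<gamma>0: "\<gamma> 0 = 0"
    using r by (simp add: \<gamma>_def qmap_def qx) (simp add: x_def)
  have \<gamma>U: "\<forall>\<^sub>F t in at 0. \<gamma> t \<in> rep_dom W q"
    using ev
  proof eventually_elim
    case (elim t)
    then have "cinner q (x + t *\<^sub>R w) \<in> - {0}" "cline (x + t *\<^sub>R w) \<in> W"
      by (simp_all add: S_def)
    then show ?case
      using proj.L_qmap[OF hq, of "x + t *\<^sub>R w"] proj.cl_translate_qmap[of q "x + t *\<^sub>R w"]
      by (simp add: \<gamma>_def)
  qed
  have g: "has_dirderiv (\<lambda>t. section_rep s q (\<gamma> t)) 0 1 (D z)"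
    by (rule has_hderivD[OF D \<gamma>0 _ \<gamma>U \<gamma>]) (simp add: proj.mmodel_X z)
  have "has_dirderiv (\<lambda>t. cnj (sgn (cinner q (x + t *\<^sub>R w)))) (0::real) 1 0"
  proof (rule has_dirderiv_eq[OF cnj.has_dirderiv[OF has_dirderiv_sgn[OF
            cinner.has_dirderiv[OF has_dirderiv_const line]]]])
    show "cinner q (x + 0 *\<^sub>R w) \<noteq> 0"
      using r by (simp add: qx)
    have "Im (cinner q w * complex_of_real r) = 0"
      using qw by simp
    then show "cnj (sgn (cinner q (x + 0 *\<^sub>R w)) * (\<i> * complex_of_real
        (Im ((cinner 0 (x + 0 *\<^sub>R w) + cinner q w) * inverse (cinner q (x + 0 *\<^sub>R w)))))) = 0"
      by (simp add: qx)
  qed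
  from cmult.has_dirderiv[OF this g]
  have "has_dirderiv (\<lambda>t. cnj (sgn (cinner q (x + t *\<^sub>R w))) * section_rep s q (\<gamma> t)) 0 1 (D z)"
    using r by (simp add: qx sgn_of_real)
  then have "has_dirderiv (\<lambda>y. cnj (sgn (cinner q y)) * section_rep s q (qmap (cinner q) q y)) x w (D z)"
    unfolding \<gamma>_def by (rule has_dirderiv_curve[THEN iffD1])
  then have "has_dirderiv (f \<circ> param sphere_mfd i) (mchart sphere_mfd i (nrm q)) (dq (rinner i) q z) (D z)"
    unfolding x_def w_def
    by (rule sph.has_dirderiv_param[OF i oS xS[unfolded x_def], rotated])
       (use equivariant_fun_section_rep[OF s hq] in \<open>auto simp: f_def S_def\<close>)
  then have "fun_deriv sphere_mfd f q (sph.tangent q z) = D z"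
    using i has_dirderiv_imp unfolding fun_deriv_def i_def[symmetric] Let_def
    by (simp add: nq sph.tangent_def)
  then show ?thesis
    using horizontal_lift_sphere[OF hq, of \<xi>] \<xi> cq
    unfolding taut_connection_def assoc_connection_def Let_def unit_rep_def[symmetric] q[symmetric]
    by (simp add: f_def z_def)
qed

lemma section_on_if_smooth_section:
  assumes "smooth_section proj_mfd taut_bundle taut_proj W s"
  shows "section_on W s"
proof -
  have W: "openin (mtop proj_mfd) W" and s: "smooth_map (open_submfd proj_mfd W) taut_bundle s"
    and pr: "\<forall>p\<in>W. taut_proj (s p) = p"
    using assms by (auto simp: smooth_section_def)
  have "continuous_map (subtopology (mtop proj_mfd) W) (mtop taut_bundle) s"
    using s by (simp add: smooth_map_def)
  moreover have "topspace (subtopology (mtop proj_mfd) W) = W"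
    using openin_subset[OF W] by auto
  ultimately have "s ` W \<subseteq> points taut_bundle"
    using continuous_map_image_subset_topspace by metis
  then show ?thesis
    using W pr by (auto simp: section_on_def)
qed

text \<open>\<open>param\<close> of an open submanifold inverts the chart on a smaller domain only,
  so it has to be related to that of X point by point.\<close>

lemma (in qcharts) param_open_submfd:
  assumes "hnorm i = 1" "L i x = 0" "cl (i + x) \<in> W"
  shows "param (open_submfd X W) i x = cl (i + x)"
proof -
  have "inj_on (mchart X i) (mdom X i \<inter> W)"
    using inj_mchart[OF assms(1)] by (rule inj_on_subset) auto
  then show ?thesis
    unfolding param_def
    using assms by (intro inv_into_f_eq) (simp_all add: translate_mdom mchart_translate)
qed

lemma C1_on_section_rep:
  assumes s: "smooth_section proj_mfd taut_bundle taut_proj W s" and q: "hnorm q = 1"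
  shows "C1_on (mmodel proj_mfd q) (rep_dom W q) (section_rep s q)"
proof -
  let ?g = "mchart taut_bundle q \<circ> s \<circ> param (open_submfd proj_mfd W) q"
  have sm: "smooth_map (open_submfd proj_mfd W) taut_bundle s"
    using s by (simp add: smooth_section_def)
  note sec = section_on_if_smooth_section[OF s, unfolded section_on_def]
  have "smooth_on (mmodel proj_mfd q) (mchart proj_mfd q ` (mdom proj_mfd q \<inter> (W \<inter> s -` mdom taut_bundle q))) ?g"
    using sm q unfolding smooth_map_def by (simp add: Int_assoc)
  moreover have "mchart proj_mfd q ` (mdom proj_mfd q \<inter> (W \<inter> s -` mdom taut_bundle q)) = rep_dom W q"
    unfolding proj.mchart_image_Int[OF q] using sec proj.translate_mdom[OF q]
    by (auto simp: mdom_taut)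
  ultimately have "C1_on (mmodel proj_mfd q) (rep_dom W q) ?g"
    by (simp add: C1_on_if_smooth_on)
  from snd.C1_on[OF this] show ?thesis
    by (rule C1_on_eq[OF _ proj.subspace_mmodel])
       (simp add: section_rep_def proj.param_open_submfd[OF q])
qed


section \<open>Coordinates and tangent vectors of open submanifolds\<close>

lemma (in qcharts) openin_rep_dom:
  assumes "hnorm i = 1" "openin (mtop X) W"
  shows "openin (top_of_set (mmodel X i)) {x. L i x = 0 \<and> cl (i + x) \<in> W}"
proof -
  have "open ((\<lambda>x. i + x) -` {y. y \<noteq> 0 \<and> cl y \<in> W})"
    by (intro open_vimage open_cl_vimage assms continuous_intros)
  moreover have "{x. L i x = 0 \<and> cl (i + x) \<in> W} =
      mmodel X i \<inter> (\<lambda>x. i + x) -` {y. y \<noteq> 0 \<and> cl y \<in> W}"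
    using translate_nonzero[OF assms(1)] by (auto simp: mmodel_X)
  ultimately show ?thesis
    unfolding openin_open by blast
qed

lemma (in qcharts) dirderiv_param_open_submfd:
  assumes i: "hnorm i = 1" and W: "openin (mtop X) W"
    and x: "L i x = 0" "cl (i + x) \<in> W" and v: "L i v = 0"
  shows "dirderiv (f \<circ> param (open_submfd X W) i) x v = dirderiv (f \<circ> param X i) x v"
proof (rule dirderiv_cong)
  have "\<forall>\<^sub>F t in at 0. x + t *\<^sub>R v \<in> {x. L i x = 0 \<and> cl (i + x) \<in> W}"
    by (rule eventually_at_0_I[OF openin_rep_dom[OF i W] _ subspace_mmodel])
       (use x v in \<open>simp_all add: mmodel_X\<close>)
  then show "\<forall>\<^sub>F t in at 0. (f \<circ> param (open_submfd X W) i) (x + t *\<^sub>R v) = (f \<circ> param X i) (x + t *\<^sub>R v)"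
    by eventually_elim (simp add: param_open_submfd param_translate i)
qed (use i x in \<open>simp add: param_open_submfd param_translate\<close>)

lemma (in qcharts) tangent_vector_open_submfd:
  assumes i: "hnorm i = 1" and W: "openin (mtop X) W"
    and x: "L i x = 0" "cl (i + x) \<in> W" and v: "L i v = 0"
  shows "tangent_vector (open_submfd X W) i (cl (i + x)) v = tangent (i + x) v"
proof -
  have "tangent_vector (open_submfd X W) i (cl (i + x)) v = tangent_vector X i (cl (i + x)) v"
    using x unfolding tangent_vector_def
    by (simp add: mchart_translate[OF i] dirderiv_param_open_submfd[OF assms] cong: if_cong)
  then show ?thesis
    using tangent_vector_eq[OF i x(1) v] by simp
qed

lemma (in qcharts) tangent_space_open_submfd:
  assumes W: "openin (mtop X) W" and p: "p \<in> W"
  shows "tangent_space (open_submfd X W) p = tangent_space X p"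
proof -
  have *: "dirderiv (mchart X j \<circ> param (open_submfd X W) i) (mchart X i p) v =
      dirderiv (mchart X j \<circ> param X i) (mchart X i p) v"
    if i: "i \<in> mix X" "p \<in> mdom X i" and v: "v \<in> mmodel X i" for i j v
  proof -
    have hi: "hnorm i = 1"
      using i by simp
    obtain x where x: "L i x = 0" "p = cl (i + x)"
      using mdom_E[OF i(2) hi] .
    then show ?thesis
      using dirderiv_param_open_submfd[OF hi W x(1), of v "mchart X j"] p v
      by (simp add: mchart_translate[OF hi] mmodel_X)
  qed
  have dom: "p \<in> mdom X i \<inter> W \<longleftrightarrow> p \<in> mdom X i" for i
    using p by blast
  show ?thesis
    unfolding tangent_space_def mix_open_submfd mdom_open_submfd mchart_open_submfd mmodel_open_submfd dom
    using * by (intro Collect_cong conj_cong ball_cong refl) auto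
qed

text \<open>Here the chart need not be centred at the point. A direction u may be changed by
  multiples of i + x; subtracting L i u times i + x puts it into the model space, and the result is
  the component at i.\<close>

lemma (in qcharts) tangent_space_chart_E:
  assumes \<xi>: "\<xi> \<in> tangent_space X (cl (i + x))" and i: "hnorm i = 1" and x: "L i x = 0"
  shows "\<xi> = tangent (i + x) (\<xi> i)" "L i (\<xi> i) = 0"
proof -
  have nz: "i + x \<noteq> 0" and L1: "L i (i + x) = 1"
    using translate_nonzero L_translate i x by auto
  obtain u where u: "\<xi> = tangent (i + x) u"
    using \<xi> tangent_space_eq[OF nz] by blast
  have "\<xi> i = u - L i u *\<^sub>C (i + x)"
    by (simp add: u tangent_def i L1 G_1 dq_def)
  moreover have "dq (L j) (i + x) (u - L i u *\<^sub>C (i + x)) = dq (L j) (i + x) u" if "L j (i + x) \<in> G" for j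
    using that G_nonzero by (intro dq_shift lin L_scale L_K) auto
  ultimately show "\<xi> = tangent (i + x) (\<xi> i)"
    by (auto simp: u tangent_def fun_eq_iff)
  show "L i (\<xi> i) = 0"
    using L_dq[of i "i + x" u] L1 G_1 by (simp add: u tangent_def i)
qed

section \<open>Frames with constant fibre coordinate 1 and their connection forms\<close>

definition taut_frame :: "'v::hermitian_lc_space \<Rightarrow> 'v set \<Rightarrow> ('v \<times> complex) set" where
  "taut_frame \<psi> p = taut_class (nrm (\<psi> + mchart proj_mfd \<psi> p)) 1"

text \<open>i times the pullback of \<alpha> along the local section of the sphere that underlies
  \<open>taut_frame\<close>.\<close>

definition frame_form :: "'v::hermitian_lc_space \<Rightarrow> 'v set \<Rightarrow> ('v \<Rightarrow> 'v) \<Rightarrow> complex" where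
  "frame_form \<psi> p \<xi> = \<i> * complex_of_real (sphere_form (\<psi> + mchart proj_mfd \<psi> p) (\<xi> \<psi>))"

lemma taut_frame_cline:
  assumes "hnorm \<psi> = 1" "cinner \<psi> x \<noteq> 0"
  shows "taut_frame \<psi> (cline x) = taut_class (nrm x) (sgn (inverse (cinner \<psi> x)))"
  using assms proj.mchart_X[of \<psi> x]
  by (simp add: taut_frame_def proj.translate_qmap nrm_scaleC taut_class_phase norm_sgn norm_inverse)

text \<open>\<open>sphere_form\<close> ignores the common factor 1 / <\<psi>, x>; the multiple of x
  subtracted by \<open>dq\<close> contributes Im (<\<psi>, v> / <\<psi>, x>), the derivative of arg
  <\<psi>, .> along v.\<close>

lemma frame_form_tangent:
  assumes "hnorm \<psi> = 1" "cinner \<psi> x \<noteq> 0"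
  shows "frame_form \<psi> (cline x) (proj.tangent x v) =
    \<i> * complex_of_real (sphere_form x v - Im (cinner \<psi> v * inverse (cinner \<psi> x)))"
proof -
  have x: "x \<noteq> 0"
    using assms by auto
  have "dq (cinner \<psi>) x v = inverse (cinner \<psi> x) *\<^sub>C (v - (cinner \<psi> v * inverse (cinner \<psi> x)) *\<^sub>C x)"
    by (simp add: dq_def algebra_simps)
  then have "frame_form \<psi> (cline x) (proj.tangent x v) =
      \<i> * complex_of_real (sphere_form x (v - (cinner \<psi> v * inverse (cinner \<psi> x)) *\<^sub>C x))"
    using assms proj.mchart_X[of \<psi> x]
    by (simp add: frame_form_def proj.translate_qmap proj.tangent_def sphere_form_scale)
  also have "sphere_form x (v - (cinner \<psi> v * inverse (cinner \<psi> x)) *\<^sub>C x) =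
      sphere_form x v - Im (cinner \<psi> v * inverse (cinner \<psi> x))"
  proof -
    have "cinner x (v - (cinner \<psi> v * inverse (cinner \<psi> x)) *\<^sub>C x) * inverse (cinner x x) =
        cinner x v * inverse (cinner x x) - cinner \<psi> v * inverse (cinner \<psi> x)"
      using x by (simp add: cinner_simps algebra_simps)
    then show ?thesis
      by (simp add: sphere_form_def)
  qed
  finally show ?thesis .
qed

lemma section_on_taut_frame:
  assumes "hnorm \<psi> = 1"
  shows "section_on (mdom proj_mfd \<psi>) (taut_frame \<psi>)"
  unfolding section_on_def
proof (intro conjI ballI proj.openin_mdom assms)
  fix p
  assume "p \<in> mdom proj_mfd \<psi>"
  then obtain x where x: "cinner \<psi> x = 0" "p = cline (\<psi> + x)"
    using assms by (auto elim: proj.mdom_E)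
  moreover have "\<psi> + x \<noteq> 0"
    by (rule proj.translate_nonzero[OF assms x(1)])
  ultimately show "taut_frame \<psi> p \<in> points taut_bundle" "taut_proj (taut_frame \<psi> p) = p"
    by (simp_all add: taut_frame_def proj.mchart_translate assms taut_class_points hnorm_nrm cline_nrm)
qed

lemma smooth_section_taut_frame:
  fixes \<psi> :: "'v::hermitian_lc_space"
  assumes \<psi>: "hnorm \<psi> = 1"
  shows "smooth_section proj_mfd taut_bundle taut_proj (mdom proj_mfd \<psi>) (taut_frame \<psi>)"
proof -
  let ?M = "open_submfd proj_mfd (mdom proj_mfd \<psi>)"
  note sec = section_on_taut_frame[OF \<psi>, unfolded section_on_def]
  have "smooth_map ?M taut_bundle (taut_frame \<psi>)"
  proof (rule smooth_mapI[OF open_charts_open_submfd[OF open_charts_proj proj.openin_mdom[OF \<psi>]] open_charts_taut,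
        where V = "\<lambda>j k. {x. cinner k (j + x) \<noteq> 0 \<and> cinner \<psi> (j + x) \<noteq> 0}"
          and f = "\<lambda>j k x. (qmap (cinner k) k (j + x), sgn (cinner k (j + x)) * sgn (inverse (cinner \<psi> (j + x))))"],
      goal_cases)
    case 1
    have "continuous_on (mmodel proj_mfd \<psi>) (\<lambda>x. (nrm (\<psi> + x), 1 :: complex))"
      using proj.translate_nonzero[OF \<psi>] by (intro continuous_intros) (auto simp: proj.mmodel_X)
    then have "continuous_map (top_of_set (mmodel proj_mfd \<psi>)) (top_of_set ({\<phi>. hnorm \<phi> = 1} \<times> UNIV))
        (\<lambda>x. (nrm (\<psi> + x), 1 :: complex))"
      using proj.translate_nonzero[OF \<psi>] by (auto simp: continuous_map_top_of_set hnorm_nrm proj.mmodel_X)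
    from continuous_map_compose[OF continuous_map_compose[OF proj.continuous_map_mchart[OF \<psi>] this]
        continuous_map_taut_class]
    have "continuous_map (subtopology (mtop proj_mfd) (mdom proj_mfd \<psi>)) (mtop taut_bundle)
        ((\<lambda>(q, z). taut_class q z) \<circ> ((\<lambda>x. (nrm (\<psi> + x), 1)) \<circ> mchart proj_mfd \<psi>))" .
    moreover have "(\<lambda>(q, z). taut_class q z) \<circ> ((\<lambda>x. (nrm (\<psi> + x), 1)) \<circ> mchart proj_mfd \<psi>) = taut_frame \<psi>"
      by (simp add: fun_eq_iff taut_frame_def)
    ultimately show ?case
      by (simp only: mtop_open_submfd)
  next
    case (2 j k n)
    show ?case
      by (intro Cn_on_qmap lc_linear_cinner Cn_on_intros) auto
  next
    case (3 j k p)
    then have jk: "hnorm j = 1" "hnorm k = 1" and p: "p \<in> mdom proj_mfd j" "p \<in> mdom proj_mfd \<psi>"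
      by auto
    obtain x where x: "cinner j x = 0" "p = cline (j + x)"
      using proj.mdom_E[OF p(1) jk(1)] .
    have nz: "j + x \<noteq> 0"
      by (rule proj.translate_nonzero[OF jk(1) x(1)])
    have "p \<in> mdom proj_mfd k"
      using 3(4) sec p(2) by (simp add: mdom_taut)
    then have "cinner k (j + x) \<noteq> 0" "cinner \<psi> (j + x) \<noteq> 0"
      using p(2) x(2) proj.cl_mdom[OF \<psi> nz] proj.cl_mdom[OF jk(2) nz] by simp_all
    then show ?case
      using x nz \<psi> jk proj.mchart_X[of k "j + x"]
      by (simp add: proj.mchart_translate taut_frame_cline mchart_taut cline_nrm sgn_cinner_nrm)
  qed
  then show ?thesis
    using sec by (simp add: smooth_section_def)
qed

lemma local_form1_frame_form:
  assumes \<psi>: "hnorm \<psi> = 1" and i: "hnorm i = 1" and x: "cinner i x = 0" "cinner \<psi> (i + x) \<noteq> 0"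
    and v: "cinner i v = 0"
  shows "local_form1 (open_submfd proj_mfd (mdom proj_mfd \<psi>)) (frame_form \<psi>) i x v =
    \<i> * complex_of_real (sphere_form (i + x) v - Im (cinner \<psi> v * inverse (cinner \<psi> (i + x))))"
proof -
  have "cline (i + x) \<in> mdom proj_mfd \<psi>"
    using proj.cl_mdom[OF \<psi> proj.translate_nonzero[OF i x(1)]] x(2) by simp
  then show ?thesis
    using assms unfolding local_form1_def
    by (simp add: proj.param_open_submfd proj.tangent_vector_open_submfd proj.openin_mdom frame_form_tangent)
qed

lemma one_form_frame_form:
  fixes \<psi> :: "'v::hermitian_lc_space"
  assumes \<psi>: "hnorm \<psi> = 1"
  shows "one_form (open_submfd proj_mfd (mdom proj_mfd \<psi>)) (frame_form \<psi>)"
  unfolding one_form_def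
proof (intro conjI ballI allI)
  fix i :: 'v
  assume "i \<in> mix (open_submfd proj_mfd (mdom proj_mfd \<psi>))"
  then have i: "hnorm i = 1"
    by simp
  define T where "T = mmodel proj_mfd i"
  define U where "U = {x. cinner i x = 0 \<and> cinner \<psi> (i + x) \<in> - {0}}"
  have U: "mchart proj_mfd i ` (mdom proj_mfd i \<inter> mdom proj_mfd \<psi>) = U"
    using proj.translate_nonzero[OF i] proj.cl_mdom[OF \<psi>] by (auto simp: proj.mchart_image_Int[OF i] U_def)
  have T: "cinner i v = 0" if "v \<in> T" for v
    using that by (simp add: T_def proj.mmodel_X)
  have "smooth_on (T \<times> T) (U \<times> T)
      (\<lambda>(x, v). local_form1 (open_submfd proj_mfd (mdom proj_mfd \<psi>)) (frame_form \<psi>) i x v)"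
  proof (rule smooth_on_if_Cn_on)
    show "openin (top_of_set (T \<times> T)) (U \<times> T)"
      unfolding T_def U_def by (intro openin_Times proj.openin_transition_dom) simp
    show "subspace (T \<times> T)"
      using proj.subspace_mmodel by (auto simp: T_def intro!: subspace_Times)
    show "Cn_on n (T \<times> T) (U \<times> T) (\<lambda>z h. \<i> * complex_of_real (sphere_form (i + fst z) (snd z) -
        Im (cinner \<psi> (snd z) * inverse (cinner \<psi> (i + fst z)))))" for n
      using proj.translate_nonzero[OF i]
      by (intro Cn_on_sphere_form Cn_on_intros) (auto simp: U_def)
  qed (auto simp: local_form1_frame_form \<psi> i T U_def)
  then show "smooth_on (mmodel (open_submfd proj_mfd (mdom proj_mfd \<psi>)) i \<times> mmodel (open_submfd proj_mfd (mdom proj_mfd \<psi>)) i)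
      (mchart (open_submfd proj_mfd (mdom proj_mfd \<psi>)) i ` mdom (open_submfd proj_mfd (mdom proj_mfd \<psi>)) i \<times>
        mmodel (open_submfd proj_mfd (mdom proj_mfd \<psi>)) i)
      (\<lambda>(x, v). local_form1 (open_submfd proj_mfd (mdom proj_mfd \<psi>)) (frame_form \<psi>) i x v)"
    by (simp add: U T_def)
qed (simp_all add: frame_form_def sphere_form_def cinner_simps algebra_simps scaleR_conv_of_real)

text \<open>In the trivialisation of q the frame is represented by the phase of 1 / <\<psi>, q + x>,
  whose derivative along l is -i Im (<\<psi>, l> / <\<psi>, q>) times itself. The form has the same
  value, since its \<alpha> term vanishes on \<xi> q, which is orthogonal to q.\<close>

lemma taut_connection_frame:
  fixes \<psi> :: "'v::hermitian_lc_space"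
  assumes \<psi>: "hnorm \<psi> = 1" and p: "p \<in> mdom proj_mfd \<psi>" and \<xi>: "\<xi> \<in> tangent_space proj_mfd p"
  shows "taut_connection (taut_frame \<psi>) p \<xi> = assoc_scale scaleC (frame_form \<psi> p \<xi>) (taut_frame \<psi> p)"
proof -
  note sec = section_on_taut_frame[OF \<psi>]
  define q where "q = unit_rep p"
  have q: "hnorm q = 1" "cline q = p"
    using unit_rep[OF section_on_points[OF sec p]] by (simp_all add: q_def)
  define c where "c = cinner \<psi> q"
  have c: "c \<noteq> 0"
    using proj.cl_mdom[OF \<psi> unit_nonzero[OF q(1)]] p q(2) by (simp add: c_def)
  define D where "D l = sgn (inverse c) * (\<i> * complex_of_real (Im (cinner \<psi> l * - (inverse c * inverse c) *
      inverse (inverse c))))" for l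
  let ?U = "rep_dom (mdom proj_mfd \<psi>) q"
  have "has_hderiv (mmodel proj_mfd q) ?U (\<lambda>x. sgn (inverse (cinner \<psi> (q + x)))) 0 D"
    unfolding has_hderiv_def
  proof (intro allI impI)
    fix \<gamma> :: "real \<Rightarrow> 'v" and l
    assume \<gamma>: "\<gamma> 0 = 0" "has_dirderiv \<gamma> 0 1 l"
    have "has_dirderiv (\<lambda>t. cinner \<psi> (q + \<gamma> t)) 0 1 (cinner \<psi> l)"
      using lc_linear.has_dirderiv[OF lc_linear_cinner has_dirderiv_add[OF has_dirderiv_const \<gamma>(2)], of \<psi> q]
      by simp
    from has_dirderiv_sgn[OF has_dirderiv_inverse[OF this]]
    show "has_dirderiv (\<lambda>t. sgn (inverse (cinner \<psi> (q + \<gamma> t)))) 0 1 (D l)"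
      using c by (simp add: \<gamma>(1) c_def D_def)
  qed
  then have "has_hderiv (mmodel proj_mfd q) ?U (section_rep (taut_frame \<psi>) q) 0 D"
  proof (rule has_hderiv_eq)
    fix x
    assume x: "x \<in> ?U"
    have nz: "q + x \<noteq> 0"
      using proj.translate_nonzero[OF q(1)] x by simp
    then have "cinner \<psi> (q + x) \<noteq> 0"
      using x proj.cl_mdom[OF \<psi> nz] by simp
    then show "sgn (inverse (cinner \<psi> (q + x))) = section_rep (taut_frame \<psi>) q x"
      using \<psi> nz x proj.L_translate[OF q(1), of x]
      by (simp add: section_rep_def taut_frame_cline mchart_taut sgn_cinner_nrm)
  qed (use p q in simp)
  from taut_connection_eq[OF sec p \<xi> q_def this]
  have "taut_connection (taut_frame \<psi>) p \<xi> = taut_class q (D (\<xi> q))" .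
  moreover have "taut_frame \<psi> p = taut_class q (sgn (inverse c))"
    using taut_frame_cline[OF \<psi>, of q] c q by (simp add: c_def nrm_unit)
  moreover have "frame_form \<psi> p \<xi> = \<i> * complex_of_real (- Im (cinner \<psi> (\<xi> q) * inverse c))"
  proof -
    have \<xi>': "\<xi> = proj.tangent q (\<xi> q)" "cinner q (\<xi> q) = 0"
      using proj.tangent_space_E[of \<xi> q] \<xi> q by auto
    have "frame_form \<psi> p (proj.tangent q (\<xi> q)) = \<i> * complex_of_real (- Im (cinner \<psi> (\<xi> q) * inverse c))"
      using frame_form_tangent[OF \<psi>, of q "\<xi> q"] c q \<xi>'(2) by (simp add: c_def sphere_form_def)
    then show ?thesis
      using \<xi>'(1) by simp
  qed
  moreover have "D (\<xi> q) = \<i> * complex_of_real (- Im (cinner \<psi> (\<xi> q) * inverse c)) * sgn (inverse c)"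
  proof -
    have "cinner \<psi> (\<xi> q) * - (inverse c * inverse c) * inverse (inverse c) = - (cinner \<psi> (\<xi> q) * inverse c)"
      using c by simp
    then show ?thesis
      by (simp only: D_def uminus_complex.sel) (simp add: mult.commute)
  qed
  ultimately show ?thesis
    by simp
qed

lemma connection_form_taut_frame:
  assumes \<psi>: "hnorm \<psi> = 1"
  shows "connection_form proj_mfd taut_bundle taut_proj (assoc_scale scaleC) taut_connection
    (mdom proj_mfd \<psi>) (taut_frame \<psi>) (frame_form \<psi>)"
  unfolding connection_form_def
proof (intro conjI ballI impI smooth_section_taut_frame one_form_frame_form taut_connection_frame \<psi>)
  fix p l
  assume p: "p \<in> mdom proj_mfd \<psi>" and l: "l \<in> points taut_bundle" "taut_proj l = p"
  obtain x where x: "cinner \<psi> x = 0" "p = cline (\<psi> + x)"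
    using proj.mdom_E[OF p \<psi>] .
  have nz: "\<psi> + x \<noteq> 0"
    by (rule proj.translate_nonzero[OF \<psi> x(1)])
  obtain z where "l = taut_class (nrm (\<psi> + x)) z"
    using taut_fibre_E[OF l(1), of "nrm (\<psi> + x)"] l(2) x(2) nz by (auto simp: cline_nrm hnorm_nrm)
  then show "\<exists>c. l = assoc_scale scaleC c (taut_frame \<psi> p)"
    using x \<psi> by (intro exI[of _ z]) (simp add: taut_frame_def proj.mchart_translate)
qed

text \<open>The term from arg <\<psi>, .> contributes an expression symmetric in v and w, which
  cancels: d d arg = 0 in coordinates. What remains is i times the exterior derivative of
  \<open>sphere_form\<close>.\<close>

lemma is_ext_deriv1_frame_form:
  fixes \<psi> :: "'v::hermitian_lc_space"
  assumes \<psi>: "hnorm \<psi> = 1"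
  shows "is_ext_deriv1 (open_submfd proj_mfd (mdom proj_mfd \<psi>)) (frame_form \<psi>)
    (\<lambda>q \<xi> \<eta>. \<i> * complex_of_real (proj_Omega q \<xi> \<eta>))"
  unfolding is_ext_deriv1_def
proof (intro ballI)
  let ?M = "open_submfd proj_mfd (mdom proj_mfd \<psi>)"
  fix i :: 'v and p \<xi> \<eta>
  assume "i \<in> mix ?M" and p0: "p \<in> mdom ?M i"
    and tan: "\<xi> \<in> tangent_space ?M p" "\<eta> \<in> tangent_space ?M p"
  then have i: "hnorm i = 1" and p: "p \<in> mdom proj_mfd i" "p \<in> mdom proj_mfd \<psi>"
    by auto
  obtain x where x: "cinner i x = 0" "p = cline (i + x)"
    using proj.mdom_E[OF p(1) i] .
  have nz: "i + x \<noteq> 0"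
    by (rule proj.translate_nonzero[OF i x(1)])
  have c: "cinner \<psi> (i + x) \<noteq> 0"
    using p(2) x(2) proj.cl_mdom[OF \<psi> nz] by simp
  have "\<xi> \<in> tangent_space proj_mfd (cline (i + x))" "\<eta> \<in> tangent_space proj_mfd (cline (i + x))"
    using tan proj.tangent_space_open_submfd[OF proj.openin_mdom[OF \<psi>] p(2)] x(2) by auto
  note \<xi> = proj.tangent_space_chart_E[OF this(1) i x(1)] and \<eta> = proj.tangent_space_chart_E[OF this(2) i x(1)]
  define v w where "v = \<xi> i" and "w = \<eta> i"
  have \<omega>: "proj_Omega p \<xi> \<eta> = Im (fubini_study (i + x) v w)"
    using \<xi>(1) \<eta>(1) proj_H_tangent[OF nz, of v w] by (simp add: proj_Omega_def x(2) v_def w_def)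
  let ?f = "\<lambda>w y. \<i> * complex_of_real (sphere_form (i + y) w - Im (cinner \<psi> w * inverse (cinner \<psi> (i + y))))"
  have D: "dirderiv (\<lambda>y. local_form1 ?M (frame_form \<psi>) i y w) x v =
      \<i> * complex_of_real (dirderiv (\<lambda>y. sphere_form (i + y) w) x v
        + Im (cinner \<psi> w * cinner \<psi> v * (inverse (cinner \<psi> (i + x)) * inverse (cinner \<psi> (i + x)))))"
    if vw: "cinner i v = 0" "cinner i w = 0" for v w
  proof (rule has_dirderiv_imp, rule iffD2[OF has_dirderiv_openin_cong[OF proj.openin_transition_dom _ proj.subspace_mmodel]])
    show "x \<in> {x. cinner i x = 0 \<and> cinner \<psi> (i + x) \<in> - {0}}" "v \<in> mmodel proj_mfd i"
      using x c vw by (simp_all add: proj.mmodel_X)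
    show "local_form1 ?M (frame_form \<psi>) i y w = ?f w y" if "y \<in> {x. cinner i x = 0 \<and> cinner \<psi> (i + x) \<in> - {0}}" for y
      using that vw by (intro local_form1_frame_form \<psi> i) simp_all
    have "has_dirderiv (\<lambda>y. sphere_form (i + y) w) x v (dirderiv (\<lambda>y. sphere_form (i + y) w) x v)"
      using has_dirderiv_sphere_form[OF nz] has_dirderiv_imp by metis
    then show "has_dirderiv (?f w) x v (\<i> * complex_of_real (dirderiv (\<lambda>y. sphere_form (i + y) w) x v
        + Im (cinner \<psi> w * cinner \<psi> v * (inverse (cinner \<psi> (i + x)) * inverse (cinner \<psi> (i + x))))))"
      by (rule has_dirderiv_eq[OF cmult.has_dirderiv[OF has_dirderiv_const of_real.has_dirderiv[OF has_dirderiv_diff[OF _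
            Im.has_dirderiv[OF cmult.has_dirderiv[OF has_dirderiv_const has_dirderiv_inverse[OF
              cinner.has_dirderiv[OF has_dirderiv_const has_dirderiv_add[OF has_dirderiv_const has_dirderiv_ident]]]]]]]]])
         (use c in \<open>simp_all add: mult.assoc\<close>)
  qed
  have "mchart ?M i p = x"
    using x i by (simp add: proj.mchart_translate)
  moreover have "cinner i v = 0" "cinner i w = 0"
    using \<xi>(2) \<eta>(2) by (simp_all add: v_def w_def)
  ultimately have "ext_deriv1 ?M (frame_form \<psi>) i (mchart ?M i p) v w =
      \<i> * complex_of_real (dirderiv (\<lambda>y. sphere_form (i + y) w) x v - dirderiv (\<lambda>y. sphere_form (i + y) v) x w)"
    by (simp add: ext_deriv1_def D algebra_simps)
  then show "\<i> * complex_of_real (proj_Omega p \<xi> \<eta>) = ext_deriv1 ?M (frame_form \<psi>) i (mchart ?M i p) (\<xi> i) (\<eta> i)"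
    by (simp add: \<omega> sphere_form_ext_deriv[OF nz] v_def w_def)
qed

section \<open>Curvature and the axioms of a linear connection\<close>

lemma has_curvature_taut:
  "has_curvature (proj_mfd :: ('v::hermitian_lc_space set, 'v, 'v) mfd) taut_bundle taut_proj
     (assoc_scale scaleC) taut_connection proj_Omega"
  unfolding has_curvature_def
proof
  fix p :: "'v set"
  assume "p \<in> points proj_mfd"
  then obtain \<psi> where "hnorm \<psi> = 1" "p \<in> mdom proj_mfd \<psi>"
    unfolding proj.mdom_covers[symmetric] by auto
  then show "\<exists>W s \<theta>. p \<in> W \<and> connection_form proj_mfd taut_bundle taut_proj (assoc_scale scaleC) taut_connection W s \<theta> \<and>
      is_ext_deriv1 (open_submfd proj_mfd W) \<theta> (\<lambda>q \<xi> \<eta>. \<i> * complex_of_real (proj_Omega q \<xi> \<eta>))"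
    by (intro exI[of _ "mdom proj_mfd \<psi>"] exI[of _ "taut_frame \<psi>"] exI[of _ "frame_form \<psi>"] conjI
        connection_form_taut_frame is_ext_deriv1_frame_form)
qed

text \<open>\<open>fun_deriv\<close> differentiates in the chart selected by
  \<open>chart_at\<close>, whereas the Leibniz rule needs the chart at q. A curve \<gamma> in the
  latter is carried to a curve \<delta> in the former, where the chain rule for C^1 functions
  applies.\<close>

lemma has_hderiv_smooth_function:
  fixes q :: "'v::hermitian_lc_space"
  assumes W: "openin (mtop proj_mfd) W" and q: "hnorm q = 1" "cline q \<in> W"
    and f: "smooth_map (open_submfd proj_mfd W) complex_plane f"
  shows "has_hderiv (mmodel proj_mfd q) (rep_dom W q) (\<lambda>x. f (cline (q + x))) 0
    (\<lambda>l. fun_deriv proj_mfd f (cline q) (proj.tangent q l))"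
proof -
  define i where "i = chart_at proj_mfd (cline q)"
  have nz: "q \<noteq> 0"
    using q unit_nonzero by auto
  have i: "hnorm i = 1" "cinner i q \<noteq> 0"
    using proj.chart_at[OF nz] by (simp_all add: i_def)
  define x where "x = mchart proj_mfd i (cline q)"
  have xq: "x = qmap (cinner i) i q"
    using i proj.mchart_X[of i q] by (simp add: x_def)
  let ?fi = "f \<circ> param proj_mfd i"
  have "smooth_on (mmodel proj_mfd i) (mchart proj_mfd i ` (mdom proj_mfd i \<inter> W))
      (f \<circ> param (open_submfd proj_mfd W) i)"
    using f i by (simp add: smooth_map_def)
  then have "C1_on (mmodel proj_mfd i) (rep_dom W i) (f \<circ> param (open_submfd proj_mfd W) i)"
    unfolding proj.mchart_image_Int[OF i(1)] by (rule C1_on_if_smooth_on)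
  then have C1: "C1_on (mmodel proj_mfd i) (rep_dom W i) ?fi"
    by (rule C1_on_eq[OF _ proj.subspace_mmodel])
       (simp add: proj.param_open_submfd[OF i(1)] proj.param_translate[OF i(1)])
  have xU: "x \<in> rep_dom W i"
    using i q proj.L_qmap[of i q] proj.cl_translate_qmap[of i q] by (simp add: xq)
  note hd = has_hderiv_C1_on[OF C1 proj.subspace_mmodel xU]
  define S where "S = {y. y \<noteq> 0 \<and> cline y \<in> W} \<inter> {y. cinner i y \<noteq> 0}"
  have oS: "open S"
    unfolding S_def by (intro open_Int proj.open_cl_vimage W open_Collect_neq continuous_intros)
  have qS: "q \<in> S"
    using nz q i by (simp add: S_def)
  show ?thesis
    unfolding has_hderiv_def
  proof (intro allI impI)
    fix \<gamma> :: "real \<Rightarrow> 'v" and l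
    assume \<gamma>: "\<gamma> 0 = 0" "l \<in> mmodel proj_mfd q" "has_dirderiv \<gamma> 0 1 l"
    have line: "has_dirderiv (\<lambda>t. q + \<gamma> t) 0 1 l"
      using has_dirderiv_add[OF has_dirderiv_const \<gamma>(3), of q] by simp
    have "((\<lambda>t. q + \<gamma> t) \<longlongrightarrow> q) (at 0)"
      using has_dirderiv_curve_tendsto[OF line] by (simp add: \<gamma>(1))
    then have ev: "\<forall>\<^sub>F t in at 0. q + \<gamma> t \<in> S"
      using oS qS by (rule topological_tendstoD)
    define \<delta> where "\<delta> t = qmap (cinner i) i (q + \<gamma> t)" for t
    have \<delta>: "has_dirderiv \<delta> 0 1 (dq (cinner i) q l)"
      unfolding \<delta>_def using has_dirderiv_qmap[OF lc_linear_cinner line, of i i] i by (simp add: \<gamma>(1))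
    have \<delta>U: "\<forall>\<^sub>F t in at 0. \<delta> t \<in> rep_dom W i"
      using ev
    proof eventually_elim
      case (elim t)
      then show ?case
        using proj.L_qmap[OF i(1), of "q + \<gamma> t"] proj.cl_translate_qmap[of i "q + \<gamma> t"]
        by (simp add: S_def \<delta>_def)
    qed
    have "has_dirderiv (\<lambda>t. ?fi (\<delta> t)) 0 1 (dirderiv ?fi x (dq (cinner i) q l))"
      by (rule has_hderivD[OF hd _ _ \<delta>U \<delta>])
        (use proj.L_dq[of i q l] i in \<open>simp_all add: \<delta>_def \<gamma>(1) xq proj.mmodel_X\<close>)
    moreover have "\<forall>\<^sub>F t in at 0. f (cline (q + \<gamma> (0 + t *\<^sub>R 1))) = ?fi (\<delta> (0 + t *\<^sub>R 1))"
      using ev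
    proof eventually_elim
      case (elim t)
      then show ?case
        using i(1) proj.L_qmap[OF i(1), of "q + \<gamma> t"] proj.cl_translate_qmap[of i "q + \<gamma> t"]
        by (simp add: S_def \<delta>_def proj.param_translate)
    qed
    moreover have "f (cline (q + \<gamma> 0)) = ?fi (\<delta> 0)"
      using i proj.L_qmap[OF i(1), of q] proj.cl_translate_qmap[of i q]
      by (simp add: \<delta>_def \<gamma>(1) proj.param_translate)
    ultimately have "has_dirderiv (\<lambda>t. f (cline (q + \<gamma> t))) 0 1 (dirderiv ?fi x (dq (cinner i) q l))"
      using has_dirderiv_cong[of "\<lambda>t. f (cline (q + \<gamma> t))" 0 1 "\<lambda>t. ?fi (\<delta> t)"] by blast
    moreover have "fun_deriv proj_mfd f (cline q) (proj.tangent q l) = dirderiv ?fi x (dq (cinner i) q l)"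
      using i by (simp add: fun_deriv_def i_def[symmetric] x_def proj.tangent_def)
    ultimately show "has_dirderiv (\<lambda>t. f (cline (q + \<gamma> t))) 0 1
        (fun_deriv proj_mfd f (cline q) (proj.tangent q l))"
      by simp
  qed
qed

lemma section_rep_eq:
  assumes s: "section_on W s" and q: "hnorm q = 1" and x: "x \<in> rep_dom W q"
  shows "s (cline (q + x)) = taut_class (nrm (q + x)) (section_rep s q x)"
proof -
  have nz: "q + x \<noteq> 0"
    using proj.translate_nonzero[OF q] x by simp
  have "s (cline (q + x)) \<in> points taut_bundle" "taut_proj (s (cline (q + x))) = cline (nrm (q + x))"
    using s x nz by (simp_all add: section_on_def cline_nrm)
  then obtain z where z: "s (cline (q + x)) = taut_class (nrm (q + x)) z"
    using hnorm_nrm[OF nz] by (auto elim: taut_fibre_E)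
  moreover have "section_rep s q x = z"
    using nz x proj.L_translate[OF q, of x] by (simp add: section_rep_def z mchart_taut sgn_cinner_nrm)
  ultimately show ?thesis
    by simp
qed

text \<open>In the trivialisation of q the fibre operations become addition and multiplication of
  complex functions. The axioms thus reduce to real linearity of the derivative and to the sum and
  product rules for \<open>has_hderiv\<close>; the frames over chart domains supply the local
  connection forms.\<close>

lemma linear_connection_taut:
  "linear_connection (proj_mfd :: ('v::hermitian_lc_space set, 'v, 'v) mfd) taut_bundle taut_proj
     (assoc_add scaleC) (assoc_scale scaleC) taut_connection"
  unfolding linear_connection_def
proof (intro conjI allI impI ballI)
  fix p :: "'v set"
  assume "p \<in> points proj_mfd"
  then obtain \<psi> where "hnorm \<psi> = 1" "p \<in> mdom proj_mfd \<psi>"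
    unfolding proj.mdom_covers[symmetric] by auto
  then show "\<exists>W s \<theta>. p \<in> W \<and> connection_form proj_mfd taut_bundle taut_proj (assoc_scale scaleC) taut_connection W s \<theta>"
    by (intro exI[of _ "mdom proj_mfd \<psi>"] exI[of _ "taut_frame \<psi>"] exI[of _ "frame_form \<psi>"] conjI
        connection_form_taut_frame)
next
  fix W s p and \<xi> :: "'v \<Rightarrow> 'v"
  assume asm: "smooth_section proj_mfd taut_bundle taut_proj W s \<and> p \<in> W \<and> \<xi> \<in> tangent_space proj_mfd p"
  then have p: "p \<in> W" and \<xi>: "\<xi> \<in> tangent_space proj_mfd p" and sm: "smooth_section proj_mfd taut_bundle taut_proj W s"
    by auto
  note s = section_on_if_smooth_section[OF sm]
  have pp: "p \<in> points proj_mfd"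
    by (rule section_on_points[OF s p])
  define q where "q = unit_rep p"
  have q: "hnorm q = 1" "cline q = p"
    using unit_rep[OF pp] by (simp_all add: q_def)
  have nz: "q \<noteq> 0"
    by (rule unit_nonzero[OF q(1)])
  have 0: "0 \<in> rep_dom W q"
    using q p by simp
  have tq: "\<xi> q \<in> mmodel proj_mfd q" if "\<xi> \<in> tangent_space proj_mfd p" for \<xi>
    using proj.tangent_space_E(2)[of \<xi> q] that q by (simp add: proj.mmodel_X)
  define D where "D s = dirderiv (section_rep s q) 0" for s
  have C1: "C1_on (mmodel proj_mfd q) (rep_dom W q) (section_rep s q)"
    if "smooth_section proj_mfd taut_bundle taut_proj W s" for s
    by (rule C1_on_section_rep[OF that q(1)])
  have hd: "has_hderiv (mmodel proj_mfd q) (rep_dom W q) (section_rep s q) 0 (D s)"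
    if "smooth_section proj_mfd taut_bundle taut_proj W s" for s
    unfolding D_def by (rule has_hderiv_C1_on[OF C1[OF that] proj.subspace_mmodel 0])
  have nab: "taut_connection s p \<xi> = taut_class q (D s (\<xi> q))"
    if "smooth_section proj_mfd taut_bundle taut_proj W s" "\<xi> \<in> tangent_space proj_mfd p" for s \<xi>
    by (rule taut_connection_eq[OF section_on_if_smooth_section[OF that(1)] p that(2) q_def hd[OF that(1)]])
  show "taut_connection s p \<xi> \<in> points taut_bundle" "taut_proj (taut_connection s p \<xi>) = p"
    using q by (simp_all add: nab sm \<xi> taut_class_points)
  show "taut_connection s p (\<lambda>j. \<xi> j + \<eta> j) = assoc_add scaleC (taut_connection s p \<xi>) (taut_connection s p \<eta>)"
    if \<eta>: "\<eta> \<in> tangent_space proj_mfd p" for \<eta>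
  proof -
    have "D s (\<xi> q + \<eta> q) = D s (\<xi> q) + D s (\<eta> q)"
      unfolding D_def by (rule dirderiv_add[OF C1[OF sm] proj.subspace_mmodel 0 tq[OF \<xi>] tq[OF \<eta>]])
    then show ?thesis
      by (simp add: nab sm \<xi> \<eta> proj_tangent_add[OF pp \<xi> \<eta>] nz)
  qed
  show "taut_connection s p (\<lambda>j. r *\<^sub>R \<xi> j) = assoc_scale scaleC (complex_of_real r) (taut_connection s p \<xi>)"
    for r :: real
  proof -
    have "(\<lambda>j. r *\<^sub>R \<xi> j) \<in> tangent_space proj_mfd p"
      using proj_tangent_scaleC[OF pp \<xi>, of "complex_of_real r"] by (simp add: scaleR_scaleC)
    moreover have "D s (r *\<^sub>R \<xi> q) = r *\<^sub>R D s (\<xi> q)"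
      unfolding D_def by (rule C1_on_dirderiv_scaleR[OF C1[OF sm] 0 tq[OF \<xi>]])
    ultimately show ?thesis
      by (simp add: nab sm \<xi> scaleR_conv_of_real)
  qed
  show "taut_connection s' p \<xi> = taut_connection s p \<xi>" if "\<forall>q\<in>W. s' q = s q" for s'
  proof -
    have s': "section_on W s'"
      using s that by (simp add: section_on_def)
    \<comment> \<open>\<open>s'\<close> may be arbitrary outside W, but near parameter 0 the curves
      in \<open>has_hderiv\<close> stay in \<open>rep_dom W q\<close>, where both representatives
      coincide.\<close>
    have "has_hderiv (mmodel proj_mfd q) (rep_dom W q) (section_rep s' q) 0 (D s)"
      by (rule has_hderiv_eq[OF hd[OF sm] _ 0]) (simp add: section_rep_def that)
    from taut_connection_eq[OF s' p \<xi> q_def this] show ?thesis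
      by (simp add: nab sm \<xi>)
  qed
  show "taut_connection (\<lambda>q. assoc_add scaleC (s q) (s' q)) p \<xi> =
      assoc_add scaleC (taut_connection s p \<xi>) (taut_connection s' p \<xi>)"
    if sm': "smooth_section proj_mfd taut_bundle taut_proj W s'" for s'
  proof -
    note s' = section_on_if_smooth_section[OF sm']
    let ?s = "\<lambda>q. assoc_add scaleC (s q) (s' q)"
    have sec: "section_on W ?s"
      unfolding section_on_def
    proof (intro conjI ballI)
      show "openin (mtop proj_mfd) W"
        using s by (simp add: section_on_def)
      fix p'
      assume "p' \<in> W"
      then have "s p' \<in> points taut_bundle" "s' p' \<in> points taut_bundle"
          "taut_proj (s p') = p'" "taut_proj (s' p') = p'"
        using s s' by (simp_all add: section_on_def)
      then show "?s p' \<in> points taut_bundle" "taut_proj (?s p') = p'"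
        using taut_add_scale_points(1)[of "s p'" "s' p'"] by simp_all
    qed
    have "section_rep s q x + section_rep s' q x = section_rep ?s q x" if x: "x \<in> rep_dom W q" for x
    proof -
      have "q + x \<noteq> 0"
        using proj.translate_nonzero[OF q(1)] x by simp
      then show ?thesis
        unfolding section_rep_def[of ?s] section_rep_eq[OF s q(1) x] section_rep_eq[OF s' q(1) x]
        using x proj.L_translate[OF q(1), of x] by (simp add: nrm_nonzero mchart_taut sgn_cinner_nrm)
    qed
    from taut_connection_eq[OF sec p \<xi> q_def has_hderiv_eq[OF has_hderiv_add[OF hd[OF sm] hd[OF sm']] this 0]]
    show ?thesis
      by (simp add: nab sm sm' \<xi> nz)
  qed
  show "taut_connection (\<lambda>q. assoc_scale scaleC (f q) (s q)) p \<xi> =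
      assoc_add scaleC (assoc_scale scaleC (fun_deriv proj_mfd f p \<xi>) (s p))
        (assoc_scale scaleC (f p) (taut_connection s p \<xi>))"
    if f: "smooth_map (open_submfd proj_mfd W) complex_plane f" for f
  proof -
    let ?s = "\<lambda>q. assoc_scale scaleC (f q) (s q)"
    have sec: "section_on W ?s"
      using s by (simp add: section_on_def taut_add_scale_points(2))
    have W: "openin (mtop proj_mfd) W"
      using s by (simp add: section_on_def)
    have fd: "has_hderiv (mmodel proj_mfd q) (rep_dom W q) (\<lambda>x. f (cline (q + x))) 0
        (\<lambda>l. fun_deriv proj_mfd f (cline q) (proj.tangent q l))"
      using q p by (intro has_hderiv_smooth_function W f) simp_all
    have "f (cline (q + x)) * section_rep s q x = section_rep ?s q x" if x: "x \<in> rep_dom W q" for x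
    proof -
      have "q + x \<noteq> 0"
        using proj.translate_nonzero[OF q(1)] x by simp
      then show ?thesis
        unfolding section_rep_def[of ?s] section_rep_eq[OF s q(1) x]
        using x proj.L_translate[OF q(1), of x] by (simp add: mchart_taut sgn_cinner_nrm)
    qed
    from taut_connection_eq[OF sec p \<xi> q_def has_hderiv_eq[OF has_hderiv_mult[OF fd hd[OF sm]] this 0]]
    have "taut_connection ?s p \<xi> = taut_class q
        (fun_deriv proj_mfd f p (proj.tangent q (\<xi> q)) * section_rep s q 0 + f p * D s (\<xi> q))"
      by (simp add: q)
    moreover have "proj.tangent q (\<xi> q) = \<xi>"
      using proj.tangent_space_E(1)[of \<xi> q] \<xi> q by simp
    moreover have "s p = taut_class q (section_rep s q 0)"
      using section_rep_eq[OF s q(1) 0] q by (simp add: nrm_unit)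
    ultimately show ?thesis
      by (simp add: nab sm \<xi> nz)
  qed
qed

lemma prequantum_line_bundle_taut:
  "prequantum_line_bundle (proj_mfd :: ('v::hermitian_lc_space set, 'v, 'v) mfd) proj_Omega taut_bundle
     taut_proj (assoc_add scaleC) (assoc_scale scaleC) taut_connection"
  unfolding prequantum_line_bundle_def
  using symplectic_form_proj complex_line_bundle_taut linear_connection_taut has_curvature_taut
  by (simp add: proj_Omega_def[abs_def])

text \<open>The first conjunct ties \<open>proj_H\<close>, which is defined through a chosen unit
  vector, to every unit vector of the line. The last three identify the associated bundle, linearly
  on each fibre, with the tautological one.\<close>

theorem theorem2p5:
  fixes PV :: "('v::hermitian_lc_space set, 'v, 'v) mfd"
    and SV :: "('v, 'v, 'v) mfd"
    and LV :: "(('v \<times> complex) set, 'v \<times> complex, 'v) mfd"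
  defines "PV \<equiv> proj_mfd" and "SV \<equiv> sphere_mfd" and "LV \<equiv> taut_bundle"
  shows
    "(\<forall>\<psi>. hnorm \<psi> = 1 \<longrightarrow> (\<forall>\<xi>\<in>tangent_space PV (cline \<psi>). \<forall>\<eta>\<in>tangent_space PV (cline \<psi>).
        proj_H (cline \<psi>) \<xi> \<eta> = 2 * cinner (\<xi> \<psi>) (\<eta> \<psi>))) \<and>
     kaehler_manifold PV proj_H \<and>
     principal_U1_bundle SV PV scaleC cline sphere_triv \<and>
     principal_connection SV scaleC sphere_alpha \<and>
     is_ext_deriv1 SV sphere_alpha (pullback2 SV PV cline proj_Omega) \<and>
     prequantum_line_bundle PV proj_Omega LV (assoc_proj cline)
       (assoc_add scaleC) (assoc_scale scaleC) taut_connection \<and>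
     (\<forall>p\<in>points PV. bij_betw taut_vector {l \<in> points LV. assoc_proj cline l = p} p) \<and>
     (\<forall>l\<in>points LV. \<forall>l'\<in>points LV. assoc_proj cline l' = assoc_proj cline l \<longrightarrow>
        taut_vector (assoc_add scaleC l l') = taut_vector l + taut_vector l') \<and>
     (\<forall>l\<in>points LV. \<forall>c. taut_vector (assoc_scale scaleC c l) = c *\<^sub>C taut_vector l)"
  unfolding PV_def SV_def LV_def
proof (intro conjI allI impI ballI)
  show "\<And>\<psi> \<xi> \<eta>. hnorm \<psi> = 1 \<Longrightarrow> \<xi> \<in> tangent_space proj_mfd (cline \<psi>) \<Longrightarrow>
      \<eta> \<in> tangent_space proj_mfd (cline \<psi>) \<Longrightarrow>
      proj_H (cline \<psi>) \<xi> \<eta> = 2 * cinner (\<xi> \<psi>) (\<eta> \<psi> :: 'v)"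
    by (rule proj_H_unit)
qed (rule kaehler_manifold_proj principal_U1_bundle_sphere principal_connection_sphere
    is_ext_deriv1_sphere prequantum_line_bundle_taut bij_betw_taut_vector taut_vector_add
    taut_vector_scale; assumption)+

end
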